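(* Let $0\neq(v,v^* )\in T_{\mathrm{gph}\,\widehat N_\Gamma}(\bar y,\bar y^* )$ and assume that $M_q$ is metrically subregular at $(\bar y,0)$ and metrically regular in the vicinity of $\bar y$. 1. If $v\neq0$, assume that 2-LICQ holds at $\bar y$ in direction $v$. Then $$N_{\mathrm{gph}\,\widehat N_\Gamma}((\bar y,\bar y^* );(v,v^* ))\subset\bigcup_{(\lambda,\mu)\in\bar{\mathcal M}(v,v^* ),\ \mathcal J\in\bar{\mathcal J}(v)}\ \ \bigcup_{I^+(\lambda,\mu)\subset I^+\subset\mathcal I\subset\mathcal J}Q(v,\lambda,I^+,\mathcal I),$$ and this inclusion holds with equality if for every maximal index set $\mathcal J\in\bar{\mathcal J}(v)$ the mapping $y\mapsto(q_i(y))_{i\in\mathcal J}$ is 2-regular at $\bar y$ in direction $v$. 2. If $v=0$, assume that 2-LICQ holds at $\bar y$ in every direction $0\neq u\in\bar K$. Then $$N^1_{\mathrm{gph}\,\widehat N_\Gamma}((\bar y,\bar y^* );(0,v^* ))\subset\bigcup_{\tilde v\in\bar K,\ \|\tilde v\|=1}\ \ \bigcup_{\substack{(\lambda,\mu)\in\bar{\mathcal M}(0,v^* ):\ \lambda\in\bar\Lambda(\tilde v)\\ \mathcal J\in\bar{\mathcal J}(\tilde v)}}\ \ \bigcup_{I^+(\lambda,\mu)\subset I^+\subset\mathcal I\subset\mathcal J}Q(\tilde v,\lambda,I^+,\mathcal I),$$ and equality holds if for every direction $0\neq u\in\bar K$ and every maximal index set $\mathcal J\in\bar{\mathcal J}(u)$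 the mapping $y\mapsto(q_i(y))_{i\in\mathcal J}$ is 2-regular at $\bar y$ in direction $u$.
   Context: Setting. $q=(q_1,\dots,q_l):\mathbb R^m\to\mathbb R^l$ is twice continuously differentiable, $\Gamma=\{y\in\mathbb R^m: q_i(y)\le0,\ i=1,\dots,l\}$, $\mathcal I(y)=\{i: q_i(y)=0\}$ for $y\in\Gamma$. $\nabla q(y)$ is the $l\times m$ Jacobian with rows $\nabla q_i(y)$. $K^\circ$ denotes the negative polar of a cone $K$. Variational notions. For closed (or arbitrary) $\Omega\subset\mathbb R^d$ and $\bar z\in\Omega$: $T_\Omega(\bar z)=\{u:\exists t_k\downarrow0,u_k\to u,\ \bar z+t_ku_k\in\Omega\ \forall k\}$ (contingent cone); $\widehat N_\Omega(\bar z)=(T_\Omega(\bar z))^\circ$ (regular normal cone), with $\widehat N_\Omega(z)=\emptyset$ for $z\notin\Omega$; the limiting normal cone in direction $u$ is $N_\Omega(\bar z;u)=\{z^*:\exists t_k\downarrow0,u_k\to u,z_k^*\to z^*,\ z_k^*\in\widehat N_\Omega(\bar z+t_ku_k)\ \forall k\}$. $\widehat N_\Gamma$ is regarded as the multifunction $y\mapsto\widehat N_\Gamma(y)$ with graph in $\mathbb R^m\times\mathbb R^m$. $N^1_{\mathrm{gph}\,\widehat N_\Gamma}((\bar y,\bar y^* );(0,v^* ))$ is the set of all $(w^*,w)$ for which there are $t_k\downarrow0$, $(v_k,v_k^* )\to(0,v^* )$, $(w_k^*,w_k)\to(w^*,w)$ with $v_k\neq0$ and $(w_k^*,w_k)\in\widehat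 N_{\mathrm{gph}\,\widehat N_\Gamma}(\bar y+t_kv_k,\bar y^*+t_kv_k^* )$ for all $k$. Regularity. A multifunction $\Psi:\mathbb R^d\rightrightarrows\mathbb R^s$ is metrically regular with modulus $\kappa>0$ near $(\bar u,\bar v)\in\mathrm{gph}\,\Psi$ if there are neighborhoods $U$ of $\bar u$, $V$ of $\bar v$ with $d(u,\Psi^{-1}(v))\le\kappa\, d(v,\Psi(u))$ for all $(u,v)\in U\times V$; it is metrically subregular at $(\bar u,\bar v)$ if for some $\kappa>0$ and neighborhood $U$ of $\bar u$, $d(u,\Psi^{-1}(\bar v))\le\kappa\, d(\bar v,\Psi(u))$ for all $u\in U$. $M_q(y):=q(y)-\mathbb R^l_-$ (so $M_q^{-1}(0)=\Gamma$). $M_q$ is metrically regular in the vicinity of $\bar y$ if there are a neighborhood $V$ of $\bar y$ and $\kappa>0$ such that for every $y\in\Gamma\cap V$, $y\neq\bar y$, $M_q$ is metrically regular near $(y,0)$ with modulus $\kappa$. 2-regularity. A map $g:\mathbb R^m\to\mathbb R^p$, twice Fréchet differentiable at $\bar y$, is 2-regular at $\bar y$ in direction $v$ if for every $\alpha\in\mathbb R^p$ the system $\nabla g(\bar y)u+v^T\nabla^2g(\bar y)w=\alpha$, $\nabla g(\bar y)w=0$ has a solution $(u,w)\in\mathbb R^m\times\mathbb R^m$, where $v^T\nabla^2g(\bar y)w$ is the vector with components $v^T\nabla^2g_i(\bar y)w$ (an empty family is 2-regular). For $\epsilon,\delta>0$: $V_{\epsilon,\delta}(v)=\{0\}\cup\{u\neq0:\|u\|\le\epsilon,\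 \|u/\|u\|-v/\|v\|\|\le\delta\}$ if $v\neq0$, and $V_{\epsilon,\delta}(0)$ is the closed ball of radius $\epsilon$ about $0$. With $T^{\rm lin}_\Gamma(\bar y)=\{v:\nabla q_i(\bar y)v\le0,\ i\in\mathcal I(\bar y)\}$, 2-LICQ holds at $\bar y$ in direction $v\in T^{\rm lin}_\Gamma(\bar y)$ if there are $\epsilon,\delta>0$ such that for every $y\in(\bar y+V_{\epsilon,\delta}(v))\cap\Gamma$, $y\neq\bar y$, the mapping $(q_i)_{i\in\mathcal I(y)}$ is 2-regular at $\bar y$ in direction $v$. Objects at the reference pair. Fix $\bar y\in\Gamma$, $\bar y^*\in\widehat N_\Gamma(\bar y)$. $\bar{\mathcal I}=\mathcal I(\bar y)$; $N_{\mathbb R^l_-}(q(\bar y))=\{\lambda\in\mathbb R^l_+:\lambda_i=0,\ i\notin\bar{\mathcal I}\}$; $\bar\Lambda=\{\lambda\in N_{\mathbb R^l_-}(q(\bar y)):\nabla q(\bar y)^T\lambda=\bar y^*\}$; $\bar K=T_\Gamma(\bar y)\cap(\bar y^* )^\perp$. For $v\in T^{\rm lin}_\Gamma(\bar y)$: $\bar{\mathcal I}(v)=\{i\in\bar{\mathcal I}:\nabla q_i(\bar y)v=0\}$; $\bar\Lambda(v)$ is the solution set of $\max_{\lambda\in\bar\Lambda}v^T\nabla^2(\lambda^Tq)(\bar y)v$; $\bar\Xi(v)=\{z\in\mathbb R^m:\nabla q_i(\bar y)z+v^T\nabla^2q_i(\bar y)v\le0,\ i\in\bar{\mathcal I}\}$;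 for $z\in\bar\Xi(v)$, $\mathcal J(z)=\{i\in\bar{\mathcal I}(v):\nabla q_i(\bar y)z+v^T\nabla^2q_i(\bar y)v=0\}$; $\bar{\mathcal J}(v)=\{\mathcal J(z):z\in\bar\Xi(v)\}$; an element of $\bar{\mathcal J}(v)$ is maximal if it is maximal with respect to inclusion within $\bar{\mathcal J}(v)$. $\bar{\mathcal M}(v,v^* )=\{(\lambda,\mu):\lambda\in\bar\Lambda(v),\ \mu\in T_{N_{\mathbb R^l_-}(q(\bar y))}(\lambda),\ v^*=\nabla^2(\lambda^Tq)(\bar y)v+\nabla q(\bar y)^T\mu\}$. $I^+(\lambda)=\{i:\lambda_i>0\}$ and, for $(\lambda,\mu)\in\bar{\mathcal M}(v,v^* )$, $I^+(\lambda,\mu)=I^+(\lambda)\cup\{i:\lambda_i=0,\mu_i>0\}$. For $I^+\subset\mathcal I\subset\bar{\mathcal I}$: $\bar K_{I^+,\mathcal I}=\{w:\nabla q_i(\bar y)w=0,\ i\in I^+;\ \nabla q_i(\bar y)w\le0,\ i\in\mathcal I\setminus I^+\}$; $\bar K_{I^+,\mathcal I}(v)$ is the set of $w\in\bar K_{I^+,\mathcal I}$ for which there is $z\in\mathbb R^m$ with $\nabla q_i(\bar y)z+v^T\nabla^2q_i(\bar y)w=0$ for $i\in I^+$ and $\le0$ for $i\in\mathcal I\setminus I^+$; and $Q(v,\lambda,I^+,\mathcal I)=\{(w^*,w): w\in\bar K_{I^+,\mathcal I}(v),\ w^*+\nabla^2(\lambda^Tq)(\bar y)w\in(\bar K_{I^+,\mathcal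 I}(v))^\circ\}$. *)

theory Defs
  imports "HOL-Analysis.Analysis"
begin

definition grad :: "(real^'m \<Rightarrow> real) \<Rightarrow> real^'m \<Rightarrow> real^'m" where
  "grad f y = (\<chi> j. frechet_derivative f (at y) (axis j 1))"

definition hess :: "(real^'m \<Rightarrow> real) \<Rightarrow> real^'m \<Rightarrow> real^'m^'m" where
  "hess f y = jacobian (grad f) (at y)"

definition twice_cont_diff :: "(real^'m \<Rightarrow> real^'l) \<Rightarrow> bool" where
  "twice_cont_diff q \<longleftrightarrow>
     (\<forall>i. (\<forall>y. (\<lambda>x. q x $ i) differentiable (at y))
        \<and> (\<forall>y. grad (\<lambda>x. q x $ i) differentiable (at y))
        \<and> continuous_on UNIV (hess (\<lambda>x. q x $ i)))"

definition neg_polar :: "'a::real_inner set \<Rightarrow> 'a set" where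
  "neg_polar K = {z. \<forall>u\<in>K. z \<bullet> u \<le> 0}"

definition contingent_cone :: "'a::real_normed_vector set \<Rightarrow> 'a \<Rightarrow> 'a set" where
  "contingent_cone \<Omega> z =
     {u. \<exists>(t::nat \<Rightarrow> real) U. (\<forall>k. t k > 0) \<and> t \<longlonglongrightarrow> 0 \<and> U \<longlonglongrightarrow> u
           \<and> (\<forall>k. z + t k *\<^sub>R U k \<in> \<Omega>)}"

definition regular_normal_cone :: "'a::real_inner set \<Rightarrow> 'a \<Rightarrow> 'a set" where
  "regular_normal_cone \<Omega> z = (if z \<in> \<Omega> then neg_polar (contingent_cone \<Omega> z) else {})"

definition dir_normal_cone :: "'a::real_inner set \<Rightarrow> 'a \<Rightarrow> 'a \<Rightarrow> 'a set" where
  "dir_normal_cone \<Omega> z u =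
     {zs. \<exists>(t::nat \<Rightarrow> real) U Z. (\<forall>k. t k > 0) \<and> t \<longlonglongrightarrow> 0 \<and> U \<longlonglongrightarrow> u \<and> Z \<longlonglongrightarrow> zs
           \<and> (\<forall>k. Z k \<in> regular_normal_cone \<Omega> (z + t k *\<^sub>R U k))}"

definition gph :: "('a \<Rightarrow> 'b set) \<Rightarrow> ('a \<times> 'b) set" where
  "gph \<Psi> = {(x, y). y \<in> \<Psi> x}"

definition dir_normal_cone1 ::
  "('a::real_inner \<times> 'b::real_inner) set \<Rightarrow> 'a \<times> 'b \<Rightarrow> 'a \<times> 'b \<Rightarrow> ('a \<times> 'b) set" where
  "dir_normal_cone1 \<Omega> z u =
     {zs. \<exists>(t::nat \<Rightarrow> real) U Z. (\<forall>k. t k > 0) \<and> t \<longlonglongrightarrow> 0 \<and> U \<longlonglongrightarrow> u \<and> Z \<longlonglongrightarrow> zs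
           \<and> (\<forall>k. fst (U k) \<noteq> 0)
           \<and> (\<forall>k. Z k \<in> regular_normal_cone \<Omega> (z + t k *\<^sub>R U k))}"

text \<open>The distance to the empty set has to be infinite (whereas \<open>infdist x {} = 0\<close>).\<close>

definition edist :: "'a::metric_space \<Rightarrow> 'a set \<Rightarrow> ereal" where
  "edist x A = (INF a\<in>A. ereal (dist x a))"

definition inv_mf :: "('a \<Rightarrow> 'b set) \<Rightarrow> 'b \<Rightarrow> 'a set" where
  "inv_mf \<Psi> y = {x. y \<in> \<Psi> x}"

definition metrically_regular ::
  "real \<Rightarrow> ('a::metric_space \<Rightarrow> 'b::metric_space set) \<Rightarrow> 'a \<Rightarrow> 'b \<Rightarrow> bool" where
  "metrically_regular \<kappa> \<Psi> x0 y0 \<longleftrightarrow>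
     (x0, y0) \<in> gph \<Psi> \<and>
     (\<exists>U V. open U \<and> x0 \<in> U \<and> open V \<and> y0 \<in> V
        \<and> (\<forall>x\<in>U. \<forall>y\<in>V. edist x (inv_mf \<Psi> y) \<le> ereal \<kappa> * edist y (\<Psi> x)))"

definition metrically_subregular ::
  "('a::metric_space \<Rightarrow> 'b::metric_space set) \<Rightarrow> 'a \<Rightarrow> 'b \<Rightarrow> bool" where
  "metrically_subregular \<Psi> x0 y0 \<longleftrightarrow>
     (x0, y0) \<in> gph \<Psi> \<and>
     (\<exists>\<kappa>>0. \<exists>U. open U \<and> x0 \<in> U
        \<and> (\<forall>x\<in>U. edist x (inv_mf \<Psi> y0) \<le> ereal \<kappa> * edist y0 (\<Psi> x)))"

definition Gam :: "(real^'m \<Rightarrow> real^'l) \<Rightarrow> (real^'m) set" where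
  "Gam q = {y. \<forall>i. q y $ i \<le> 0}"

definition active :: "(real^'m \<Rightarrow> real^'l) \<Rightarrow> real^'m \<Rightarrow> 'l set" where
  "active q y = {i. q y $ i = 0}"

definition Mq :: "(real^'m \<Rightarrow> real^'l) \<Rightarrow> real^'m \<Rightarrow> (real^'l) set" where
  "Mq q y = {q y - p | p. \<forall>i. p $ i \<le> 0}"

definition metrically_regular_vicinity :: "(real^'m \<Rightarrow> real^'l) \<Rightarrow> real^'m \<Rightarrow> bool" where
  "metrically_regular_vicinity q y0 \<longleftrightarrow>
     (\<exists>V \<kappa>. open V \<and> y0 \<in> V \<and> \<kappa> > 0
        \<and> (\<forall>y \<in> Gam q \<inter> V. y \<noteq> y0 \<longrightarrow> metrically_regular \<kappa> (Mq q) y 0))"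

definition gradq :: "(real^'m \<Rightarrow> real^'l) \<Rightarrow> 'l \<Rightarrow> real^'m \<Rightarrow> real^'m" where
  "gradq q i y = grad (\<lambda>x. q x $ i) y"

definition hessq :: "(real^'m \<Rightarrow> real^'l) \<Rightarrow> 'l \<Rightarrow> real^'m \<Rightarrow> real^'m^'m" where
  "hessq q i y = hess (\<lambda>x. q x $ i) y"

definition hessL :: "(real^'m \<Rightarrow> real^'l) \<Rightarrow> real^'l \<Rightarrow> real^'m \<Rightarrow> real^'m^'m" where
  "hessL q lam y = hess (\<lambda>x. lam \<bullet> q x) y"

definition Tlin :: "(real^'m \<Rightarrow> real^'l) \<Rightarrow> real^'m \<Rightarrow> (real^'m) set" where
  "Tlin q y = {v. \<forall>i \<in> active q y. gradq q i y \<bullet> v \<le> 0}"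

text \<open>2-regularity of the mapping whose components are \<open>q\<^sub>i\<close>, \<open>i \<in> J\<close>; only the values
  of \<open>\<alpha>\<close> on \<open>J\<close> matter, so \<open>\<alpha>\<close> represents an arbitrary vector with
  \<open>card J\<close> components. For \<open>J = {}\<close> the condition holds trivially.\<close>

definition two_regular ::
  "(real^'m \<Rightarrow> real^'l) \<Rightarrow> 'l set \<Rightarrow> real^'m \<Rightarrow> real^'m \<Rightarrow> bool" where
  "two_regular q J y v \<longleftrightarrow>
     (\<forall>\<alpha>::'l \<Rightarrow> real. \<exists>u w. \<forall>i\<in>J.
        gradq q i y \<bullet> u + v \<bullet> (hessq q i y *v w) = \<alpha> i \<and> gradq q i y \<bullet> w = 0)"

definition dir_nbhd :: "real \<Rightarrow> real \<Rightarrow> 'a::real_normed_vector \<Rightarrow> 'a set" where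
  "dir_nbhd \<epsilon> \<delta> v =
     (if v = 0 then cball 0 \<epsilon>
      else {0} \<union> {u. u \<noteq> 0 \<and> norm u \<le> \<epsilon> \<and> norm (u /\<^sub>R norm u - v /\<^sub>R norm v) \<le> \<delta>})"

definition two_LICQ :: "(real^'m \<Rightarrow> real^'l) \<Rightarrow> real^'m \<Rightarrow> real^'m \<Rightarrow> bool" where
  "two_LICQ q y0 v \<longleftrightarrow>
     v \<in> Tlin q y0 \<and>
     (\<exists>\<epsilon>>0. \<exists>\<delta>>0. \<forall>y \<in> (\<lambda>u. y0 + u) ` dir_nbhd \<epsilon> \<delta> v \<inter> Gam q.
        y \<noteq> y0 \<longrightarrow> two_regular q (active q y) y0 v)"

definition normal_orthant :: "(real^'m \<Rightarrow> real^'l) \<Rightarrow> real^'m \<Rightarrow> (real^'l) set" where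
  "normal_orthant q y = {lam. (\<forall>i. lam $ i \<ge> 0) \<and> (\<forall>i. i \<notin> active q y \<longrightarrow> lam $ i = 0)}"

definition Lam :: "(real^'m \<Rightarrow> real^'l) \<Rightarrow> real^'m \<Rightarrow> real^'m \<Rightarrow> (real^'l) set" where
  "Lam q y ys = {lam \<in> normal_orthant q y. transpose (jacobian q (at y)) *v lam = ys}"

definition critK :: "(real^'m \<Rightarrow> real^'l) \<Rightarrow> real^'m \<Rightarrow> real^'m \<Rightarrow> (real^'m) set" where
  "critK q y ys = contingent_cone (Gam q) y \<inter> {u. ys \<bullet> u = 0}"

definition active_dir :: "(real^'m \<Rightarrow> real^'l) \<Rightarrow> real^'m \<Rightarrow> real^'m \<Rightarrow> 'l set" where
  "active_dir q y v = {i \<in> active q y. gradq q i y \<bullet> v = 0}"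

definition Lam_dir ::
  "(real^'m \<Rightarrow> real^'l) \<Rightarrow> real^'m \<Rightarrow> real^'m \<Rightarrow> real^'m \<Rightarrow> (real^'l) set" where
  "Lam_dir q y ys v =
     {lam \<in> Lam q y ys. \<forall>lam' \<in> Lam q y ys.
        v \<bullet> (hessL q lam' y *v v) \<le> v \<bullet> (hessL q lam y *v v)}"

definition Xi :: "(real^'m \<Rightarrow> real^'l) \<Rightarrow> real^'m \<Rightarrow> real^'m \<Rightarrow> (real^'m) set" where
  "Xi q y v = {z. \<forall>i \<in> active q y. gradq q i y \<bullet> z + v \<bullet> (hessq q i y *v v) \<le> 0}"

definition Jz :: "(real^'m \<Rightarrow> real^'l) \<Rightarrow> real^'m \<Rightarrow> real^'m \<Rightarrow> real^'m \<Rightarrow> 'l set" where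
  "Jz q y v z = {i \<in> active_dir q y v. gradq q i y \<bullet> z + v \<bullet> (hessq q i y *v v) = 0}"

definition Jbar :: "(real^'m \<Rightarrow> real^'l) \<Rightarrow> real^'m \<Rightarrow> real^'m \<Rightarrow> 'l set set" where
  "Jbar q y v = Jz q y v ` Xi q y v"

definition Jmax :: "(real^'m \<Rightarrow> real^'l) \<Rightarrow> real^'m \<Rightarrow> real^'m \<Rightarrow> 'l set set" where
  "Jmax q y v = {J \<in> Jbar q y v. \<forall>J' \<in> Jbar q y v. J \<subseteq> J' \<longrightarrow> J' = J}"

definition Mbar ::
  "(real^'m \<Rightarrow> real^'l) \<Rightarrow> real^'m \<Rightarrow> real^'m \<Rightarrow> real^'m \<Rightarrow> real^'m \<Rightarrow> ((real^'l) \<times> (real^'l)) set" where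
  "Mbar q y ys v vs =
     {(lam, mu). lam \<in> Lam_dir q y ys v
        \<and> mu \<in> contingent_cone (normal_orthant q y) lam
        \<and> vs = hessL q lam y *v v + transpose (jacobian q (at y)) *v mu}"

definition Iplus :: "real^'l \<Rightarrow> real^'l \<Rightarrow> 'l set" where
  "Iplus lam mu = {i. lam $ i > 0} \<union> {i. lam $ i = 0 \<and> mu $ i > 0}"

definition KI :: "(real^'m \<Rightarrow> real^'l) \<Rightarrow> real^'m \<Rightarrow> 'l set \<Rightarrow> 'l set \<Rightarrow> (real^'m) set" where
  "KI q y Ip I =
     {w. (\<forall>i\<in>Ip. gradq q i y \<bullet> w = 0) \<and> (\<forall>i\<in>I - Ip. gradq q i y \<bullet> w \<le> 0)}"

definition KI_dir ::
  "(real^'m \<Rightarrow> real^'l) \<Rightarrow> real^'m \<Rightarrow> 'l set \<Rightarrow> 'l set \<Rightarrow> real^'m \<Rightarrow> (real^'m) set" where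
  "KI_dir q y Ip I v =
     {w \<in> KI q y Ip I. \<exists>z.
        (\<forall>i\<in>Ip. gradq q i y \<bullet> z + v \<bullet> (hessq q i y *v w) = 0)
      \<and> (\<forall>i\<in>I - Ip. gradq q i y \<bullet> z + v \<bullet> (hessq q i y *v w) \<le> 0)}"

definition Qset ::
  "(real^'m \<Rightarrow> real^'l) \<Rightarrow> real^'m \<Rightarrow> real^'m \<Rightarrow> real^'l \<Rightarrow> 'l set \<Rightarrow> 'l set
     \<Rightarrow> ((real^'m) \<times> (real^'m)) set" where
  "Qset q y v lam Ip I =
     {(ws, w). w \<in> KI_dir q y Ip I v
        \<and> ws + hessL q lam y *v w \<in> neg_polar (KI_dir q y Ip I v)}"

end

theory Submission
  imports Defs
begin

text \<open>
  A sequence realising a directional normal has, along a subsequence, a constant active set \<open>I\<close>, a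
  constant set \<open>Ip\<close> of positive multipliers and, by metric regularity, convergent multipliers.
  Second-order expansion along the sequence shows that the limit multiplier lies in \<open>Lam_dir\<close> and
  that \<open>I\<close> is contained in some \<open>J \<in> Jbar\<close>. By 2-regularity the active gradients are linearly
  independent along the sequence, so the regular normals to the graph are those of \<open>Qset\<close> type for
  the critical cones \<open>KI\<close> at the nearby points; these cones converge to \<open>KI_dir\<close>, and so do their
  polars.

  Conversely, for maximal \<open>J\<close> the gradients indexed by \<open>J\<close> have the same kernel as those indexed by
  \<open>active_dir\<close>. Brouwer's theorem then yields feasible points approaching \<open>y\<close> in the given direction
  with active set exactly \<open>I\<close>, and perturbing the multiplier makes it positive exactly on \<open>Ip\<close>.
\<close>

section \<open>Second-order calculus\<close>

text \<open>At \<open>y\<close> itself the active gradients may be dependent and the multiplier set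
  unbounded, so regularity is exploited at feasible points other than \<open>y\<close>. A uniform
  modulus bounds the multipliers there, and 2-regularity makes the active gradients near
  \<open>y + s u\<close> independent with a right inverse of order \<open>1 / s\<close>. This loss
  of one order is why the cones \<open>KI\<close> converge not to \<open>KI\<close> at
  \<open>y\<close> but to \<open>KI_dir\<close>, whose auxiliary \<open>z\<close> records a
  second-order term. Natural candidates for limits, such as \<open>w k / s k\<close>,
  \<open>(L k - lam) / t k\<close> or \<open>(2 / s k) U k\<close>, can be unbounded. No subsequence
  is drawn from them: linear images of orthants are closed, so the limiting linear system is
  solvable. Points and normals may move at different speeds \<open>s\<close> and \<open>t\<close>,
  and only the limit \<beta> of \<open>s / t\<close> matters. For \<open>v = 0\<close> it is 0: the
  Hessian term disappears from \<open>vs\<close>, and the direction of the points is recovered by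
  normalisation. Brouwer's theorem stands in for an implicit function theorem, since the Jacobian
  may degenerate at \<open>y\<close> and only a solution of the right size is wanted.\<close>

abbreviation gradsum :: "(real^'m \<Rightarrow> real^'l) \<Rightarrow> real^'m \<Rightarrow> real^'l \<Rightarrow> real^'m" where
  "gradsum q x lam \<equiv> (\<Sum>i\<in>UNIV. lam $ i *\<^sub>R gradq q i x)"

lemma has_derivative_grad:
  fixes f :: "real^'m \<Rightarrow> real"
  assumes "f differentiable (at y)"
  shows "(f has_derivative (\<lambda>h. grad f y \<bullet> h)) (at y)"
proof -
  let ?D = "frechet_derivative f (at y)"
  have D: "(f has_derivative ?D) (at y)"
    using assms frechet_derivative_works by blast
  then have lin: "linear ?D"
    by (rule has_derivative_linear)
  have "?D h = grad f y \<bullet> h" for h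
  proof -
    have "?D h = ?D (\<Sum>j\<in>UNIV. h $ j *\<^sub>R axis j 1)"
      using basis_expansion[of h] by (simp add: scalar_mult_eq_scaleR)
    also have "\<dots> = (\<Sum>j\<in>UNIV. h $ j *\<^sub>R ?D (axis j 1))"
      by (simp add: linear_sum[OF lin] linear_cmul[OF lin])
    finally show ?thesis
      by (simp add: grad_def inner_vec_def mult.commute)
  qed
  then have "?D = (\<lambda>h. grad f y \<bullet> h)" by auto
  with D show ?thesis by simp
qed

lemma grad_unique:
  fixes f :: "real^'m \<Rightarrow> real"
  assumes "(f has_derivative (\<lambda>h. a \<bullet> h)) (at y)"
  shows "grad f y = a"
proof -
  have "frechet_derivative f (at y) = (\<lambda>h. a \<bullet> h)"
    using frechet_derivative_at[OF assms] by simp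
  then show ?thesis
    by (simp add: grad_def vec_eq_iff inner_axis)
qed

lemma jacobian_unique:
  fixes f :: "real^'m \<Rightarrow> real^'n"
  assumes "(f has_derivative f') (at y)"
  shows "jacobian f (at y) *v h = f' h"
proof -
  have "(f has_derivative (\<lambda>h. jacobian f (at y) *v h)) (at y)"
    using assms jacobian_works differentiableI by blast
  from has_derivative_unique[OF this assms] show ?thesis by metis
qed

context
  fixes q :: "real^'m \<Rightarrow> real^'l"
  assumes q2: "twice_cont_diff q"
begin

lemma gradq_deriv: "((\<lambda>x. q x $ i) has_derivative (\<lambda>h. gradq q i x \<bullet> h)) (at x)"
  unfolding gradq_def using q2 by (intro has_derivative_grad) (auto simp: twice_cont_diff_def)

lemma hessq_deriv: "(gradq q i has_derivative (\<lambda>h. hessq q i x *v h)) (at x)"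
proof -
  have "grad (\<lambda>x. q x $ i) differentiable (at x)"
    using q2 by (auto simp: twice_cont_diff_def)
  then show ?thesis
    unfolding jacobian_works hessq_def hess_def
    by (simp add: gradq_def[abs_def])
qed

lemma hessq_continuous: "continuous_on UNIV (hessq q i)"
  using q2 by (auto simp: twice_cont_diff_def hessq_def[abs_def])

lemma gradq_continuous: "continuous_on UNIV (gradq q i)"
  by (simp add: continuous_at_imp_continuous_on has_derivative_continuous[OF hessq_deriv])

lemma comp_continuous: "continuous_on UNIV (\<lambda>x. q x $ i)"
  by (simp add: continuous_at_imp_continuous_on has_derivative_continuous[OF gradq_deriv])

lemma q_deriv: "(q has_derivative (\<lambda>h. \<chi> i. gradq q i x \<bullet> h)) (at x)"
proof -
  have "((\<lambda>x. q x \<bullet> b) has_derivative (\<lambda>h. (\<chi> i. gradq q i x \<bullet> h) \<bullet> b)) (at x)"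
    if b: "b \<in> Basis" for b
  proof -
    obtain i where "b = axis i 1"
      using b by (auto simp: Basis_vec_def)
    then show ?thesis
      using gradq_deriv[of i x] by (simp add: inner_axis)
  qed
  then show ?thesis
    using has_derivative_componentwise_within[of q _ x UNIV] by blast
qed

lemma transpose_jacobian:
  "transpose (jacobian q (at x)) *v lam = gradsum q x lam"
proof -
  have "jacobian q (at x) $ i $ j = gradq q i x $ j" for i j
    using jacobian_unique[OF q_deriv, of x "axis j 1"]
    by (simp add: matrix_vector_mult_basis column_def vec_eq_iff inner_axis)
  then show ?thesis
    by (simp add: vec_eq_iff matrix_vector_mult_def transpose_def mult.commute)
qed

lemma grad_lagrangian: "grad (\<lambda>x. lam \<bullet> q x) x = gradsum q x lam"
proof (rule grad_unique)
  have "((\<lambda>x. \<Sum>i\<in>UNIV. lam $ i * q x $ i) has_derivative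
          (\<lambda>h. \<Sum>i\<in>UNIV. lam $ i * (gradq q i x \<bullet> h))) (at x)"
    by (intro has_derivative_sum has_derivative_mult_right gradq_deriv)
  then show "((\<lambda>x. lam \<bullet> q x) has_derivative
      (\<lambda>h. gradsum q x lam \<bullet> h)) (at x)"
    by (simp add: inner_vec_def[of lam] inner_sum_left)
qed

lemma hessL_mult: "hessL q lam x *v h = (\<Sum>i\<in>UNIV. lam $ i *\<^sub>R (hessq q i x *v h))"
proof -
  have eq: "grad (\<lambda>x. lam \<bullet> q x) = (\<lambda>x. \<Sum>i\<in>UNIV. lam $ i *\<^sub>R gradq q i x)"
    using grad_lagrangian by auto
  have "((\<lambda>x. \<Sum>i\<in>UNIV. lam $ i *\<^sub>R gradq q i x) has_derivative
     (\<lambda>h. \<Sum>i\<in>UNIV. lam $ i *\<^sub>R (hessq q i x *v h))) (at x)"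
    by (intro has_derivative_sum has_derivative_scaleR_right hessq_deriv)
  from jacobian_unique[OF this] show ?thesis
    unfolding hessL_def hess_def eq .
qed

lemma gradq_expansion:
  assumes "e > 0"
  shows "\<exists>d>0. \<forall>h. norm h \<le> d \<longrightarrow> norm (gradq q i (x + h) - gradq q i x - hessq q i x *v h) \<le> e * norm h"
proof -
  obtain d where d: "d > 0" "\<forall>y. norm (y - x) < d \<longrightarrow>
      norm (gradq q i y - gradq q i x - hessq q i x *v (y - x)) \<le> e * norm (y - x)"
    using hessq_deriv[of i x] assms unfolding has_derivative_at_alt by metis
  show ?thesis
  proof (intro exI conjI allI impI)
    show "d / 2 > 0" using d by simp
    fix h :: "real^'m" assume "norm h \<le> d / 2"
    then show "norm (gradq q i (x + h) - gradq q i x - hessq q i x *v h) \<le> e * norm h"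
      using d(2)[rule_format, of "x + h"] d(1) by simp
  qed
qed

text \<open>Differentiability of the gradient is enough for a symmetric Hessian, because the second
  difference is symmetric in \<open>a\<close> and \<open>b\<close>.\<close>

lemma second_difference:
  assumes e: "e > 0"
  shows "\<exists>d>0. \<forall>s. 0 < s \<and> s < d \<longrightarrow>
    \<bar>q (x + s *\<^sub>R a + s *\<^sub>R b) $ i - q (x + s *\<^sub>R a) $ i - q (x + s *\<^sub>R b) $ i + q x $ i
      - s\<^sup>2 * (a \<bullet> (hessq q i x *v b))\<bar> \<le> e * s\<^sup>2"
proof -
  define B where "B = norm a + norm b + 1"
  have B: "B > 0" by (simp add: B_def add_nonneg_pos)
  \<comment> \<open>Normalised for the final estimate: the derivative bound
    \<open>2 * e' * s * B\<close> times the segment length, at most \<open>s * B\<close>, is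
    \<open>e * s\<^sup>2\<close>.\<close>
  define e' where "e' = e / (2 * B * B)"
  have e': "e' > 0" using e B by (simp add: e'_def)
  obtain d where d: "d > 0" "\<And>h. norm h \<le> d \<Longrightarrow>
      norm (gradq q i (x + h) - gradq q i x - hessq q i x *v h) \<le> e' * norm h"
    using gradq_expansion[OF e', of i x] by blast
  show ?thesis
  proof (intro exI[of _ "d / B"] conjI allI impI)
    show "d / B > 0" using d B by simp
    fix s :: real assume s: "0 < s \<and> s < d / B"
    then have sB: "s * B \<le> d" using B by (simp add: field_simps)
    have gr: "norm (gradq q i (x + h) - gradq q i x - hessq q i x *v h) \<le> e' * (s * B)"
      if "norm h \<le> s * B" for h
    proof -
      have "e' * norm h \<le> e' * (s * B)" using that e' by (intro mult_left_mono) auto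
      with d(2)[of h] that sB show ?thesis by linarith
    qed
    \<comment> \<open>Differencing in direction \<open>b\<close> first leaves a function whose
      gradient \<open>L p\<close> is a difference of two first-order expansions at \<open>x\<close>,
      hence close to the constant \<open>H\<close>; the mean value inequality along \<open>a\<close>
      then yields the mixed term.\<close>
    define f where "f = (\<lambda>p. q (p + s *\<^sub>R b) $ i - q p $ i)"
    define S where "S = closed_segment x (x + s *\<^sub>R a)"
    have nz: "norm h \<le> s * norm a" if hS: "x + h \<in> S" for h
    proof -
      obtain u where u: "0 \<le> u" "u \<le> 1" "x + h = (1 - u) *\<^sub>R x + u *\<^sub>R (x + s *\<^sub>R a)"
        using hS unfolding S_def in_segment by auto
      then have "h = (u * s) *\<^sub>R a" by (simp add: algebra_simps)
      then show ?thesis using u s by (simp add: mult_left_le_one_le mult.assoc mult_right_mono)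
    qed
    define L where "L = (\<lambda>p. (gradq q i (p + s *\<^sub>R b) - gradq q i p))"
    define H where "H = hessq q i x *v (s *\<^sub>R b)"
    have df: "((\<lambda>p. f p - H \<bullet> p) has_derivative (\<lambda>h. (L p - H) \<bullet> h)) (at p within S)" for p
    proof -
      have "((\<lambda>p. q (p + s *\<^sub>R b) $ i) has_derivative (\<lambda>h. gradq q i (p + s *\<^sub>R b) \<bullet> h)) (at p within S)"
        by (rule has_derivative_compose[OF _ gradq_deriv, of "\<lambda>p. p + s *\<^sub>R b" "\<lambda>h. h" p S])
          (auto intro!: derivative_eq_intros)
      moreover have "((\<lambda>p. q p $ i) has_derivative (\<lambda>h. gradq q i p \<bullet> h)) (at p within S)"
        using gradq_deriv has_derivative_at_withinI by blast
      ultimately show ?thesis unfolding f_def L_def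
        by (auto intro!: derivative_eq_intros simp: inner_diff_left)
    qed
    have bd: "onorm (\<lambda>h. (L p - H) \<bullet> h) \<le> 2 * e' * s * B" if "p \<in> S" for p
    proof -
      define h where "h = p - x"
      have h: "norm h \<le> s * norm a" using nz[of h] that by (simp add: h_def)
      have "s * norm a \<le> s * B" using s by (intro mult_left_mono) (auto simp: B_def add_nonneg_nonneg)
      with h have h1: "norm h \<le> s * B" by linarith
      have h2: "norm (h + s *\<^sub>R b) \<le> s * B"
      proof -
        have "norm (h + s *\<^sub>R b) \<le> s * norm a + s * norm b"
          using norm_triangle_ineq[of h "s *\<^sub>R b"] h s by simp
        also have "\<dots> \<le> s * B" using s by (simp add: B_def algebra_simps)
        finally show ?thesis .
      qed
      have "L p - H = (gradq q i (x + (h + s *\<^sub>R b)) - gradq q i x - hessq q i x *v (h + s *\<^sub>R b))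
           - (gradq q i (x + h) - gradq q i x - hessq q i x *v h)"
        by (simp add: L_def H_def h_def algebra_simps matrix_vector_right_distrib
            matrix_vector_mult_diff_distrib)
      then have "norm (L p - H) \<le> 2 * e' * s * B"
        using gr[OF h1] gr[OF h2] norm_triangle_ineq4[of "gradq q i (x + (h + s *\<^sub>R b)) - gradq q i x - hessq q i x *v (h + s *\<^sub>R b)"
           "gradq q i (x + h) - gradq q i x - hessq q i x *v h"] by (simp add: mult.assoc)
      moreover have "onorm (\<lambda>h. (L p - H) \<bullet> h) \<le> norm (L p - H)"
        by (rule onorm_le) (simp add: Cauchy_Schwarz_ineq2)
      ultimately show ?thesis by linarith
    qed
    have "norm ((f (x + s *\<^sub>R a) - H \<bullet> (x + s *\<^sub>R a)) - (f x - H \<bullet> x))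
        \<le> 2 * e' * s * B * norm (x + s *\<^sub>R a - x)"
      by (rule differentiable_bound[of S _ "\<lambda>p h. (L p - H) \<bullet> h"])
        (use df bd in \<open>auto simp: S_def\<close>)
    also have "\<dots> \<le> 2 * e' * s * B * (s * B)"
      using s e' B unfolding B_def by (intro mult_left_mono) (auto intro!: mult_left_mono)
    also have "\<dots> = e * s\<^sup>2"
      using B by (simp add: e'_def power2_eq_square)
    finally have "\<bar>f (x + s *\<^sub>R a) - f x - H \<bullet> (s *\<^sub>R a)\<bar> \<le> e * s\<^sup>2"
      by (simp add: inner_add_right algebra_simps)
    moreover have "H \<bullet> (s *\<^sub>R a) = s\<^sup>2 * (a \<bullet> (hessq q i x *v b))"
      by (simp add: H_def matrix_vector_mult_scaleR power2_eq_square inner_commute)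
    moreover have "f (x + s *\<^sub>R a) - f x
       = q (x + s *\<^sub>R a + s *\<^sub>R b) $ i - q (x + s *\<^sub>R a) $ i - q (x + s *\<^sub>R b) $ i + q x $ i"
      by (simp add: f_def)
    ultimately show "\<bar>q (x + s *\<^sub>R a + s *\<^sub>R b) $ i - q (x + s *\<^sub>R a) $ i - q (x + s *\<^sub>R b) $ i + q x $ i
      - s\<^sup>2 * (a \<bullet> (hessq q i x *v b))\<bar> \<le> e * s\<^sup>2" by simp
  qed
qed

lemma hessq_sym: "a \<bullet> (hessq q i x *v b) = b \<bullet> (hessq q i x *v a)"
proof -
  have "\<bar>a \<bullet> (hessq q i x *v b) - b \<bullet> (hessq q i x *v a)\<bar> \<le> e" if "e > 0" for e
  proof -
    have e: "e / 2 > 0" using that by simp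
    obtain d1 where d1: "d1 > 0" "\<And>s. 0 < s \<Longrightarrow> s < d1 \<Longrightarrow>
      \<bar>q (x + s *\<^sub>R a + s *\<^sub>R b) $ i - q (x + s *\<^sub>R a) $ i - q (x + s *\<^sub>R b) $ i + q x $ i
      - s\<^sup>2 * (a \<bullet> (hessq q i x *v b))\<bar> \<le> e / 2 * s\<^sup>2"
      using second_difference[OF e, of x a b i] by blast
    obtain d2 where d2: "d2 > 0" "\<And>s. 0 < s \<Longrightarrow> s < d2 \<Longrightarrow>
      \<bar>q (x + s *\<^sub>R b + s *\<^sub>R a) $ i - q (x + s *\<^sub>R b) $ i - q (x + s *\<^sub>R a) $ i + q x $ i
      - s\<^sup>2 * (b \<bullet> (hessq q i x *v a))\<bar> \<le> e / 2 * s\<^sup>2"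
      using second_difference[OF e, of x b a i] by blast
    define s where "s = min d1 d2 / 2"
    have s: "0 < s" "s < d1" "s < d2" using d1 d2 by (auto simp: s_def)
    define \<Delta> where "\<Delta> = q (x + s *\<^sub>R a + s *\<^sub>R b) $ i - q (x + s *\<^sub>R a) $ i - q (x + s *\<^sub>R b) $ i + q x $ i"
    have \<Delta>': "\<Delta> = q (x + s *\<^sub>R b + s *\<^sub>R a) $ i - q (x + s *\<^sub>R b) $ i - q (x + s *\<^sub>R a) $ i + q x $ i"
      unfolding \<Delta>_def by (simp add: add_ac)
    have "\<bar>s\<^sup>2 * (a \<bullet> (hessq q i x *v b)) - s\<^sup>2 * (b \<bullet> (hessq q i x *v a))\<bar> \<le> e * s\<^sup>2"
      using d1(2)[OF s(1,2), folded \<Delta>_def] d2(2)[OF s(1,3), folded \<Delta>'] by argo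
    then have "s\<^sup>2 * \<bar>a \<bullet> (hessq q i x *v b) - b \<bullet> (hessq q i x *v a)\<bar> \<le> s\<^sup>2 * e"
      by (simp flip: right_diff_distrib add: abs_mult mult.commute)
    then show ?thesis using s by simp
  qed
  \<comment> \<open>With half the gap itself as tolerance, a nonzero gap would be at most its own
    half.\<close>
  from this[of "\<bar>a \<bullet> (hessq q i x *v b) - b \<bullet> (hessq q i x *v a)\<bar> / 2"] show ?thesis
    by (cases "a \<bullet> (hessq q i x *v b) = b \<bullet> (hessq q i x *v a)") auto
qed

lemma hessL_sym: "a \<bullet> (hessL q lam x *v b) = b \<bullet> (hessL q lam x *v a)"
proof -
  have "a \<bullet> (lam $ i *\<^sub>R (hessq q i x *v b)) = b \<bullet> (lam $ i *\<^sub>R (hessq q i x *v a))" for i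
    unfolding inner_scaleR_right hessq_sym[of a i x b] ..
  then show ?thesis unfolding hessL_mult inner_sum_right by presburger
qed

text \<open>Symmetry of the Hessian makes the gradient of the quadratic remainder equal to the
  first-order remainder of \<open>gradq\<close>, so the mean value inequality on the segment from
  \<open>0\<close> to \<open>h\<close> suffices.\<close>

lemma second_order_taylor:
  assumes e: "e > 0"
  shows "\<exists>d>0. \<forall>h. norm h \<le> d \<longrightarrow>
    \<bar>q (x + h) $ i - q x $ i - gradq q i x \<bullet> h - (h \<bullet> (hessq q i x *v h)) / 2\<bar> \<le> e * (norm h)\<^sup>2"
proof -
  obtain d where d: "d > 0" "\<And>h. norm h \<le> d \<Longrightarrow>
      norm (gradq q i (x + h) - gradq q i x - hessq q i x *v h) \<le> e * norm h"
    using gradq_expansion[OF e, of i x] by blast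
  show ?thesis
  proof (intro exI[of _ d] conjI allI impI)
    show "d > 0" by fact
    fix h :: "real^'m" assume h: "norm h \<le> d"
    define r where "r = (\<lambda>p. q (x + p) $ i - gradq q i x \<bullet> p - 1 / 2 * (p \<bullet> (hessq q i x *v p)))"
    define S where "S = closed_segment 0 h"
    define D where "D = (\<lambda>p. gradq q i (x + p) - gradq q i x - hessq q i x *v p)"
    have dr: "(r has_derivative (\<lambda>k. D p \<bullet> k)) (at p within S)" for p
    proof -
      have 1: "((\<lambda>p. q (x + p) $ i) has_derivative (\<lambda>h. gradq q i (x + p) \<bullet> h)) (at p within S)"
        by (rule has_derivative_compose[OF _ gradq_deriv, of "\<lambda>p. x + p" "\<lambda>h. h" p S])
          (auto intro!: derivative_eq_intros)
      have 2: "((\<lambda>p. hessq q i x *v p) has_derivative (\<lambda>k. hessq q i x *v k)) (at p within S)"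
        by (intro bounded_linear_imp_has_derivative) (simp add: matrix_vector_mul_bounded_linear)
      have "(r has_derivative (\<lambda>k. gradq q i (x + p) \<bullet> k - gradq q i x \<bullet> k -
          1 / 2 * (p \<bullet> (hessq q i x *v k) + k \<bullet> (hessq q i x *v p)))) (at p within S)"
        unfolding r_def
        by (intro has_derivative_diff has_derivative_mult_right has_derivative_inner 1 2
            has_derivative_ident has_derivative_inner_right)
      moreover have "p \<bullet> (hessq q i x *v k) + k \<bullet> (hessq q i x *v p) = 2 * ((hessq q i x *v p) \<bullet> k)" for k
        using hessq_sym[of p i x k] by (simp add: inner_commute)
      ultimately show ?thesis unfolding D_def
        by (simp add: inner_diff_left)
    qed
    have bd: "onorm (\<lambda>k. D p \<bullet> k) \<le> e * norm h" if "p \<in> S" for p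
    proof -
      have "norm p \<le> norm h"
        using segment_bound1[of p 0 h] that by (simp add: S_def)
      then have "norm (D p) \<le> e * norm h"
        using d(2)[of p] h mult_left_mono[of "norm p" "norm h" e] e unfolding D_def by linarith
      moreover have "onorm (\<lambda>h. D p \<bullet> h) \<le> norm (D p)"
        by (rule onorm_le) (simp add: Cauchy_Schwarz_ineq2)
      ultimately show ?thesis by linarith
    qed
    have "norm (r h - r 0) \<le> e * norm h * norm (h - 0)"
      by (rule differentiable_bound[of S _ "\<lambda>p k. D p \<bullet> k"])
        (use dr bd in \<open>auto simp: S_def\<close>)
    then show "\<bar>q (x + h) $ i - q x $ i - gradq q i x \<bullet> h - (h \<bullet> (hessq q i x *v h)) / 2\<bar> \<le> e * (norm h)\<^sup>2"
      by (simp add: r_def power2_eq_square algebra_simps)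
  qed
qed

end

section \<open>Polyhedral cones and a Brouwer argument\<close>

text \<open>Brouwer's theorem for \<open>a \<mapsto> a - F a\<close>, with the components outside \<open>J\<close> sent to \<open>0\<close>.\<close>

lemma zero_on_components:
  fixes F :: "real^'n \<Rightarrow> 'n \<Rightarrow> real"
  assumes r: "0 \<le> r" and cont: "\<And>i. i \<in> J \<Longrightarrow> continuous_on (cball 0 r) (\<lambda>a. F a i)"
    and near: "\<And>a i. norm a \<le> r \<Longrightarrow> i \<in> J \<Longrightarrow> \<bar>F a i - a $ i\<bar> \<le> r / CARD('n)"
  shows "\<exists>a. norm a \<le> r \<and> (\<forall>i\<in>J. F a i = 0)"
proof (cases "r = 0")
  case True
  then show ?thesis using near[of 0] by (intro exI[of _ 0]) auto
next
  case False
  define H :: "real^'n \<Rightarrow> real^'n" where "H a = (\<chi> i. if i \<in> J then a $ i - F a i else 0)" for a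
  have "continuous_on (cball 0 r) (\<lambda>a. if i \<in> J then a $ i - F a i else 0)" for i
    by (cases "i \<in> J") (auto intro!: continuous_intros cont)
  then have "continuous_on (cball 0 r) H"
    unfolding H_def by (intro continuous_on_vec_lambda)
  moreover have "H \<in> cball 0 r \<rightarrow> cball 0 r"
  proof
    fix a :: "real^'n" assume "a \<in> cball 0 r"
    then have "\<bar>H a $ i\<bar> \<le> r / CARD('n)" for i
      using near[of a i] r by (auto simp: H_def abs_minus_commute)
    \<comment> \<open>The allowance \<open>r / CARD('n)\<close> per component is calibrated for this
      estimate by the l1 norm, which keeps \<open>H a\<close> in the ball.\<close>
    then have "norm (H a) \<le> (\<Sum>i\<in>(UNIV::'n set). r / CARD('n))"
      by (intro order_trans[OF norm_le_l1_cart] sum_mono)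
    then show "H a \<in> cball 0 r" by simp
  qed
  ultimately obtain a where a: "norm a \<le> r" "H a = a"
    using brouwer_ball[of r 0 H] False r by auto
  have "F a i = 0" if "i \<in> J" for i
    using a(2) that by (auto simp: H_def vec_eq_iff dest!: spec[of _ i])
  with a(1) show ?thesis by blast
qed

section \<open>Finitely generated cones, Farkas' lemma and limits of linear systems\<close>

definition mixed_orthant :: "'n set \<Rightarrow> 'n set \<Rightarrow> (real^'n) set" where
  "mixed_orthant N Z = {c. (\<forall>i\<in>N. 0 \<le> c $ i) \<and> (\<forall>i\<in>Z. c $ i = 0)}"

lemma convex_cone_mixed_orthant: "convex_cone (mixed_orthant N Z)"
  unfolding convex_cone_iff mixed_orthant_def by (auto simp: vec_eq_iff)

text \<open>Coordinates in neither \<open>N\<close> nor \<open>Z\<close> are free, hence the second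
  family of generators. Finite generation is what makes every linear image closed; images of general
  closed cones need not be.\<close>

lemma mixed_orthant_hull:
  fixes N Z :: "'n::finite set"
  shows "mixed_orthant N Z = convex_cone hull
     ((\<lambda>i. axis i 1) ` (- Z) \<union> (\<lambda>i. - axis i 1) ` (- (Z \<union> N)))" (is "_ = convex_cone hull ?B")
proof
  show "convex_cone hull ?B \<subseteq> mixed_orthant N Z"
    by (rule hull_minimal[of _ _ convex_cone])
      (auto simp: mixed_orthant_def axis_def convex_cone_mixed_orthant[unfolded mixed_orthant_def])
  show "mixed_orthant N Z \<subseteq> convex_cone hull ?B"
  proof
    fix c :: "real^'n" assume c: "c \<in> mixed_orthant N Z"
    have comp: "c $ i *\<^sub>R axis i 1 \<in> convex_cone hull ?B" for i
    proof (cases "i \<in> Z")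
      case True
      then have "c $ i = 0" using c by (auto simp: mixed_orthant_def)
      then show ?thesis by (simp add: convex_cone_hull_contains_0)
    next
      case False
      show ?thesis
      proof (cases "0 \<le> c $ i")
        case True
        have "axis i 1 \<in> convex_cone hull ?B"
          using False by (intro hull_inc) auto
        then show ?thesis using True convex_cone_hull_mul by metis
      next
        case neg: False
        then have "i \<notin> N" using c by (auto simp: mixed_orthant_def)
        then have "- axis i 1 \<in> convex_cone hull ?B"
          using False by (intro hull_inc) auto
        then have "(- c $ i) *\<^sub>R (- axis i 1) \<in> convex_cone hull ?B"
          using neg by (intro convex_cone_hull_mul) auto
        then show ?thesis by simp
      qed
    qed
    define H where "H = convex_cone hull ?B"
    have "(\<Sum>i\<in>S. c $ i *\<^sub>R axis i 1) \<in> H" if "finite S" for S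
      using that
    proof (induction S rule: finite_induct)
      case (insert i S)
      then show ?case
        using convex_cone_hull_add[OF comp[of i]] by (simp add: H_def)
    qed (simp add: H_def convex_cone_hull_contains_0)
    from this[of UNIV] show "c \<in> convex_cone hull ?B"
      unfolding H_def using basis_expansion[of c] by (simp add: scalar_mult_eq_scaleR)
  qed
qed

lemma closed_linear_image_mixed_orthant:
  fixes f :: "real^'n \<Rightarrow> 'b::euclidean_space"
  assumes "linear f"
  shows "closed (f ` mixed_orthant N Z)"
  unfolding mixed_orthant_hull convex_cone_hull_linear_image[OF assms, symmetric]
  by (intro closed_convex_cone_hull finite_imageI finite_UnI) auto

text \<open>Separation from the closed cone spanned by the \<open>a i\<close>: if \<open>y\<close>
  lay outside, the negated normal of the separating hyperplane would be an admissible
  \<open>u\<close> violating the hypothesis.\<close>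

lemma farkas:
  fixes a :: "'n::finite \<Rightarrow> 'b::euclidean_space"
  assumes *: "\<And>u. (\<And>i. i \<in> I \<Longrightarrow> a i \<bullet> u \<le> 0) \<Longrightarrow> y \<bullet> u \<le> 0"
  shows "\<exists>c. (\<forall>i. 0 \<le> c $ i) \<and> (\<forall>i. i \<notin> I \<longrightarrow> c $ i = 0) \<and> y = (\<Sum>i\<in>UNIV. c $ i *\<^sub>R a i)"
proof (rule ccontr)
  define f :: "real^'n \<Rightarrow> 'b" where "f = (\<lambda>c. \<Sum>i\<in>UNIV. c $ i *\<^sub>R a i)"
  have lin: "linear f"
    unfolding f_def by (auto intro!: linearI simp: scaleR_left_distrib sum.distrib scaleR_sum_right)
  define C where "C = f ` mixed_orthant UNIV (- I)"
  assume "\<not> ?thesis"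
  then have "y \<notin> C"
    unfolding C_def f_def mixed_orthant_def by (auto simp: image_iff)
  moreover have "closed C" unfolding C_def by (rule closed_linear_image_mixed_orthant[OF lin])
  moreover have "convex C"
    unfolding C_def
    by (rule convex_linear_image[OF lin convex_cone_mixed_orthant[unfolded convex_cone_def, THEN conjunct2, THEN conjunct1]])
  ultimately obtain d b where d: "d \<bullet> y < b" "\<forall>x\<in>C. d \<bullet> x > b"
    using separating_hyperplane_closed_point[of C y] by auto
  have "0 \<in> C"
    unfolding C_def by (rule image_eqI[of _ _ 0]) (auto simp: linear_0[OF lin] mixed_orthant_def)
  then have b: "b < 0" using d(2) by force
  have "0 \<le> d \<bullet> a i" if i: "i \<in> I" for i
  proof (rule ccontr)
    assume neg: "\<not> 0 \<le> d \<bullet> a i"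
    \<comment> \<open>Scaled so that \<open>d \<bullet> (s *\<^sub>R a i)\<close> equals
      \<open>b\<close>, which strict separation forbids on the cone.\<close>
    define s where "s = b / (d \<bullet> a i)"
    have s: "0 \<le> s" using neg b by (simp add: s_def divide_nonpos_neg)
    have "f (axis i s) = s *\<^sub>R a i"
    proof -
      have "axis i s $ j *\<^sub>R a j = (if j = i then s *\<^sub>R a i else 0)" for j
        by (simp add: axis_def)
      then show ?thesis unfolding f_def by simp
    qed
    then have "s *\<^sub>R a i \<in> C"
      unfolding C_def using i s by (intro image_eqI[of _ _ "axis i s"]) (auto simp: mixed_orthant_def axis_def)
    then have "d \<bullet> (s *\<^sub>R a i) > b" using d(2) by blast
    then show False using neg by (simp add: s_def)
  qed
  then have "y \<bullet> (- d) \<le> 0"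
    by (intro *) (auto simp: inner_commute)
  then show False using d(1) b by (simp add: inner_commute)
qed

text \<open>The right-hand sides of a solvable system form a linear image of an orthant:
  the unknown \<open>z\<close> is a free block, the slacks are the other one.\<close>

lemma closed_solvable:
  fixes a :: "'n::finite \<Rightarrow> real^'m"
  assumes disj: "P \<inter> N = {}"
  shows "closed {b::real^'n. \<exists>z. (\<forall>i\<in>P. a i \<bullet> z + b $ i = 0) \<and> (\<forall>i\<in>N. a i \<bullet> z + b $ i \<le> 0)}"
    (is "closed ?S")
proof -
  define f :: "real^('m + 'n) \<Rightarrow> real^'n" where
    "f = (\<lambda>c. \<chi> i. - (a i \<bullet> (\<chi> j. c $ Inl j)) - c $ Inr i)"
  have lin: "linear f"
    unfolding f_def
    by (rule linearI) (auto simp: vec_eq_iff inner_vec_def sum.distrib algebra_simps sum_distrib_left)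
  have "?S = f ` mixed_orthant (Inr ` N) (Inr ` P)"
  proof (intro set_eqI iffI)
    fix b assume "b \<in> ?S"
    then obtain z where z: "\<forall>i\<in>P. a i \<bullet> z + b $ i = 0" "\<forall>i\<in>N. a i \<bullet> z + b $ i \<le> 0" by auto
    define c :: "real^('m + 'n)" where
      "c = (\<chi> k. case k of Inl j \<Rightarrow> z $ j | Inr i \<Rightarrow> - (a i \<bullet> z) - b $ i)"
    have "(\<chi> j. c $ Inl j) = z" by (simp add: c_def vec_eq_iff)
    then have "f c = b" by (simp add: f_def c_def vec_eq_iff)
    moreover have "c \<in> mixed_orthant (Inr ` N) (Inr ` P)"
      using z by (auto simp: mixed_orthant_def c_def)
    ultimately show "b \<in> f ` mixed_orthant (Inr ` N) (Inr ` P)" by auto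
  next
    fix b assume "b \<in> f ` mixed_orthant (Inr ` N) (Inr ` P)"
    then obtain c where c: "c \<in> mixed_orthant (Inr ` N) (Inr ` P)" and b: "b = f c" by auto
    define z where "z = (\<chi> j. c $ Inl j)"
    have "a i \<bullet> z + b $ i = - c $ Inr i" for i
      by (simp add: b f_def z_def)
    then show "b \<in> ?S"
      using c by (auto simp: mixed_orthant_def intro!: exI[of _ z])
  qed
  then show ?thesis
    using closed_linear_image_mixed_orthant[OF lin] by simp
qed

text \<open>The \<open>z k\<close> may be unbounded, so compactness is of no help; the limit
  solution comes from closedness of the set of right-hand sides for which the system is
  solvable.\<close>

lemma solvable_limit:
  fixes a :: "'n::finite \<Rightarrow> real^'m" and b :: "nat \<Rightarrow> 'n \<Rightarrow> real"
  assumes "P \<inter> N = {}"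
    and lim: "\<And>i. i \<in> P \<union> N \<Longrightarrow> (\<lambda>k. b k i) \<longlonglongrightarrow> b0 i"
    and eq: "\<And>k i. i \<in> P \<Longrightarrow> a i \<bullet> z k + b k i = 0"
    and le: "\<And>k i. i \<in> N \<Longrightarrow> a i \<bullet> z k + b k i \<le> 0"
  shows "\<exists>z. (\<forall>i\<in>P. a i \<bullet> z + b0 i = 0) \<and> (\<forall>i\<in>N. a i \<bullet> z + b0 i \<le> 0)"
proof -
  define S where "S = {b::real^'n. \<exists>z. (\<forall>i\<in>P. a i \<bullet> z + b $ i = 0) \<and> (\<forall>i\<in>N. a i \<bullet> z + b $ i \<le> 0)}"
  \<comment> \<open>Coordinates outside \<open>P \<union> N\<close> are unconstrained and need not
    converge, so they are replaced by \<open>0\<close>.\<close>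
  define B where "B k = (\<chi> i. if i \<in> P \<union> N then b k i else 0)" for k
  define B0 where "B0 = (\<chi> i. if i \<in> P \<union> N then b0 i else 0)"
  have "B \<longlonglongrightarrow> B0"
    unfolding B_def B0_def by (rule vec_tendstoI) (use lim in auto)
  moreover have "B k \<in> S" for k
    unfolding S_def B_def using eq le by (auto intro!: exI[of _ "z k"])
  moreover have "closed S" unfolding S_def by (rule closed_solvable[OF assms(1)])
  ultimately have "B0 \<in> S" using closed_sequentially by blast
  then show ?thesis unfolding S_def B0_def by force
qed

text \<open>\<open>p\<close> is the projection of \<xi>. Thus \<open>\<xi> - p\<close> is a point of
  the polar cone at distance \<open>norm p\<close> from \<xi>, which later turns a limit of cones
  into a limit of polars.\<close>

lemma moreau:
  fixes \<xi> :: "'a::euclidean_space"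
  assumes "closed K" and cone: "convex_cone K"
  shows "\<exists>p\<in>K. (\<forall>x\<in>K. (\<xi> - p) \<bullet> x \<le> 0) \<and> (\<xi> - p) \<bullet> p = 0"
proof -
  have K: "K \<noteq> {}" "convex K" using cone by (simp_all add: convex_cone_def)
  have K0: "0 \<in> K" and add: "\<And>x y. x \<in> K \<Longrightarrow> y \<in> K \<Longrightarrow> x + y \<in> K"
    using cone by (simp_all add: convex_cone_iff)
  define p where "p = closest_point K \<xi>"
  have p: "p \<in> K" unfolding p_def using assms K by (intro closest_point_in_set) auto
  have dot: "(\<xi> - p) \<bullet> (x - p) \<le> 0" if "x \<in> K" for x
    unfolding p_def using closest_point_dot[OF K(2) assms(1) that] .
  have le: "(\<xi> - p) \<bullet> x \<le> 0" if "x \<in> K" for x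
    using dot[OF add[OF that p]] by simp
  have "(\<xi> - p) \<bullet> (0 - p) \<le> 0" by (rule dot[OF K0])
  with le[OF p] have "(\<xi> - p) \<bullet> p = 0" by simp
  with le p show ?thesis by blast
qed

section \<open>Multipliers under metric regularity\<close>

text \<open>A single \<open>e\<close> bounds both the step length and the relative error, so
  \<open>e = 1 / (k + 1)\<close> produces the defining sequences at once.\<close>

lemma contingent_coneI:
  assumes *: "\<And>e. e > 0 \<Longrightarrow> \<exists>t x. 0 < t \<and> t < e \<and> x \<in> \<Omega> \<and> norm (x - z - t *\<^sub>R u) \<le> e * t"
  shows "u \<in> contingent_cone \<Omega> z"
proof -
  have "\<exists>t x. 0 < t \<and> t < inverse (real (Suc k)) \<and> x \<in> \<Omega> \<and> norm (x - z - t *\<^sub>R u) \<le> inverse (real (Suc k)) * t" for k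
    by (rule *) simp
  then obtain t x where tx: "\<And>k. 0 < t k" "\<And>k. t k < inverse (real (Suc k))" "\<And>k. x k \<in> \<Omega>"
      "\<And>k. norm (x k - z - t k *\<^sub>R u) \<le> inverse (real (Suc k)) * t k"
    by metis
  define U where "U = (\<lambda>k. (1 / t k) *\<^sub>R (x k - z))"
  have "t \<longlonglongrightarrow> 0"
    by (rule tendsto_sandwich[OF _ _ tendsto_const LIMSEQ_inverse_real_of_nat])
      (use tx in \<open>auto intro!: always_eventually less_imp_le\<close>)
  moreover have "U \<longlonglongrightarrow> u"
  proof (rule LIM_zero_cancel, rule tendsto_norm_zero_cancel,
      rule tendsto_sandwich[OF _ _ tendsto_const LIMSEQ_inverse_real_of_nat])
    show "\<forall>\<^sub>F k in sequentially. norm (U k - u) \<le> inverse (real (Suc k))"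
    proof (rule always_eventually, rule allI)
      fix k
      have "U k - u = (1 / t k) *\<^sub>R (x k - z - t k *\<^sub>R u)"
        using tx(1)[of k] by (simp add: U_def algebra_simps)
      then have "norm (U k - u) = norm (x k - z - t k *\<^sub>R u) / t k"
        using tx(1)[of k] by simp
      also have "\<dots> \<le> inverse (real (Suc k)) * t k / t k"
        using tx(1)[of k] tx(4)[of k] by (intro divide_right_mono) auto
      finally show "norm (U k - u) \<le> inverse (real (Suc k))"
        using tx(1)[of k] by simp
    qed
  qed auto
  moreover have "z + t k *\<^sub>R U k \<in> \<Omega>" for k
    using tx(1)[of k] tx(3)[of k] by (simp add: U_def)
  ultimately show ?thesis unfolding contingent_cone_def using tx(1) by blast
qed

text \<open>Hadamard form of differentiability: the directions \<open>U k\<close> may vary because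
  they are bounded and the remainder is small relative to \<open>t k * norm (U k)\<close>.\<close>

lemma difference_quotient_tendsto:
  fixes f :: "'a::real_normed_vector \<Rightarrow> 'b::real_normed_vector"
  assumes D: "(f has_derivative D) (at z)" and t: "\<And>k. t k > (0::real)" "t \<longlonglongrightarrow> 0" and U: "U \<longlonglongrightarrow> u"
  shows "(\<lambda>k. (1 / t k) *\<^sub>R (f (z + t k *\<^sub>R U k) - f z)) \<longlonglongrightarrow> D u"
proof -
  have bl: "bounded_linear D" using D has_derivative_bounded_linear by blast
  have lin: "linear D" using bl bounded_linear.linear by blast
  obtain M where M: "M > 0" "\<And>k. norm (U k) \<le> M"
    using U convergent_imp_bounded bounded_pos by (metis rangeI)
  have tU: "(\<lambda>k. t k *\<^sub>R U k) \<longlonglongrightarrow> 0"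
    using tendsto_scaleR[OF t(2) U] by simp
  define r where "r = (\<lambda>k. (1 / t k) *\<^sub>R (f (z + t k *\<^sub>R U k) - f z) - D (U k))"
  have "r \<longlonglongrightarrow> 0"
  proof (rule LIMSEQ_I)
    fix e :: real assume e: "e > 0"
    define e' where "e' = e / (2 * M)"
    have e': "e' > 0" using e M by (simp add: e'_def)
    obtain d where d: "d > 0" "\<forall>y. norm (y - z) < d \<longrightarrow> norm (f y - f z - D (y - z)) \<le> e' * norm (y - z)"
      using D e' unfolding has_derivative_at_alt by blast
    obtain K where K: "\<And>k. k \<ge> K \<Longrightarrow> norm (t k *\<^sub>R U k - 0) < d"
      using LIMSEQ_D[OF tU d(1)] by blast
    show "\<exists>K. \<forall>k\<ge>K. norm (r k - 0) < e"
    proof (intro exI allI impI)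
      fix k assume "k \<ge> K"
      then have "norm (f (z + t k *\<^sub>R U k) - f z - D (t k *\<^sub>R U k)) \<le> e' * norm (t k *\<^sub>R U k)"
        using K[of k] d(2)[rule_format, of "z + t k *\<^sub>R U k"] by simp
      moreover have "f (z + t k *\<^sub>R U k) - f z - D (t k *\<^sub>R U k) = t k *\<^sub>R r k"
        using t(1)[of k] by (simp add: r_def linear_cmul[OF lin] algebra_simps)
      ultimately have "t k * norm (r k) \<le> t k * (e' * norm (U k))"
        using t(1)[of k] by (simp add: algebra_simps)
      then have "norm (r k) \<le> e' * norm (U k)" using t(1)[of k] by simp
      also have "\<dots> \<le> e' * M" using M(2)[of k] e' by simp
      also have "\<dots> < e" using M e by (simp add: e'_def)
      finally show "norm (r k - 0) < e" by simp
    qed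
  qed
  moreover have "(\<lambda>k. D (U k)) \<longlonglongrightarrow> D u"
    using bounded_linear.tendsto[OF bl U] .
  ultimately have "(\<lambda>k. r k + D (U k)) \<longlonglongrightarrow> 0 + D u" by (rule tendsto_add)
  then show ?thesis by (simp add: r_def)
qed

lemma Mq_iff: "p \<in> Mq q x \<longleftrightarrow> (\<forall>i. q x $ i \<le> p $ i)"
proof
  assume "p \<in> Mq q x"
  then show "\<forall>i. q x $ i \<le> p $ i" unfolding Mq_def by force
next
  assume *: "\<forall>i. q x $ i \<le> p $ i"
  have "p = q x - (q x - p)" by simp
  moreover have "\<forall>i. (q x - p) $ i \<le> 0" using * by simp
  ultimately show "p \<in> Mq q x" unfolding Mq_def by blast
qed

text \<open>Here \<open>p'\<close> stands for any element of \<open>Mq q x\<close>, which bounds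
  \<open>edist p (Mq q x)\<close> from above; the slack \<open>e\<close> is there because the
  infimum in \<open>edist\<close> need not be attained.\<close>

lemma metrically_regular_MqD:
  fixes q :: "real^'m \<Rightarrow> real^'l"
  assumes mr: "metrically_regular \<kappa> (Mq q) x0 0"
  shows "\<exists>\<delta>>0. \<forall>x p p' e. norm (x - x0) < \<delta> \<longrightarrow> norm p < \<delta> \<longrightarrow> (\<forall>i. q x $ i \<le> p' $ i) \<longrightarrow> e > 0 \<longrightarrow>
      0 \<le> \<kappa> \<longrightarrow>
      (\<exists>x'. (\<forall>i. q x' $ i \<le> p $ i) \<and> dist x x' < \<kappa> * dist p p' + e)"
proof -
  obtain U V where UV: "open U" "x0 \<in> U" "open V" "0 \<in> V"
    "\<forall>x\<in>U. \<forall>y\<in>V. edist x (inv_mf (Mq q) y) \<le> ereal \<kappa> * edist y (Mq q x)"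
    using mr unfolding metrically_regular_def by blast
  obtain d1 where d1: "d1 > 0" "ball x0 d1 \<subseteq> U" using UV openE by blast
  obtain d2 where d2: "d2 > 0" "ball 0 d2 \<subseteq> V" using UV openE by blast
  show ?thesis
  proof (intro exI[of _ "min d1 d2"] conjI allI impI)
    show "min d1 d2 > 0" using d1 d2 by simp
    fix x and p p' :: "real^'l" and e :: real
    assume a: "norm (x - x0) < min d1 d2" "norm p < min d1 d2" "\<forall>i. q x $ i \<le> p' $ i" "e > 0" "0 \<le> \<kappa>"
    have "x \<in> U" using a(1) d1(2) by (auto simp: subset_eq dist_norm norm_minus_commute)
    moreover have "p \<in> V" using a(2) d2(2) by (auto simp: subset_eq)
    ultimately have "edist x (inv_mf (Mq q) p) \<le> ereal \<kappa> * edist p (Mq q x)"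
      using UV(5) by blast
    also have "\<dots> \<le> ereal \<kappa> * ereal (dist p p')"
    proof (rule ereal_mult_left_mono)
      show "edist p (Mq q x) \<le> ereal (dist p p')"
        unfolding edist_def by (rule INF_lower) (use a(3) Mq_iff in blast)
      show "0 \<le> ereal \<kappa>" using a(5) by simp
    qed
    also have "\<dots> < ereal (\<kappa> * dist p p' + e)" using a(4) by simp
    finally obtain x' where "x' \<in> inv_mf (Mq q) p" "ereal (dist x x') < ereal (\<kappa> * dist p p' + e)"
      unfolding edist_def INF_less_iff by blast
    then show "\<exists>x'. (\<forall>i. q x' $ i \<le> p $ i) \<and> dist x x' < \<kappa> * dist p p' + e"
      by (auto simp: inv_mf_def Mq_iff)
  qed
qed

lemma multiplier_sum_inner:
  fixes q :: "real^'m \<Rightarrow> real^'l"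
  assumes "lam \<in> normal_orthant q x" "u \<in> Tlin q x"
  shows "gradsum q x lam \<bullet> u \<le> 0"
proof -
  have "lam $ i * (gradq q i x \<bullet> u) \<le> 0" for i
    using assms by (cases "i \<in> active q x") (auto simp: normal_orthant_def Tlin_def mult_nonneg_nonpos)
  then show ?thesis by (simp add: inner_sum_left sum_nonpos)
qed

section \<open>Constraint qualification, existence and size of multipliers\<close>

context
  fixes q :: "real^'m \<Rightarrow> real^'l"
  assumes q2: "twice_cont_diff q"
begin

lemma first_order_expansion:
  assumes e: "e > 0" and R: "R > 0"
  shows "\<forall>\<^sub>F t in at_right 0. \<forall>i h. norm h \<le> R * t \<longrightarrow> \<bar>q (x + h) $ i - q x $ i - gradq q i x \<bullet> h\<bar> \<le> e * t"
proof -
  have "\<forall>\<^sub>F t in at_right 0. \<forall>h. norm h \<le> R * t \<longrightarrow> \<bar>q (x + h) $ i - q x $ i - gradq q i x \<bullet> h\<bar> \<le> e * t" for i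
  proof -
    have eR: "e / R > 0" using e R by simp
    obtain d where d: "d > 0" "\<forall>y. norm (y - x) < d \<longrightarrow>
        norm (q y $ i - q x $ i - gradq q i x \<bullet> (y - x)) \<le> e / R * norm (y - x)"
      using gradq_deriv[OF q2, of i x] eR unfolding has_derivative_at_alt by blast
    show ?thesis unfolding eventually_at_right_field
    proof (intro exI[of _ "d / R"] conjI allI impI)
      show "d / R > 0" using d R by simp
      fix t :: real and h :: "real^'m" assume t: "0 < t" "t < d / R" and h: "norm h \<le> R * t"
      have "R * t < d" using t R by (simp add: field_simps)
      then have "\<bar>q (x + h) $ i - q x $ i - gradq q i x \<bullet> h\<bar> \<le> e / R * norm h"
        using d(2)[rule_format, of "x + h"] h by simp
      also have "\<dots> \<le> e / R * (R * t)" using eR h by (intro mult_left_mono) auto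
      finally show "\<bar>q (x + h) $ i - q x $ i - gradq q i x \<bullet> h\<bar> \<le> e * t" using R by simp
    qed
  qed
  then show ?thesis by (intro eventually_all_finite)
qed

lemma contingent_subset_Tlin: "x \<in> Gam q \<Longrightarrow> contingent_cone (Gam q) x \<subseteq> Tlin q x"
proof
  fix u assume "u \<in> contingent_cone (Gam q) x"
  then obtain t :: "nat \<Rightarrow> real" and U where tU: "\<forall>k. t k > 0" "t \<longlonglongrightarrow> 0" "U \<longlonglongrightarrow> u" "\<forall>k. x + t k *\<^sub>R U k \<in> Gam q"
    unfolding contingent_cone_def by blast
  have "gradq q i x \<bullet> u \<le> 0" if i: "i \<in> active q x" for i
  proof -
    have lim: "(\<lambda>k. (1 / t k) *\<^sub>R (q (x + t k *\<^sub>R U k) $ i - q x $ i)) \<longlonglongrightarrow> gradq q i x \<bullet> u"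
      by (rule difference_quotient_tendsto[OF gradq_deriv[OF q2]]) (use tU in auto)
    have "(1 / t k) *\<^sub>R (q (x + t k *\<^sub>R U k) $ i - q x $ i) \<le> 0" for k
      using tU(1,4) i by (auto simp: Gam_def active_def divide_nonpos_pos)
    then show ?thesis using LIMSEQ_le_const2[OF lim] by blast
  qed
  then show "u \<in> Tlin q x" unfolding Tlin_def by blast
qed

lemma regular_normal_coneI:
  assumes x: "x \<in> Gam q" and lam: "lam \<in> normal_orthant q x"
  shows "gradsum q x lam \<in> regular_normal_cone (Gam q) x"
  using multiplier_sum_inner[OF lam] contingent_subset_Tlin[OF x] x
  unfolding regular_normal_cone_def neg_polar_def by auto

text \<open>Moving from \<open>x0\<close> by \<open>t u\<close> violates the constraints by only
  \<open>o(t)\<close>, and metric regularity with target \<open>0\<close> pulls the point back into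
  the feasible set over a distance \<open>o(t)\<close>.\<close>

lemma abadie:
  assumes x0: "x0 \<in> Gam q" and \<kappa>: "\<kappa> > 0" and mr: "metrically_regular \<kappa> (Mq q) x0 0"
  shows "Tlin q x0 \<subseteq> contingent_cone (Gam q) x0"
proof
  fix u assume u: "u \<in> Tlin q x0"
  obtain \<delta> where \<delta>: "\<delta> > 0" "\<And>x p p' e. norm (x - x0) < \<delta> \<Longrightarrow> norm p < \<delta> \<Longrightarrow> (\<forall>i. q x $ i \<le> p' $ i) \<Longrightarrow>
      e > 0 \<Longrightarrow> 0 \<le> \<kappa> \<Longrightarrow> \<exists>x'. (\<forall>i. q x' $ i \<le> p $ i) \<and> dist x x' < \<kappa> * dist p p' + e"
    using metrically_regular_MqD[OF mr] by metis
  show "u \<in> contingent_cone (Gam q) x0"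
  proof (rule contingent_coneI)
    fix e :: real assume e: "e > 0"
    define R where "R = norm u + 1"
    have R: "R > 0" by (simp add: R_def add_nonneg_pos)
    \<comment> \<open>A violation of \<open>c * t\<close> in every component costs at most
      \<open>\<kappa> * CARD('l) * c * t = e * t / 2\<close>; the other half of \<open>e * t\<close>
      absorbs the slack of metric regularity.\<close>
    define c where "c = e / (2 * \<kappa> * CARD('l))"
    have c: "c > 0" using e \<kappa> by (simp add: c_def)
    note ev1 = first_order_expansion[OF c R, of x0]
    have ev2: "\<forall>\<^sub>F t in at_right 0. \<forall>i. i \<notin> active q x0 \<longrightarrow> t * (\<bar>gradq q i x0 \<bullet> u\<bar> + c) < - q x0 $ i"
    proof (rule eventually_all_finite)
      fix i
      have "((\<lambda>t. t * (\<bar>gradq q i x0 \<bullet> u\<bar> + c)) \<longlongrightarrow> 0 * (\<bar>gradq q i x0 \<bullet> u\<bar> + c)) (at_right 0)"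
        by (intro tendsto_intros)
      then have "i \<notin> active q x0 \<Longrightarrow> \<forall>\<^sub>F t in at_right 0. t * (\<bar>gradq q i x0 \<bullet> u\<bar> + c) < - q x0 $ i"
        using x0 by (intro order_tendstoD(2)) (auto simp: active_def Gam_def less_le)
      then show "\<forall>\<^sub>F t in at_right 0. i \<notin> active q x0 \<longrightarrow> t * (\<bar>gradq q i x0 \<bullet> u\<bar> + c) < - q x0 $ i"
        by (cases "i \<in> active q x0") auto
    qed
    have pos: "min e (\<delta> / R) > 0" using e \<delta> R by simp
    have ev3: "\<forall>\<^sub>F t in at_right 0. 0 < t \<and> t < min e (\<delta> / R)"
      unfolding eventually_at_right_field using pos by blast
    obtain t where t: "\<forall>i h. norm h \<le> R * t \<longrightarrow> \<bar>q (x0 + h) $ i - q x0 $ i - gradq q i x0 \<bullet> h\<bar> \<le> c * t"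
        "\<forall>i. i \<notin> active q x0 \<longrightarrow> t * (\<bar>gradq q i x0 \<bullet> u\<bar> + c) < - q x0 $ i" "0 < t" "t < e" "t < \<delta> / R"
      using eventually_happens[OF eventually_conj[OF ev1 eventually_conj[OF ev2 ev3]]] by auto
    define x where "x = x0 + t *\<^sub>R u"
    have le: "q x $ i \<le> c * t" for i
    proof -
      have tu: "norm (t *\<^sub>R u) \<le> R * t" using t(3) by (simp add: R_def algebra_simps)
      have *: "\<bar>q x $ i - q x0 $ i - t * (gradq q i x0 \<bullet> u)\<bar> \<le> c * t"
        using t(1)[rule_format, OF tu, of i] by (simp add: x_def)
      show ?thesis
      proof (cases "i \<in> active q x0")
        case True
        then have "t * (gradq q i x0 \<bullet> u) \<le> 0"
          using u t(3) by (auto simp: Tlin_def mult_nonneg_nonpos)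
        with * True show ?thesis by (simp add: active_def)
      next
        case False
        then have "t * \<bar>gradq q i x0 \<bullet> u\<bar> + t * c < - q x0 $ i"
          using t(2) by (simp add: distrib_left)
        moreover have "t * (gradq q i x0 \<bullet> u) \<le> t * \<bar>gradq q i x0 \<bullet> u\<bar>"
          using t(3) by (intro mult_left_mono) auto
        moreover have "0 < c * t" using c t(3) by simp
        ultimately show ?thesis using * by (simp add: mult.commute)
      qed
    qed
    define p' :: "real^'l" where "p' = (\<chi> i. c * t)"
    have np: "norm p' \<le> CARD('l) * (c * t)"
      using norm_le_l1_cart[of p'] c t(3) by (simp add: p'_def)
    have "norm (x - x0) < \<delta>"
    proof -
      have "norm (x - x0) \<le> t * R" using t(3) by (simp add: x_def R_def)
      also have "\<dots> < \<delta>" using t(5) R by (simp add: field_simps)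
      finally show ?thesis .
    qed
    then obtain x' where x': "\<forall>i. q x' $ i \<le> 0 $ i" "dist x x' < \<kappa> * dist 0 p' + e * t / 2"
      using \<delta>(2)[of x 0 p' "e * t / 2"] le e t(3) \<kappa> \<delta>(1) by (auto simp: p'_def)
    have "\<kappa> * dist 0 p' \<le> \<kappa> * (CARD('l) * (c * t))"
      using np \<kappa> by (intro mult_left_mono) auto
    also have "\<dots> = e * t / 2" using \<kappa> by (simp add: c_def)
    finally have "dist x x' \<le> e * t" using x'(2) by simp
    then have "norm (x' - x0 - t *\<^sub>R u) \<le> e * t"
      by (simp add: x_def dist_norm norm_minus_commute algebra_simps)
    moreover have "x' \<in> Gam q" using x'(1) by (simp add: Gam_def)
    ultimately show "\<exists>t x. 0 < t \<and> t < e \<and> x \<in> Gam q \<and> norm (x - x0 - t *\<^sub>R u) \<le> e * t"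
      using t(3,4) by blast
  qed
qed

text \<open>By \<open>abadie\<close> a regular normal is also polar to the linearised cone, where
  Farkas' lemma applies.\<close>

lemma multipliers_exist:
  assumes x: "x \<in> Gam q" and \<kappa>: "\<kappa> > 0" and mr: "metrically_regular \<kappa> (Mq q) x 0"
    and ys: "ys \<in> regular_normal_cone (Gam q) x"
  shows "\<exists>lam\<in>normal_orthant q x. ys = gradsum q x lam"
proof -
  have "ys \<bullet> u \<le> 0" if "\<And>i. i \<in> active q x \<Longrightarrow> gradq q i x \<bullet> u \<le> 0" for u
    using that ys abadie[OF x \<kappa> mr] x
    by (auto simp: Tlin_def regular_normal_cone_def neg_polar_def)
  then have "\<exists>c. (\<forall>i. 0 \<le> c $ i) \<and> (\<forall>i. i \<notin> active q x \<longrightarrow> c $ i = 0) \<and>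
      ys = gradsum q x c"
    by (rule farkas[of "active q x" "\<lambda>i. gradq q i x" ys])
  then show ?thesis unfolding normal_orthant_def by auto
qed

text \<open>Test regularity with the target \<open>- s lam\<close>: some \<open>x'\<close> at
  distance about \<open>\<kappa> * s * norm lam\<close> satisfies \<open>q x' \<le> - s lam\<close>
  componentwise. Pairing the linearised inequalities with \<open>lam\<close> gives \<open>s\<close>
  times the squared norm of \<open>lam\<close> on one side, and the norm of the gradient sum times
  that distance on the other.\<close>

lemma multiplier_bound:
  assumes x0: "x0 \<in> Gam q" and \<kappa>: "\<kappa> > 0" and mr: "metrically_regular \<kappa> (Mq q) x0 0"
    and lam: "lam \<in> normal_orthant q x0"
  shows "norm lam \<le> \<kappa> * norm (gradsum q x0 lam)"
proof (cases "lam = 0")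
  case True
  then show ?thesis using \<kappa> by simp
next
  case False
  define L where "L = norm lam"
  define G where "G = gradsum q x0 lam"
  define S where "S = (\<Sum>i\<in>UNIV. lam $ i)"
  have L: "L > 0" using False by (simp add: L_def)
  have lam0: "0 \<le> lam $ i" for i using lam by (simp add: normal_orthant_def)
  have S: "0 \<le> S" unfolding S_def by (intro sum_nonneg) (simp add: lam0)
  obtain \<delta> where \<delta>: "\<delta> > 0" "\<And>x p p' e. norm (x - x0) < \<delta> \<Longrightarrow> norm p < \<delta> \<Longrightarrow> (\<forall>i. q x $ i \<le> p' $ i) \<Longrightarrow>
      e > 0 \<Longrightarrow> 0 \<le> \<kappa> \<Longrightarrow> \<exists>x'. (\<forall>i. q x' $ i \<le> p $ i) \<and> dist x x' < \<kappa> * dist p p' + e"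
    using metrically_regular_MqD[OF mr] by metis
  have main: "L * L \<le> norm G * (\<kappa> * L + e) + e * S" if e: "e > 0" for e
  proof -
    have R: "\<kappa> * L + e > 0" using \<kappa> L e by (simp add: add_pos_pos)
    note ev1 = first_order_expansion[OF e R, of x0]
    have pos: "\<delta> / L > 0" using \<delta> L by simp
    have ev2: "\<forall>\<^sub>F s in at_right 0. 0 < s \<and> s < \<delta> / L"
      unfolding eventually_at_right_field using pos by blast
    obtain s where s: "\<forall>i h. norm h \<le> (\<kappa> * L + e) * s \<longrightarrow>
        \<bar>q (x0 + h) $ i - q x0 $ i - gradq q i x0 \<bullet> h\<bar> \<le> e * s" "0 < s" "s < \<delta> / L"
      using eventually_happens[OF eventually_conj[OF ev1 ev2]] by auto
    have "norm (- (s *\<^sub>R lam)) < \<delta>" using s(2,3) L by (simp add: L_def field_simps)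
    then obtain x' where x': "\<forall>i. q x' $ i \<le> (- (s *\<^sub>R lam)) $ i"
        "dist x0 x' < \<kappa> * dist (- (s *\<^sub>R lam)) 0 + e * s"
      using \<delta>(2)[of x0 "- (s *\<^sub>R lam)" 0 "e * s"] \<delta>(1) x0 e s(2) \<kappa> by (auto simp: Gam_def)
    define h where "h = x' - x0"
    have nh: "norm h \<le> (\<kappa> * L + e) * s"
      using x'(2) s(2) by (simp add: h_def dist_norm norm_minus_commute L_def algebra_simps)
    have comp: "lam $ i * (gradq q i x0 \<bullet> h) \<le> - s * (lam $ i * lam $ i) + e * s * lam $ i" for i
    proof (cases "i \<in> active q x0")
      case True
      have "gradq q i x0 \<bullet> h \<le> q x' $ i + e * s"
        using s(1)[rule_format, OF nh, of i] True by (simp add: h_def active_def)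
      also have "\<dots> \<le> - s * lam $ i + e * s" using x'(1)[rule_format, of i] by simp
      finally have "lam $ i * (gradq q i x0 \<bullet> h) \<le> lam $ i * (- s * lam $ i + e * s)"
        using lam0[of i] by (rule mult_left_mono)
      then show ?thesis by (simp add: algebra_simps)
    next
      case False
      then show ?thesis using lam by (simp add: normal_orthant_def)
    qed
    have "G \<bullet> h = (\<Sum>i\<in>UNIV. lam $ i * (gradq q i x0 \<bullet> h))"
      by (simp add: G_def inner_sum_left)
    also have "\<dots> \<le> (\<Sum>i\<in>UNIV. - s * (lam $ i * lam $ i) + e * s * lam $ i)"
      by (rule sum_mono) (rule comp)
    also have "\<dots> = - s * (L * L) + e * s * S"
      unfolding sum.distrib S_def L_def power2_eq_square[symmetric] power2_norm_eq_inner inner_vec_def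
      by (simp add: sum_distrib_left power2_eq_square)
    finally have "s * (L * L) \<le> - (G \<bullet> h) + e * s * S" by simp
    also have "- (G \<bullet> h) \<le> norm G * norm h"
      using Cauchy_Schwarz_ineq2[of G h] by linarith
    also have "\<dots> \<le> norm G * ((\<kappa> * L + e) * s)" using nh by (intro mult_left_mono) auto
    finally have "s * (L * L) \<le> s * (norm G * (\<kappa> * L + e) + e * S)" by (simp add: algebra_simps)
    then show ?thesis using s(2) by simp
  qed
  have "L * L \<le> norm G * (\<kappa> * L)"
  proof (rule field_le_epsilon)
    fix e :: real assume e: "e > 0"
    \<comment> \<open>In \<open>main\<close> the slack of regularity is weighted by
      \<open>norm G\<close> and the Taylor error by \<open>S\<close>; with this choice the two add
      up to at most \<open>e\<close>.\<close>
    define c where "c = e / (norm G + S + 1)"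
    have c: "c > 0" unfolding c_def using e S by (intro divide_pos_pos) (auto intro: add_nonneg_pos)
    have "c * (norm G + S) \<le> c * (norm G + S + 1)" using c by simp
    also have "\<dots> = e" using S by (simp add: c_def add_nonneg_eq_0_iff)
    finally show "L * L \<le> norm G * (\<kappa> * L) + e" using main[OF c] by (simp add: algebra_simps)
  qed
  then have "L * L \<le> L * (\<kappa> * norm G)" by (simp add: algebra_simps)
  then show ?thesis using L by (simp add: L_def G_def)
qed

end

section \<open>Regular normals to the graph of the normal cone mapping\<close>

lemma tendsto_matrix_vector_mult:
  fixes A :: "'a \<Rightarrow> real^'n^'m"
  assumes A: "(A \<longlongrightarrow> A0) F" and w: "(w \<longlongrightarrow> w0) F"
  shows "((\<lambda>k. A k *v w k) \<longlongrightarrow> A0 *v w0) F"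
  unfolding matrix_vector_mult_def
  by (intro vec_tendstoI) (auto intro!: tendsto_intros A w)

abbreviation normal_graph :: "(real^'m \<Rightarrow> real^'l) \<Rightarrow> ((real^'m) \<times> (real^'m)) set" where
  "normal_graph q \<equiv> gph (regular_normal_cone (Gam q))"

text \<open>The form in which metric regularity is used from here on. One \<kappa> serves all
  feasible points near \<open>y\<close> other than \<open>y\<close>, so multipliers along a sequence
  stay bounded even if those at \<open>y\<close> are unbounded.\<close>

definition bounded_multipliers :: "real \<Rightarrow> (real^'m \<Rightarrow> real^'l) \<Rightarrow> real^'m \<Rightarrow> bool" where
  "bounded_multipliers \<kappa> q x \<longleftrightarrow> (\<forall>ys\<in>regular_normal_cone (Gam q) x.
     \<exists>lam\<in>normal_orthant q x. ys = gradsum q x lam \<and> norm lam \<le> \<kappa> * norm ys)"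

text \<open>Solving for the unit vectors and extending linearly selects solutions continuously and
  with a linear bound, as the Brouwer argument requires; an arbitrary pointwise choice would give
  neither.\<close>

lemma linear_selection:
  fixes R :: "('a::real_vector \<times> (real^'n)) set"
  assumes R: "subspace R" and ex: "\<And>\<alpha>. \<exists>p. (p, \<alpha>) \<in> R"
  shows "\<exists>G. linear G \<and> (\<forall>\<alpha>. (G \<alpha>, \<alpha>) \<in> R)"
proof -
  have "\<forall>i. \<exists>p. (p, axis i 1) \<in> R" by (rule allI) (rule ex)
  from choice[OF this] obtain p where p: "\<And>i. (p i, axis i 1) \<in> R"
    by auto
  define G where "G = (\<lambda>\<alpha>::real^'n. \<Sum>i\<in>UNIV. \<alpha> $ i *\<^sub>R p i)"
  have "linear G"
    unfolding G_def by (auto intro!: linearI simp: scaleR_left_distrib sum.distrib scaleR_sum_right)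
  moreover have "(G \<alpha>, \<alpha>) \<in> R" for \<alpha>
  proof -
    have "(\<Sum>i\<in>UNIV. \<alpha> $ i *\<^sub>R (p i, axis i 1)) \<in> R"
      by (intro subspace_sum[OF R] subspace_scale[OF R] p)
    moreover have "(\<Sum>i\<in>UNIV. \<alpha> $ i *\<^sub>R (p i, axis i 1)) = (G \<alpha>, \<alpha>)"
      using basis_expansion[of \<alpha>]
      by (simp add: prod_eq_iff fst_sum snd_sum G_def scalar_mult_eq_scaleR)
    ultimately show ?thesis by simp
  qed
  ultimately show ?thesis by blast
qed

lemma subseq_constant:
  fixes f :: "nat \<Rightarrow> 'a::finite"
  obtains r c where "strict_mono (r::nat \<Rightarrow> nat)" "\<And>k. f (r k) = c"
proof -
  obtain k0 where "infinite {k. f k = f k0}"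
    using pigeonhole_infinite[of "UNIV::nat set" f] by auto
  then obtain r :: "nat \<Rightarrow> nat" where "strict_mono r" "\<forall>n. r n \<in> {k. f k = f k0}"
    using infinite_enumerate by metis
  then show thesis using that[of r "f k0"] by auto
qed

text \<open>Bounded multipliers have a limit point, and finiteness of the index type fixes the two
  index sets. \<open>Ip\<close> is the support of the \<open>L k\<close>; that of \<open>lam\<close>
  may be smaller, since components can vanish in the limit.\<close>

lemma multiplier_subsequence:
  fixes q :: "real^'m \<Rightarrow> real^'l"
  assumes mult: "\<And>k. bounded_multipliers \<kappa> q (X k)"
    and Y: "\<And>k. Y k \<in> regular_normal_cone (Gam q) (X k)" and lim: "Y \<longlonglongrightarrow> ys"
  obtains r L lam I Ip where "strict_mono (r::nat\<Rightarrow>nat)" "L \<longlonglongrightarrow> lam" "\<And>k. active q (X (r k)) = I"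
    "\<And>k. L k \<in> normal_orthant q (X (r k))" "\<And>k. Y (r k) = gradsum q (X (r k)) (L k)"
    "\<And>k. {i. L k $ i > 0} = Ip"
proof -
  define P where "P k L \<longleftrightarrow> L \<in> normal_orthant q (X k) \<and> Y k = gradsum q (X k) L \<and> norm L \<le> \<kappa> * norm (Y k)" for k L
  have "\<exists>L. P k L" for k
    using mult[of k] Y[of k] unfolding bounded_multipliers_def P_def by auto
  then obtain L where L: "\<And>k. P k (L k)" by metis
  obtain M where M: "M > 0" "\<And>k. norm (Y k) \<le> M"
    using convergent_imp_bounded[OF lim] unfolding bounded_pos by auto
  have "norm (L k) \<le> \<bar>\<kappa>\<bar> * M" for k
  proof -
    have "\<kappa> * norm (Y k) \<le> \<bar>\<kappa>\<bar> * M" by (intro mult_mono) (use M in auto)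
    then show ?thesis using L[of k] unfolding P_def by linarith
  qed
  then have "bounded (range L)" unfolding bounded_iff by auto
  then obtain lam r where r: "strict_mono (r::nat\<Rightarrow>nat)" "(L \<circ> r) \<longlonglongrightarrow> lam"
    using bounded_imp_convergent_subsequence by metis
  obtain r' c where r': "strict_mono (r'::nat\<Rightarrow>nat)"
      "\<And>k. (\<lambda>k. (active q (X (r k)), {i. L (r k) $ i > 0})) (r' k) = c"
    using subseq_constant[of "\<lambda>k. (active q (X (r k)), {i. L (r k) $ i > 0})"] by blast
  have c: "active q (X (r (r' k))) = fst c" "{i. L (r (r' k)) $ i > 0} = snd c" for k
    using r'(2)[of k] by auto
  show thesis
  proof (rule that[of "r \<circ> r'" "\<lambda>k. L (r (r' k))" lam "fst c" "snd c"])
    show "strict_mono (r \<circ> r')" using r(1) r'(1) by (rule strict_mono_o)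
    show "(\<lambda>k. L (r (r' k))) \<longlonglongrightarrow> lam"
      using LIMSEQ_subseq_LIMSEQ[OF r(2) r'(1)] by (simp add: o_def)
  qed (use c L in \<open>simp_all add: P_def\<close>)
qed

context
  fixes q :: "real^'m \<Rightarrow> real^'l"
  assumes q2: "twice_cont_diff q"
begin

lemma inactive_nbhd:
  assumes "x \<in> Gam q"
  shows "\<forall>\<^sub>F x' in nhds x. \<forall>i. i \<notin> active q x \<longrightarrow> q x' $ i < 0"
proof (rule eventually_all_finite)
  fix i
  show "\<forall>\<^sub>F x' in nhds x. i \<notin> active q x \<longrightarrow> q x' $ i < 0"
  proof (cases "i \<in> active q x")
    case False
    have "isCont (\<lambda>x. q x $ i) x"
      using comp_continuous[OF q2, of i] by (simp add: continuous_on_eq_continuous_at)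
    then have "((\<lambda>x. q x $ i) \<longlongrightarrow> q x $ i) (nhds x)"
      unfolding isCont_def by (rule tendsto_at_iff_tendsto_nhds[THEN iffD1])
    moreover have "q x $ i < 0" using False assms by (auto simp: active_def Gam_def less_le)
    ultimately have "\<forall>\<^sub>F x' in nhds x. q x' $ i < 0" by (rule order_tendstoD(2))
    then show ?thesis by (rule eventually_mono) auto
  qed auto
qed

lemma gradsum_deriv:
  "((\<lambda>x. gradsum q x lam) has_derivative (\<lambda>h. hessL q lam x *v h)) (at x)"
proof -
  have "((\<lambda>x. gradsum q x lam) has_derivative
      (\<lambda>h. \<Sum>i\<in>UNIV. lam $ i *\<^sub>R (hessq q i x *v h))) (at x)"
    by (intro has_derivative_sum has_derivative_scaleR_right hessq_deriv[OF q2])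
  then show ?thesis unfolding hessL_mult[OF q2] .
qed

lemma tendsto_gradq:
  "X \<longlonglongrightarrow> x \<Longrightarrow> (\<lambda>k. gradq q i (X k)) \<longlonglongrightarrow> gradq q i x"
  by (rule continuous_on_tendsto_compose[OF gradq_continuous[OF q2]]) auto

lemma tendsto_gradsum:
  "X \<longlonglongrightarrow> x \<Longrightarrow> L \<longlonglongrightarrow> lam \<Longrightarrow> (\<lambda>k. gradsum q (X k) (L k)) \<longlonglongrightarrow> gradsum q x lam"
  by (intro tendsto_intros tendsto_gradq) auto

lemma tendsto_hessL_mult:
  assumes X: "X \<longlonglongrightarrow> x" and L: "L \<longlonglongrightarrow> lam" and w: "w \<longlonglongrightarrow> w0"
  shows "(\<lambda>k. hessL q (L k) (X k) *v w k) \<longlonglongrightarrow> hessL q lam x *v w0"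
proof -
  have "(\<lambda>k. hessq q i (X k)) \<longlonglongrightarrow> hessq q i x" for i
    by (rule continuous_on_tendsto_compose[OF hessq_continuous[OF q2] X]) auto
  then show ?thesis unfolding hessL_mult[OF q2]
    by (intro tendsto_intros tendsto_matrix_vector_mult w L)
qed

text \<open>A Lyusternik argument without uniqueness: for parameters \<open>a\<close> of size at
  most \<open>\<delta> * t\<close>, the constraint values at \<open>x + t u + G a\<close> differ
  from \<open>a\<close> plus the prescribed values by \<open>o(t)\<close>, so Brouwer's theorem
  finds an exact solution.\<close>

lemma curve_first_order:
  assumes surj: "\<And>\<alpha>::real^'l. \<exists>p. \<forall>i\<in>I. gradq q i x \<bullet> p = \<alpha> $ i"
    and act: "\<And>i. i \<in> I \<Longrightarrow> q x $ i = 0" and e: "e > 0"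
  shows "\<forall>\<^sub>F t in at_right 0. \<exists>x'. norm (x' - x - t *\<^sub>R u) \<le> e * t \<and>
           (\<forall>i\<in>I. q x' $ i = t * (gradq q i x \<bullet> u))"
proof -
  have "\<exists>G. linear G \<and> (\<forall>\<alpha>. (G \<alpha>, \<alpha>) \<in> {(p, \<alpha>). \<forall>i\<in>I. gradq q i x \<bullet> p = \<alpha> $ i})"
  proof (rule linear_selection)
    show "subspace {(p, \<alpha>). \<forall>i\<in>I. gradq q i x \<bullet> p = \<alpha> $ i}"
      by (auto simp: subspace_def inner_add_right zero_prod_def)
    show "\<exists>p. (p, \<alpha>) \<in> {(p, \<alpha>). \<forall>i\<in>I. gradq q i x \<bullet> p = \<alpha> $ i}" for \<alpha> :: "real^'l"
      using surj[of \<alpha>] by simp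
  qed
  then obtain G :: "real^'l \<Rightarrow> real^'m" where lin: "linear G"
      and G: "\<And>\<alpha> i. i \<in> I \<Longrightarrow> gradq q i x \<bullet> G \<alpha> = \<alpha> $ i"
    by auto
  have contG: "continuous_on UNIV G"
    using lin by (simp add: linear_continuous_on linear_conv_bounded_linear)
  obtain C where C: "C > 0" "\<And>\<alpha>. norm (G \<alpha>) \<le> C * norm \<alpha>"
    using linear_bounded_pos[OF lin] by blast
  \<comment> \<open>As \<open>C\<close> bounds \<open>G\<close>, parameters of norm at most
    \<open>\<delta> * t\<close> give corrections of norm at most \<open>e * t\<close>.\<close>
  define \<delta> where "\<delta> = e / C"
  have \<delta>: "\<delta> > 0" "C * \<delta> = e" using C e by (simp_all add: \<delta>_def)
  define R where "R = norm u + e"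
  have R: "R > 0" using e by (simp add: R_def add_nonneg_pos)
  define c where "c = \<delta> / CARD('l)"
  have c: "c > 0" using \<delta> by (simp add: c_def)
  note ev1 = first_order_expansion[OF q2 c R, of x]
  have ev2: "\<forall>\<^sub>F t in at_right 0. 0 < (t::real)"
    by (simp add: eventually_at_right_less)
  show ?thesis
  proof (rule eventually_mono[OF eventually_conj[OF ev1 ev2]], goal_cases)
    case t: (1 t)
    define F where "F a i = q (x + (t *\<^sub>R u + G a)) $ i - t * (gradq q i x \<bullet> u)" for a i
    have nG: "norm (G a) \<le> e * t" if "norm a \<le> \<delta> * t" for a
    proof -
      have "norm (G a) \<le> C * (\<delta> * t)"
        using C(2)[of a] that C(1) by (meson less_imp_le mult_left_mono order_trans)
      then show ?thesis using \<delta>(2) by (simp flip: mult.assoc)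
    qed
    have "\<exists>a. norm a \<le> \<delta> * t \<and> (\<forall>i\<in>I. F a i = 0)"
    proof (rule zero_on_components)
      show "0 \<le> \<delta> * t" using \<delta> t by simp
      fix i
      have "continuous_on UNIV (\<lambda>a. q (x + (t *\<^sub>R u + G a)) $ i)"
        by (rule continuous_on_compose2[OF comp_continuous[OF q2]])
          (auto intro!: continuous_on_add continuous_on_const contG)
      then show "continuous_on (cball 0 (\<delta> * t)) (\<lambda>a. F a i)"
        unfolding F_def by (intro continuous_on_diff continuous_on_const) (rule continuous_on_subset, auto)
      fix a :: "real^'l" assume a: "norm a \<le> \<delta> * t" and i: "i \<in> I"
      have h: "norm (t *\<^sub>R u + G a) \<le> R * t"
        using norm_triangle_ineq[of "t *\<^sub>R u" "G a"] nG[OF a] t by (simp add: R_def algebra_simps)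
      have "F a i - a $ i = q (x + (t *\<^sub>R u + G a)) $ i - q x $ i - gradq q i x \<bullet> (t *\<^sub>R u + G a)"
        using G[OF i, of a] act[OF i] by (simp add: F_def inner_add_right)
      then show "\<bar>F a i - a $ i\<bar> \<le> \<delta> * t / CARD('l)"
        using t h by (simp add: c_def)
    qed
    then obtain a where a: "norm a \<le> \<delta> * t" "\<forall>i\<in>I. F a i = 0" by blast
    show ?case
      using nG[OF a(1)] a(2) by (intro exI[of _ "x + (t *\<^sub>R u + G a)"]) (simp add: F_def)
  qed
qed

text \<open>Two families of tangents to the graph are tested. Changing one multiplier at fixed
  \<open>x\<close> gives vertical tangents, which put \<open>w\<close> in the critical cone. Keeping
  \<open>lam\<close> and moving \<open>x\<close> in a critical direction \<open>v\<close> gives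
  \<open>(v, hessL q lam x *v v)\<close>, which yields the polarity.\<close>

lemma graph_normal_cone_subset:
  assumes x: "x \<in> Gam q" and lam: "lam \<in> normal_orthant q x" and ys: "ys = gradsum q x lam"
    and Ip: "Ip = {i. lam $ i > 0}"
    and surj: "\<And>\<alpha>::real^'l. \<exists>p. \<forall>i\<in>active q x. gradq q i x \<bullet> p = \<alpha> $ i"
    and n: "(ws, w) \<in> regular_normal_cone (normal_graph q) (x, ys)"
  shows "w \<in> KI q x Ip (active q x)"
    and "ws + hessL q lam x *v w \<in> neg_polar (KI q x Ip (active q x))"
proof -
  define T where "T = contingent_cone (normal_graph q) (x, ys)"
  have n': "ws \<bullet> a + w \<bullet> b \<le> 0" if "(a, b) \<in> T" for a b
    using n that unfolding regular_normal_cone_def[of "gph _"] neg_polar_def T_def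
    by (auto split: if_splits)
  have IpI: "Ip \<subseteq> active q x" using lam Ip by (auto simp: normal_orthant_def)
  \<comment> \<open>A multiplier may be increased at any active index but decreased only where it is
    positive; hence equality for \<open>w\<close> on \<open>Ip\<close> and an inequality
    elsewhere.\<close>
  have vert: "(0, c *\<^sub>R gradq q i x) \<in> T" if i: "i \<in> active q x" and c: "c = 1 \<or> (c = -1 \<and> i \<in> Ip)" for i c
    unfolding T_def
  proof (rule contingent_coneI)
    fix e :: real assume e: "e > 0"
    obtain t where t: "0 < t" "t < e" "i \<in> Ip \<longrightarrow> t \<le> lam $ i"
    proof (cases "i \<in> Ip")
      case True
      then show thesis using e Ip that[of "min (e/2) (lam $ i)"] by auto
    next
      case False
      then show thesis using e that[of "e/2"] by auto
    qed
    define lam' where "lam' = lam + axis i (t * c)"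
    have "lam' \<in> normal_orthant q x"
      using lam t c i unfolding lam'_def normal_orthant_def by (auto simp: axis_def)
    then have "gradsum q x lam' \<in> regular_normal_cone (Gam q) x"
      by (rule regular_normal_coneI[OF q2 x])
    moreover have "gradsum q x lam' = ys + t *\<^sub>R (c *\<^sub>R gradq q i x)"
    proof -
      have "axis i (t * c) $ j *\<^sub>R gradq q j x = (if j = i then (t * c) *\<^sub>R gradq q i x else 0)" for j
        by (simp add: axis_def)
      then show ?thesis
        by (simp add: lam'_def ys scaleR_left_distrib sum.distrib)
    qed
    ultimately have "(x, ys + t *\<^sub>R (c *\<^sub>R gradq q i x)) \<in> normal_graph q"
      by (simp add: gph_def)
    moreover have "(x, ys + t *\<^sub>R (c *\<^sub>R gradq q i x)) - (x, ys) - t *\<^sub>R (0, c *\<^sub>R gradq q i x) = 0"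
      by (simp add: zero_prod_def)
    ultimately show "\<exists>t X. 0 < t \<and> t < e \<and> X \<in> normal_graph q \<and>
        norm (X - (x, ys) - t *\<^sub>R (0, c *\<^sub>R gradq q i x)) \<le> e * t"
      using t(1,2) e by (metis less_imp_le mult_nonneg_nonneg norm_zero)
  qed
  show "w \<in> KI q x Ip (active q x)"
    unfolding KI_def
  proof (intro CollectI conjI ballI)
    fix i assume "i \<in> Ip"
    then show "gradq q i x \<bullet> w = 0"
      using n'[OF vert[of i 1]] n'[OF vert[of i "-1"]] IpI by (auto simp: inner_commute)
  next
    fix i assume "i \<in> active q x - Ip"
    then show "gradq q i x \<bullet> w \<le> 0"
      using n'[OF vert[of i 1]] by (auto simp: inner_commute)
  qed
  show "ws + hessL q lam x *v w \<in> neg_polar (KI q x Ip (active q x))"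
    unfolding neg_polar_def
  proof (intro CollectI ballI)
    fix v assume v: "v \<in> KI q x Ip (active q x)"
    \<comment> \<open>Keeping the constraints in \<open>Ip\<close> active preserves complementarity,
      so \<open>lam\<close> itself remains a multiplier at every point of \<Omega>.\<close>
    define \<Omega> where "\<Omega> = {x' \<in> Gam q. \<forall>i\<in>Ip. q x' $ i = 0}"
    have "v \<in> contingent_cone \<Omega> x"
    proof (rule contingent_coneI)
      fix e :: real assume e: "e > 0"
      obtain d where d: "d > 0" "\<And>x'. dist x' x < d \<Longrightarrow> (\<forall>i. i \<notin> active q x \<longrightarrow> q x' $ i < 0)"
        using inactive_nbhd[OF x] unfolding eventually_nhds_metric by blast
      define R where "R = norm v + e"
      have R: "R > 0" using e by (simp add: R_def add_nonneg_pos)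
      have ev1: "\<forall>\<^sub>F t in at_right 0. \<exists>x'. norm (x' - x - t *\<^sub>R v) \<le> e * t \<and>
           (\<forall>i\<in>active q x. q x' $ i = t * (gradq q i x \<bullet> v))"
        by (rule curve_first_order[OF surj _ e]) (auto simp: active_def)
      have pos: "min e (d / R) > 0" using e d R by simp
      have ev2: "\<forall>\<^sub>F t in at_right 0. 0 < t \<and> t < min e (d / R)"
        unfolding eventually_at_right_field using pos by blast
      obtain t x' where t: "0 < t" "t < e" "t < d / R" and x': "norm (x' - x - t *\<^sub>R v) \<le> e * t"
           "\<forall>i\<in>active q x. q x' $ i = t * (gradq q i x \<bullet> v)"
        using eventually_happens[OF eventually_conj[OF ev1 ev2]] by auto
      have "norm (x' - x) \<le> norm (x' - x - t *\<^sub>R v) + norm (t *\<^sub>R v)"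
        using norm_triangle_ineq[of "x' - x - t *\<^sub>R v" "t *\<^sub>R v"] by simp
      also have "\<dots> \<le> R * t" using x'(1) t by (simp add: R_def algebra_simps)
      also have "\<dots> < d" using t R by (simp add: field_simps)
      finally have inact: "\<forall>i. i \<notin> active q x \<longrightarrow> q x' $ i < 0" using d(2) by (simp add: dist_norm)
      have "q x' $ i \<le> 0" for i
      proof (cases "i \<in> active q x")
        case True
        have "gradq q i x \<bullet> v \<le> 0" using v True unfolding KI_def by (cases "i \<in> Ip") auto
        then show ?thesis using x'(2) True t(1) by (simp add: mult_nonneg_nonpos)
      qed (use inact in \<open>auto intro: less_imp_le\<close>)
      moreover have "\<forall>i\<in>Ip. q x' $ i = 0" using x'(2) v IpI unfolding KI_def by auto
      ultimately have "x' \<in> \<Omega>" by (simp add: \<Omega>_def Gam_def)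
      then show "\<exists>t x'. 0 < t \<and> t < e \<and> x' \<in> \<Omega> \<and> norm (x' - x - t *\<^sub>R v) \<le> e * t"
        using t x' by blast
    qed
    then obtain t :: "nat \<Rightarrow> real" and U where tU: "\<forall>k. t k > 0" "t \<longlonglongrightarrow> 0" "U \<longlonglongrightarrow> v" "\<forall>k. x + t k *\<^sub>R U k \<in> \<Omega>"
      unfolding contingent_cone_def by blast
    define Y where "Y = (\<lambda>k. (1 / t k) *\<^sub>R (gradsum q (x + t k *\<^sub>R U k) lam - gradsum q x lam))"
    have Y: "Y \<longlonglongrightarrow> hessL q lam x *v v"
      unfolding Y_def by (rule difference_quotient_tendsto[OF gradsum_deriv]) (use tU in auto)
    have mem: "(x, ys) + t k *\<^sub>R (U k, Y k) \<in> normal_graph q" for k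
    proof -
      have O: "x + t k *\<^sub>R U k \<in> \<Omega>" using tU(4) by blast
      then have "lam \<in> normal_orthant q (x + t k *\<^sub>R U k)"
        using lam Ip by (auto simp: normal_orthant_def \<Omega>_def active_def less_le)
      then have "gradsum q (x + t k *\<^sub>R U k) lam \<in> regular_normal_cone (Gam q) (x + t k *\<^sub>R U k)"
        using O by (intro regular_normal_coneI[OF q2]) (auto simp: \<Omega>_def)
      moreover have "ys + t k *\<^sub>R Y k = gradsum q (x + t k *\<^sub>R U k) lam"
        using tU(1)[rule_format, of k] by (simp add: Y_def ys)
      ultimately show ?thesis by (simp add: gph_def)
    qed
    have "(v, hessL q lam x *v v) \<in> T"
      unfolding T_def contingent_cone_def
      using tU(1,2) mem tendsto_Pair[OF tU(3) Y]
      by (intro CollectI exI[of _ t] exI[of _ "\<lambda>k. (U k, Y k)"]) simp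
    from n'[OF this] show "(ws + hessL q lam x *v w) \<bullet> v \<le> 0"
      using hessL_sym[OF q2, of w lam x v] by (simp add: inner_add_left inner_add_right inner_commute)
  qed
qed

text \<open>Every tangent \<open>(a, b)\<close> of the graph has \<open>a\<close> in the critical
  cone and \<open>b - hessL q lam x *v a\<close> in its polar. Symmetry of the Hessian rewrites the
  pairing as \<open>(ws + hessL q lam x *v w) \<bullet> a + (b - hessL q lam x *v a) \<bullet>
  w\<close>, a sum of two nonpositive terms.\<close>

lemma graph_normal_cone_supset:
  assumes x: "x \<in> Gam q" and lam: "lam \<in> normal_orthant q x" and ys: "ys = gradsum q x lam"
    and Ip: "Ip = {i. lam $ i > 0}"
    and surj: "\<And>\<alpha>::real^'l. \<exists>p. \<forall>i\<in>active q x. gradq q i x \<bullet> p = \<alpha> $ i"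
    and mult: "\<forall>\<^sub>F x' in nhds x. x' \<in> Gam q \<longrightarrow> bounded_multipliers \<kappa> q x'"
    and w: "w \<in> KI q x Ip (active q x)"
    and ws: "ws + hessL q lam x *v w \<in> neg_polar (KI q x Ip (active q x))"
  shows "(ws, w) \<in> regular_normal_cone (normal_graph q) (x, ys)"
proof -
  let ?K = "KI q x Ip (active q x)"
  have IpI: "Ip \<subseteq> active q x" using lam Ip by (auto simp: normal_orthant_def)
  have main: "ws \<bullet> a + w \<bullet> b \<le> 0"
    if ab: "(a, b) \<in> contingent_cone (normal_graph q) (x, ys)" for a b
  proof -
    obtain t :: "nat \<Rightarrow> real" and U where tU: "\<forall>k. t k > 0" "t \<longlonglongrightarrow> 0" "U \<longlonglongrightarrow> (a, b)"
        "\<forall>k. (x, ys) + t k *\<^sub>R U k \<in> normal_graph q"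
      using ab unfolding contingent_cone_def by blast
    define A where "A = (\<lambda>k. fst (U k))"
    define B where "B = (\<lambda>k. snd (U k))"
    have A: "A \<longlonglongrightarrow> a" and B: "B \<longlonglongrightarrow> b"
      using tendsto_fst[OF tU(3)] tendsto_snd[OF tU(3)] by (simp_all add: A_def B_def)
    have memYs: "ys + t k *\<^sub>R B k \<in> regular_normal_cone (Gam q) (x + t k *\<^sub>R A k)" for k
      using tU(4)[rule_format, of k] by (simp add: gph_def A_def B_def split_beta)
    then have memX: "x + t k *\<^sub>R A k \<in> Gam q" for k
      unfolding regular_normal_cone_def by (metis empty_iff)
    have X: "(\<lambda>k. x + t k *\<^sub>R A k) \<longlonglongrightarrow> x"
      using tendsto_add[OF tendsto_const tendsto_scaleR[OF tU(2) A], of x] by simp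
    have Y: "(\<lambda>k. ys + t k *\<^sub>R B k) \<longlonglongrightarrow> ys"
      using tendsto_add[OF tendsto_const tendsto_scaleR[OF tU(2) B], of ys] by simp
    have ev: "\<forall>\<^sub>F k in sequentially. (x + t k *\<^sub>R A k \<in> Gam q \<longrightarrow> bounded_multipliers \<kappa> q (x + t k *\<^sub>R A k)) \<and>
        (\<forall>i. i \<notin> active q x \<longrightarrow> q (x + t k *\<^sub>R A k) $ i < 0)"
      using eventually_conj[OF mult inactive_nbhd[OF x]] X unfolding filterlim_iff by blast
    then obtain N where N: "\<And>k. k \<ge> N \<Longrightarrow> bounded_multipliers \<kappa> q (x + t k *\<^sub>R A k)"
        "\<And>k i. k \<ge> N \<Longrightarrow> i \<notin> active q x \<Longrightarrow> q (x + t k *\<^sub>R A k) $ i < 0"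
      unfolding eventually_sequentially using memX by blast
    obtain r L lam' I' Ip' where r: "strict_mono (r::nat \<Rightarrow> nat)" and L: "L \<longlonglongrightarrow> lam'"
      and act': "\<And>k. active q (x + t (r k + N) *\<^sub>R A (r k + N)) = I'"
      and rL: "\<And>k. L k \<in> normal_orthant q (x + t (r k + N) *\<^sub>R A (r k + N))"
        "\<And>k. ys + t (r k + N) *\<^sub>R B (r k + N) = gradsum q (x + t (r k + N) *\<^sub>R A (r k + N)) (L k)"
        "\<And>k. {i. L k $ i > 0} = Ip'"
      by (rule multiplier_subsequence[of \<kappa> q "\<lambda>k. x + t (k + N) *\<^sub>R A (k + N)"
          "\<lambda>k. ys + t (k + N) *\<^sub>R B (k + N)" ys, OF N(1)[OF le_add2] memYs LIMSEQ_ignore_initial_segment[OF Y]])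
        (rule that; assumption)
    define \<rho> where "\<rho> = (\<lambda>k. r k + N)"
    have \<rho>: "strict_mono \<rho>" using r by (simp add: \<rho>_def strict_mono_def)
    have \<rho>N: "\<rho> k \<ge> N" for k by (simp add: \<rho>_def)
    define s where "s = t \<circ> \<rho>"
    define a' where "a' = A \<circ> \<rho>"
    define b' where "b' = B \<circ> \<rho>"
    define z where "z = (\<lambda>k. x + s k *\<^sub>R a' k)"
    have s: "\<And>k. s k > 0" "s \<longlonglongrightarrow> 0" using tU(1) LIMSEQ_subseq_LIMSEQ[OF tU(2) \<rho>] by (auto simp: s_def)
    have a': "a' \<longlonglongrightarrow> a" using LIMSEQ_subseq_LIMSEQ[OF A \<rho>] by (simp add: a'_def)
    have b': "b' \<longlonglongrightarrow> b" using LIMSEQ_subseq_LIMSEQ[OF B \<rho>] by (simp add: b'_def)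
    have z: "z \<longlonglongrightarrow> x"
      using LIMSEQ_subseq_LIMSEQ[OF X \<rho>] by (simp add: z_def s_def a'_def o_def)
    have zG: "z k \<in> Gam q" for k using memX by (simp add: z_def s_def a'_def)
    have Lz: "L k \<in> normal_orthant q (z k)" for k
      using rL(1) by (simp add: z_def s_def a'_def \<rho>_def)
    have Leq: "ys + s k *\<^sub>R b' k = gradsum q (z k) (L k)" for k
      using rL(2) by (simp add: z_def s_def a'_def b'_def \<rho>_def)
    have Linact: "L k $ i = 0" if "i \<notin> active q x" for k i
    proof -
      have "q (z k) $ i < 0" using N(2)[OF \<rho>N that, of k] by (simp add: z_def s_def a'_def)
      then show ?thesis using Lz[of k] by (auto simp: normal_orthant_def active_def)
    qed
    have L0': "0 \<le> L k $ i" for k i using Lz[of k] by (simp add: normal_orthant_def)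
    have "(\<lambda>k. ys + s k *\<^sub>R b' k) \<longlonglongrightarrow> ys + 0 *\<^sub>R b"
      by (intro tendsto_intros s b')
    moreover have "(\<lambda>k. ys + s k *\<^sub>R b' k) \<longlonglongrightarrow> gradsum q x lam'"
      unfolding Leq by (rule tendsto_gradsum[OF z L])
    ultimately have eq: "gradsum q x lam' = gradsum q x lam"
      using LIMSEQ_unique ys by fastforce
    have lam'0: "lam' $ i = 0" if i: "i \<notin> active q x" for i
    proof -
      have "(\<lambda>k. L k $ i) \<longlonglongrightarrow> lam' $ i" by (intro tendsto_vec_nth L)
      then show ?thesis using Linact[OF i] by (simp add: LIMSEQ_const_iff)
    qed
    \<comment> \<open>Uniqueness of the multiplier from independent gradients: paired with the test
      vector \<open>p\<close>, the difference of the two gradient sums becomes the squared norm of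
      \<open>lam' - lam\<close>.\<close>
    have lameq: "lam' = lam"
    proof -
      obtain p where p: "\<forall>i\<in>active q x. gradq q i x \<bullet> p = (lam' - lam) $ i" using surj by blast
      have *: "(lam' $ i - lam $ i) * (gradq q i x \<bullet> p) = (lam' $ i - lam $ i) * (lam' $ i - lam $ i)" for i
        using p lam'0[of i] lam by (cases "i \<in> active q x") (auto simp: normal_orthant_def)
      have "(gradsum q x lam' - gradsum q x lam) \<bullet> p = (\<Sum>i\<in>UNIV. (lam' $ i - lam $ i) * (gradq q i x \<bullet> p))"
        by (simp add: inner_diff_left inner_sum_left left_diff_distrib sum_subtractf)
      also have "\<dots> = (lam' - lam) \<bullet> (lam' - lam)"
        unfolding * by (simp add: inner_vec_def)
      finally show ?thesis using eq by simp
    qed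
    have act_ev: "\<forall>\<^sub>F k in sequentially. q (z k) $ i = 0" if i: "i \<in> Ip" for i
    proof -
      have "(\<lambda>k. L k $ i) \<longlonglongrightarrow> lam $ i" using tendsto_vec_nth[OF L] lameq by simp
      then have "\<forall>\<^sub>F k in sequentially. 0 < L k $ i"
        using i Ip by (intro order_tendstoD(1)) auto
      then show ?thesis
      proof (rule eventually_mono)
        fix k assume "0 < L k $ i"
        then show "q (z k) $ i = 0" using Lz[of k] by (auto simp: normal_orthant_def active_def)
      qed
    qed
    have aK: "a \<in> ?K"
      unfolding KI_def
    proof (intro CollectI conjI ballI)
      fix i assume i: "i \<in> Ip"
      have lim: "(\<lambda>k. (1 / s k) *\<^sub>R (q (x + s k *\<^sub>R a' k) $ i - q x $ i)) \<longlonglongrightarrow> gradq q i x \<bullet> a"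
        by (rule difference_quotient_tendsto[OF gradq_deriv[OF q2]]) (use s a' in auto)
      have "\<forall>\<^sub>F k in sequentially. (1 / s k) *\<^sub>R (q (x + s k *\<^sub>R a' k) $ i - q x $ i) = 0"
        using act_ev[OF i] by (rule eventually_mono) (use i IpI in \<open>auto simp: z_def active_def\<close>)
      from LIMSEQ_unique[OF lim tendsto_eventually[OF this]] show "gradq q i x \<bullet> a = 0" .
    next
      fix i assume i: "i \<in> active q x - Ip"
      have lim: "(\<lambda>k. (1 / s k) *\<^sub>R (q (x + s k *\<^sub>R a' k) $ i - q x $ i)) \<longlonglongrightarrow> gradq q i x \<bullet> a"
        by (rule difference_quotient_tendsto[OF gradq_deriv[OF q2]]) (use s a' in auto)
      have "(1 / s k) *\<^sub>R (q (x + s k *\<^sub>R a' k) $ i - q x $ i) \<le> 0" for k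
        using s(1)[of k] zG[of k] i by (auto simp: Gam_def active_def divide_nonpos_pos z_def)
      then show "gradq q i x \<bullet> a \<le> 0" using LIMSEQ_le_const2[OF lim] by blast
    qed
    have bK: "(b - hessL q lam x *v a) \<bullet> u \<le> 0" if u: "u \<in> ?K" for u
    proof -
      \<comment> \<open>No convergence of \<open>(L k - lam) / s k\<close> is available, so the
        gradient differences are weighted with \<open>L k\<close>. What is left over is a
        combination of the \<open>gradq q i x\<close> with coefficients \<open>L k - lam\<close>,
        whose pairing with \<open>u\<close> has a sign.\<close>
      define D where "D = (\<lambda>k. \<Sum>i\<in>UNIV. L k $ i *\<^sub>R ((1 / s k) *\<^sub>R (gradq q i (z k) - gradq q i x)))"
      have dq: "(\<lambda>k. (1 / s k) *\<^sub>R (gradq q i (z k) - gradq q i x)) \<longlonglongrightarrow> hessq q i x *v a" for i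
        unfolding z_def by (rule difference_quotient_tendsto[OF hessq_deriv[OF q2]]) (use s a' in auto)
      have "D \<longlonglongrightarrow> hessL q lam x *v a"
        unfolding D_def hessL_mult[OF q2] lameq[symmetric] by (intro tendsto_intros dq L)
      then have lim: "(\<lambda>k. (b' k - D k) \<bullet> u) \<longlonglongrightarrow> (b - hessL q lam x *v a) \<bullet> u"
        by (intro tendsto_intros b')
      have "(b' k - D k) \<bullet> u \<le> 0" for k
      proof -
        have "s k *\<^sub>R D k = gradsum q (z k) (L k) - gradsum q x (L k)"
          using s(1)[of k]
          by (simp add: D_def scaleR_sum_right sum_subtractf algebra_simps)
        then have "s k *\<^sub>R (b' k - D k) = gradsum q x (L k) - ys"
          using Leq[of k] by (simp add: algebra_simps)
        then have "(s k *\<^sub>R (b' k - D k)) \<bullet> u = (\<Sum>i\<in>UNIV. (L k $ i - lam $ i) * (gradq q i x \<bullet> u))"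
          by (simp only: ys inner_diff_left inner_sum_left left_diff_distrib sum_subtractf inner_scaleR_left)
        then have "s k * ((b' k - D k) \<bullet> u) = (\<Sum>i\<in>UNIV. (L k $ i - lam $ i) * (gradq q i x \<bullet> u))"
          by (simp only: inner_scaleR_left)
        also have "\<dots> \<le> 0"
        proof (rule sum_nonpos)
          fix i
          have "lam $ i = 0" if "i \<notin> Ip" using lam that Ip by (auto simp: normal_orthant_def less_le)
          then show "(L k $ i - lam $ i) * (gradq q i x \<bullet> u) \<le> 0"
            using u Linact[of i k] L0'[of k i] unfolding KI_def
            by (cases "i \<in> Ip"; cases "i \<in> active q x") (auto simp: mult_nonneg_nonpos)
        qed
        finally show ?thesis using s(1)[of k] by (simp add: mult_le_0_iff)
      qed
      then show ?thesis using LIMSEQ_le_const2[OF lim] by blast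
    qed
    have "(ws + hessL q lam x *v w) \<bullet> a \<le> 0" using ws aK by (simp add: neg_polar_def)
    moreover have "(b - hessL q lam x *v a) \<bullet> w \<le> 0" using bK[OF w] .
    moreover have "w \<bullet> (hessL q lam x *v a) = a \<bullet> (hessL q lam x *v w)" by (rule hessL_sym[OF q2])
    ultimately show ?thesis
      by (simp add: inner_add_left inner_diff_left inner_add_right inner_diff_right inner_commute)
  qed
  have "(x, ys) \<in> normal_graph q"
    using regular_normal_coneI[OF q2 x lam] by (simp add: gph_def ys)
  then show ?thesis
    unfolding regular_normal_cone_def[of "gph _"] neg_polar_def using main by auto
qed

end

section \<open>Critical cones along a directional sequence\<close>

lemma two_regular_mono: "two_regular q J y u \<Longrightarrow> I \<subseteq> J \<Longrightarrow> two_regular q I y u"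
  unfolding two_regular_def by (meson subsetD)

lemma KI_closed_cone: "closed (KI q x Ip I)" "convex_cone (KI q x Ip I)"
proof -
  have "KI q x Ip I = (\<Inter>i\<in>Ip. {w. gradq q i x \<bullet> w = 0}) \<inter> (\<Inter>i\<in>I - Ip. {w. gradq q i x \<bullet> w \<le> 0})"
    by (auto simp: KI_def)
  then show "closed (KI q x Ip I)"
    by (simp add: closed_INT closed_hyperplane closed_halfspace_le closed_Int)
  show "convex_cone (KI q x Ip I)"
    unfolding convex_cone_iff KI_def
    by (auto simp: inner_add_right add_nonpos_nonpos mult_nonneg_nonpos)
qed

lemma normal_orthant_contingentI:
  assumes lam: "lam \<in> normal_orthant q y"
    and mu: "\<And>i. lam $ i = 0 \<Longrightarrow> 0 \<le> mu $ i" "\<And>i. i \<notin> active q y \<Longrightarrow> mu $ i = 0"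
  shows "mu \<in> contingent_cone (normal_orthant q y) lam"
proof (rule contingent_coneI)
  fix e :: real assume e: "e > 0"
  have "\<forall>\<^sub>F t in at_right 0. \<forall>i. 0 \<le> lam $ i + t * mu $ i"
  proof (rule eventually_all_finite)
    fix i
    show "\<forall>\<^sub>F t in at_right 0. 0 \<le> lam $ i + t * mu $ i"
    proof (cases "lam $ i = 0")
      case True
      then show ?thesis using mu(1)[of i]
        by (auto intro!: eventually_mono[OF eventually_at_right_less[of 0]])
    next
      case False
      have "((\<lambda>t. lam $ i + t * mu $ i) \<longlongrightarrow> lam $ i + 0 * mu $ i) (at_right 0)"
        by (intro tendsto_intros)
      moreover have "0 < lam $ i" using lam False by (auto simp: normal_orthant_def less_le)
      ultimately have "\<forall>\<^sub>F t in at_right 0. 0 < lam $ i + t * mu $ i"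
        by (intro order_tendstoD(1)) auto
      then show ?thesis by (rule eventually_mono) auto
    qed
  qed
  moreover have "\<forall>\<^sub>F t in at_right 0. 0 < t \<and> t < e"
    unfolding eventually_at_right_field using e by blast
  ultimately obtain t where t: "\<forall>i. 0 \<le> lam $ i + t * mu $ i" "0 < t" "t < e"
    using eventually_happens[OF eventually_conj] by (metis (no_types, lifting) trivial_limit_at_right_real)
  have "lam + t *\<^sub>R mu \<in> normal_orthant q y"
    using lam mu(2) t(1) by (auto simp: normal_orthant_def)
  then show "\<exists>t x. 0 < t \<and> t < e \<and> x \<in> normal_orthant q y \<and> norm (x - lam - t *\<^sub>R mu) \<le> e * t"
    using t(2,3) e by (intro exI[of _ t] exI[of _ "lam + t *\<^sub>R mu"]) auto
qed

lemma normal_orthant_contingentD: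
  assumes lam: "lam \<in> normal_orthant q y" and mu: "mu \<in> contingent_cone (normal_orthant q y) lam"
  shows "lam $ i = 0 \<Longrightarrow> 0 \<le> mu $ i" "i \<notin> active q y \<Longrightarrow> mu $ i = 0"
proof -
  obtain t :: "nat \<Rightarrow> real" and U where tU: "\<forall>k. t k > 0" "t \<longlonglongrightarrow> 0" "U \<longlonglongrightarrow> mu"
      "\<forall>k. lam + t k *\<^sub>R U k \<in> normal_orthant q y"
    using mu unfolding contingent_cone_def by blast
  have lim: "(\<lambda>k. U k $ i) \<longlonglongrightarrow> mu $ i" by (intro tendsto_vec_nth tU)
  show "0 \<le> mu $ i" if 0: "lam $ i = 0"
  proof -
    have "0 \<le> U k $ i" for k
    proof -
      have "0 \<le> t k * U k $ i" using tU(4)[rule_format, of k] 0 by (auto simp: normal_orthant_def dest!: spec[of _ i])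
      then show ?thesis using tU(1)[rule_format, of k] by (simp add: zero_le_mult_iff)
    qed
    then show ?thesis using LIMSEQ_le_const[OF lim] by blast
  qed
  show "mu $ i = 0" if i: "i \<notin> active q y"
  proof -
    have "U k $ i = 0" for k
    proof -
      have "lam $ i + t k * U k $ i = 0" "lam $ i = 0"
        using tU(4)[rule_format, of k] lam i by (auto simp: normal_orthant_def)
      then show ?thesis using tU(1)[rule_format, of k] by simp
    qed
    then show ?thesis using lim by (simp add: LIMSEQ_const_iff)
  qed
qed

lemma direction_tendsto:
  fixes y u :: "'a::real_normed_vector"
  assumes "s \<longlonglongrightarrow> (0::real)" "U \<longlonglongrightarrow> u"
  shows "(\<lambda>k. y + s k *\<^sub>R U k) \<longlonglongrightarrow> y"
  using tendsto_add[OF tendsto_const tendsto_scaleR[OF assms], of y] by simp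

text \<open>Solution pairs form a linear relation with the right-hand side, so
  \<open>linear_selection\<close> gives both unknowns as linear functions of it.\<close>

lemma two_regular_selection:
  fixes q :: "real^'m \<Rightarrow> real^'l"
  assumes reg: "two_regular q I y u"
  obtains a b :: "real^'l \<Rightarrow> real^'m" and C where "C > 0" "\<And>S. continuous_on S a" "\<And>S. continuous_on S b"
    "\<And>\<alpha>. norm (a \<alpha>) \<le> C * norm \<alpha>" "\<And>\<alpha>. norm (b \<alpha>) \<le> C * norm \<alpha>"
    "\<And>\<alpha> i. i \<in> I \<Longrightarrow> gradq q i y \<bullet> a \<alpha> + u \<bullet> (hessq q i y *v b \<alpha>) = \<alpha> $ i"
    "\<And>\<alpha> i. i \<in> I \<Longrightarrow> gradq q i y \<bullet> b \<alpha> = 0"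
proof -
  define R where "R = {(p, \<alpha>::real^'l). \<forall>i\<in>I.
     \<alpha> $ i = gradq q i y \<bullet> fst p + u \<bullet> (hessq q i y *v snd p) \<and> gradq q i y \<bullet> snd p = 0}"
  have "subspace R"
    unfolding subspace_def R_def
    by (auto simp: inner_add_right zero_prod_def matrix_vector_right_distrib matrix_vector_mult_scaleR
        distrib_left)
  moreover have "\<exists>p. (p, \<alpha>) \<in> R" for \<alpha>
  proof -
    obtain a b where "\<forall>i\<in>I. gradq q i y \<bullet> a + u \<bullet> (hessq q i y *v b) = \<alpha> $ i \<and> gradq q i y \<bullet> b = 0"
      using reg unfolding two_regular_def by blast
    then have "((a, b), \<alpha>) \<in> R" by (simp add: R_def)
    then show ?thesis by blast
  qed
  ultimately obtain G where lin: "linear G" and G: "\<forall>\<alpha>. (G \<alpha>, \<alpha>) \<in> R"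
    using linear_selection[of R] by auto
  obtain C where C: "C > 0" "\<And>\<alpha>. norm (G \<alpha>) \<le> C * norm \<alpha>"
    using linear_bounded_pos[OF lin] by blast
  have "continuous_on S G" for S
    using lin by (simp add: linear_continuous_on linear_conv_bounded_linear)
  moreover have "norm (fst (G \<alpha>)) \<le> C * norm \<alpha>" "norm (snd (G \<alpha>)) \<le> C * norm \<alpha>" for \<alpha>
    using C(2)[of \<alpha>] norm_fst_le[of "fst (G \<alpha>)" "snd (G \<alpha>)"] norm_snd_le[of "snd (G \<alpha>)" "fst (G \<alpha>)"]
    by simp_all
  ultimately show thesis
    using C(1) G by (intro that[of C "\<lambda>\<alpha>. fst (G \<alpha>)" "\<lambda>\<alpha>. snd (G \<alpha>)"])
      (auto simp: R_def intro!: continuous_intros)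
qed

section \<open>Two-regularity along a directional sequence and limits of critical cones\<close>

context
  fixes q :: "real^'m \<Rightarrow> real^'l"
  assumes q2: "twice_cont_diff q"
begin

text \<open>The first-order term is subtracted at \<open>U k\<close>, not at \<open>u\<close>: the
  difference between the two is only \<open>o(s k)\<close> and could swamp the second-order
  quotient.\<close>

lemma second_difference_quotient_tendsto:
  assumes s: "\<And>k. s k > (0::real)" "s \<longlonglongrightarrow> 0" and U: "U \<longlonglongrightarrow> u"
  shows "(\<lambda>k. (q (y + s k *\<^sub>R U k) $ i - q y $ i - s k * (gradq q i y \<bullet> U k)) / (s k)\<^sup>2)
    \<longlonglongrightarrow> (u \<bullet> (hessq q i y *v u)) / 2"
proof -
  define D where "D = (\<lambda>k. (q (y + s k *\<^sub>R U k) $ i - q y $ i - s k * (gradq q i y \<bullet> U k)) / (s k)\<^sup>2)"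
  define H where "H = (\<lambda>k. (U k \<bullet> (hessq q i y *v U k)) / 2)"
  obtain M where M: "M > 0" "\<And>k. norm (U k) \<le> M"
    using convergent_imp_bounded[OF U] unfolding bounded_pos by auto
  have sU: "(\<lambda>k. s k *\<^sub>R U k) \<longlonglongrightarrow> 0"
    using tendsto_scaleR[OF s(2) U] by simp
  have "(\<lambda>k. D k - H k) \<longlonglongrightarrow> 0"
  proof (rule LIMSEQ_I)
    fix e :: real assume e: "e > 0"
    define e' where "e' = e / (2 * M\<^sup>2)"
    have e': "e' > 0" using e M by (simp add: e'_def)
    obtain d where d: "d > 0" "\<And>h. norm h \<le> d \<Longrightarrow>
       \<bar>q (y + h) $ i - q y $ i - gradq q i y \<bullet> h - (h \<bullet> (hessq q i y *v h)) / 2\<bar> \<le> e' * (norm h)\<^sup>2"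
      using second_order_taylor[OF q2 e', of y i] by blast
    obtain N where N: "\<And>k. k \<ge> N \<Longrightarrow> norm (s k *\<^sub>R U k - 0) < d"
      using LIMSEQ_D[OF sU d(1)] by blast
    show "\<exists>N. \<forall>k\<ge>N. norm (D k - H k - 0) < e"
    proof (intro exI allI impI)
      fix k assume "k \<ge> N"
      then have "norm (s k *\<^sub>R U k) \<le> d" using N[of k] by simp
      from d(2)[OF this]
      have *: "\<bar>q (y + s k *\<^sub>R U k) $ i - q y $ i - s k * (gradq q i y \<bullet> U k) - (s k)\<^sup>2 * H k\<bar>
          \<le> e' * (norm (s k *\<^sub>R U k))\<^sup>2"
        by (simp add: H_def matrix_vector_mult_scaleR power2_eq_square)
      have "(s k)\<^sup>2 * D k = q (y + s k *\<^sub>R U k) $ i - q y $ i - s k * (gradq q i y \<bullet> U k)"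
        using s(1)[of k] by (simp add: D_def)
      then have eq: "q (y + s k *\<^sub>R U k) $ i - q y $ i - s k * (gradq q i y \<bullet> U k) - (s k)\<^sup>2 * H k
          = (s k)\<^sup>2 * (D k - H k)"
        by (simp add: right_diff_distrib)
      have "(s k)\<^sup>2 * \<bar>D k - H k\<bar> \<le> (s k)\<^sup>2 * (e' * (norm (U k))\<^sup>2)"
        using *[unfolded eq] by (simp add: abs_mult power_mult_distrib mult.left_commute)
      then have "\<bar>D k - H k\<bar> \<le> e' * (norm (U k))\<^sup>2"
        using s(1)[of k] by simp
      also have "\<dots> \<le> e' * M\<^sup>2"
        using M(2)[of k] e' by (intro mult_left_mono power_mono) auto
      also have "\<dots> < e" using M e by (simp add: e'_def)
      finally show "norm (D k - H k - 0) < e" by simp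
    qed
  qed
  moreover have "H \<longlonglongrightarrow> (u \<bullet> (hessq q i y *v u)) / 2"
    unfolding H_def by (intro tendsto_intros tendsto_matrix_vector_mult U) simp
  ultimately have "(\<lambda>k. (D k - H k) + H k) \<longlonglongrightarrow> 0 + (u \<bullet> (hessq q i y *v u)) / 2"
    by (rule tendsto_add)
  then show ?thesis by (simp add: D_def)
qed

lemma gradq_quotient_tendsto:
  assumes "\<And>k. s k > (0::real)" "s \<longlonglongrightarrow> 0" "U \<longlonglongrightarrow> u"
  shows "(\<lambda>k. (1 / s k) *\<^sub>R (gradq q i (y + s k *\<^sub>R U k) - gradq q i y)) \<longlonglongrightarrow> hessq q i y *v u"
  by (rule difference_quotient_tendsto[OF hessq_deriv[OF q2]]) (use assms in auto)

text \<open>If \<open>(a, b)\<close> solves the 2-regularity system with right-hand side \<open>\<alpha>\<close>, then \<open>b + s k a\<close> solves the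
  system below up to \<open>o(s k)\<close>; Brouwer's theorem removes the error.\<close>

lemma two_regular_solve:
  assumes reg: "two_regular q I y u" and s: "\<And>k. s k > (0::real)" "s \<longlonglongrightarrow> 0" and U: "U \<longlonglongrightarrow> u"
  shows "\<exists>C>0. \<forall>\<^sub>F k in sequentially. \<forall>\<alpha>::real^'l. \<exists>p.
     (\<forall>i\<in>I. gradq q i (y + s k *\<^sub>R U k) \<bullet> p = s k * \<alpha> $ i) \<and> norm p \<le> C * norm \<alpha>"
proof -
  obtain a b :: "real^'l \<Rightarrow> real^'m" and C where C: "C > 0"
    and cont: "\<And>S. continuous_on S a" "\<And>S. continuous_on S b"
    and le: "\<And>\<alpha>. norm (a \<alpha>) \<le> C * norm \<alpha>" "\<And>\<alpha>. norm (b \<alpha>) \<le> C * norm \<alpha>"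
    and ab: "\<And>\<alpha> i. i \<in> I \<Longrightarrow> gradq q i y \<bullet> a \<alpha> + u \<bullet> (hessq q i y *v b \<alpha>) = \<alpha> $ i"
      "\<And>\<alpha> i. i \<in> I \<Longrightarrow> gradq q i y \<bullet> b \<alpha> = 0"
    by (rule two_regular_selection[OF reg]) (rule that; assumption)
  define n where "n = real CARD('l)"
  have n: "n \<ge> 1" by (simp add: n_def Suc_leI)
  define D where "D k i = (1 / s k) *\<^sub>R (gradq q i (y + s k *\<^sub>R U k) - gradq q i y)" for k i
  have D: "(\<lambda>k. D k i) \<longlonglongrightarrow> hessq q i y *v u" for i
    unfolding D_def by (rule gradq_quotient_tendsto[OF s U])
  \<comment> \<open>Relative error of the trial solution \<open>b c + s k a c\<close> after division
    by \<open>s k\<close>: first \<open>D k i\<close> in place of its limit, paired with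
    \<open>b\<close>, then the correction of the gradient meeting the correction by
    \<open>a\<close>.\<close>
  define E where "E k i = (norm (D k i - hessq q i y *v u) + s k * norm (D k i)) * C" for k i
  have "\<forall>\<^sub>F k in sequentially. \<forall>i. E k i < 1 / (2 * n)"
  proof (rule eventually_all_finite)
    fix i
    have "(\<lambda>k. E k i) \<longlonglongrightarrow> (norm (hessq q i y *v u - hessq q i y *v u) + 0 * norm (hessq q i y *v u)) * C"
      unfolding E_def by (intro tendsto_intros D s)
    then show "\<forall>\<^sub>F k in sequentially. E k i < 1 / (2 * n)"
      using n by (intro order_tendstoD(2)) auto
  qed
  moreover have "\<forall>\<^sub>F k in sequentially. s k < 1"
    using s(2) by (rule order_tendstoD(2)) simp
  ultimately have ev: "\<forall>\<^sub>F k in sequentially. (\<forall>i. E k i < 1 / (2 * n)) \<and> s k < 1"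
    by (rule eventually_conj)
  have solve: "\<exists>p. (\<forall>i\<in>I. gradq q i (y + s k *\<^sub>R U k) \<bullet> p = s k * \<alpha> $ i) \<and> norm p \<le> 4 * n * C * norm \<alpha>"
    if k: "(\<forall>i. E k i < 1 / (2 * n)) \<and> s k < 1" for k and \<alpha> :: "real^'l"
  proof -
    define p where "p c = b c + s k *\<^sub>R a c" for c
    have np: "norm (p c) \<le> 2 * C * norm c" for c
    proof -
      have "norm (p c) \<le> norm (b c) + norm (s k *\<^sub>R a c)"
        unfolding p_def by (rule norm_triangle_ineq)
      also have "norm (s k *\<^sub>R a c) \<le> norm (a c)"
        using k s(1)[of k] by (simp add: mult_left_le_one_le)
      finally show ?thesis using le[of c] by simp
    qed
    have err: "\<bar>(1 / s k) * (gradq q i (y + s k *\<^sub>R U k) \<bullet> p c) - c $ i\<bar> \<le> E k i * norm c"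
      if i: "i \<in> I" for i c
    proof -
      have g: "gradq q i (y + s k *\<^sub>R U k) = gradq q i y + s k *\<^sub>R D k i"
        using s(1)[of k] by (simp add: D_def)
      have "gradq q i (y + s k *\<^sub>R U k) \<bullet> p c
          = s k * (gradq q i y \<bullet> a c + D k i \<bullet> b c + s k * (D k i \<bullet> a c))"
        unfolding g p_def using ab(2)[OF i, of c]
        by (simp add: inner_add_left inner_add_right algebra_simps)
      then have "(1 / s k) * (gradq q i (y + s k *\<^sub>R U k) \<bullet> p c) - c $ i
          = (D k i - hessq q i y *v u) \<bullet> b c + s k * (D k i \<bullet> a c)"
        using s(1)[of k] ab(1)[OF i, of c] hessq_sym[OF q2, of u i y "b c"]
        by (simp add: inner_diff_left inner_diff_right inner_commute)
      also have "\<bar>\<dots>\<bar> \<le> norm (D k i - hessq q i y *v u) * norm (b c) + s k * (norm (D k i) * norm (a c))"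
      proof -
        have "\<bar>s k * (D k i \<bullet> a c)\<bar> \<le> s k * (norm (D k i) * norm (a c))"
          using s(1)[of k] Cauchy_Schwarz_ineq2[of "D k i" "a c"] by (simp add: abs_mult)
        then show ?thesis
          using Cauchy_Schwarz_ineq2[of "D k i - hessq q i y *v u" "b c"] by linarith
      qed
      also have "\<dots> \<le> norm (D k i - hessq q i y *v u) * (C * norm c) + s k * (norm (D k i) * (C * norm c))"
        using le[of c] s(1)[of k] by (intro add_mono mult_left_mono) auto
      also have "\<dots> = E k i * norm c" by (simp add: E_def algebra_simps)
      finally show ?thesis .
    qed
    \<comment> \<open>On this radius the error is at most \<open>norm \<alpha>\<close> because
      \<open>E k i < 1 / (2 * n)\<close>. With the shift by \<open>\<alpha> $ i\<close> the total is
      at most \<open>2 * norm \<alpha>\<close>, the radius divided by \<open>n\<close>.\<close>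
    have "\<exists>c. norm c \<le> 2 * n * norm \<alpha> \<and>
        (\<forall>i\<in>I. (1 / s k) * (gradq q i (y + s k *\<^sub>R U k) \<bullet> p c) - \<alpha> $ i = 0)"
    proof (rule zero_on_components)
      show "0 \<le> 2 * n * norm \<alpha>" using n by simp
      fix i
      show "continuous_on (cball 0 (2 * n * norm \<alpha>))
          (\<lambda>c. (1 / s k) * (gradq q i (y + s k *\<^sub>R U k) \<bullet> p c) - \<alpha> $ i)"
        unfolding p_def by (intro continuous_intros cont)
      fix c :: "real^'l" assume c: "norm c \<le> 2 * n * norm \<alpha>" and i: "i \<in> I"
      have "E k i * norm c \<le> 1 / (2 * n) * (2 * n * norm \<alpha>)"
        using k c n by (intro mult_mono) (auto intro: less_imp_le)
      also have "\<dots> = norm \<alpha>" using n by simp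
      finally show "\<bar>(1 / s k) * (gradq q i (y + s k *\<^sub>R U k) \<bullet> p c) - \<alpha> $ i - c $ i\<bar>
          \<le> 2 * n * norm \<alpha> / CARD('l)"
        using err[OF i, of c] component_le_norm_cart[of \<alpha> i] n by (simp flip: n_def)
    qed
    then obtain c where c: "norm c \<le> 2 * n * norm \<alpha>"
      "\<And>i. i \<in> I \<Longrightarrow> (1 / s k) * (gradq q i (y + s k *\<^sub>R U k) \<bullet> p c) - \<alpha> $ i = 0" by blast
    have "gradq q i (y + s k *\<^sub>R U k) \<bullet> p c = s k * \<alpha> $ i" if i: "i \<in> I" for i
      using c(2)[OF i] s(1)[of k] by (simp add: field_simps)
    moreover have "norm (p c) \<le> 4 * n * C * norm \<alpha>"
    proof -
      have "2 * C * norm c \<le> 2 * C * (2 * n * norm \<alpha>)" using c(1) C by (intro mult_left_mono) auto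
      then show ?thesis using np[of c] by (simp add: mult_ac)
    qed
    ultimately show ?thesis by blast
  qed
  show ?thesis
    by (rule exI[of _ "4 * n * C"], intro conjI eventually_mono[OF ev] allI solve) (use C n in auto)
qed

text \<open>Dividing \<alpha> by \<open>s k\<close> gives up the uniform bound, but independence of
  the gradients at a single point asks only for solvability.\<close>

lemma two_regular_eventually_surj:
  assumes reg: "two_regular q I y u" and s: "\<And>k. s k > (0::real)" "s \<longlonglongrightarrow> 0" and U: "U \<longlonglongrightarrow> u"
  shows "\<forall>\<^sub>F k in sequentially. \<forall>\<alpha>::real^'l. \<exists>p. \<forall>i\<in>I. gradq q i (y + s k *\<^sub>R U k) \<bullet> p = \<alpha> $ i"
proof -
  obtain C where "\<forall>\<^sub>F k in sequentially. \<forall>\<alpha>::real^'l. \<exists>p.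
     (\<forall>i\<in>I. gradq q i (y + s k *\<^sub>R U k) \<bullet> p = s k * \<alpha> $ i) \<and> norm p \<le> C * norm \<alpha>"
    using two_regular_solve[OF assms] by blast
  then show ?thesis
  proof (rule eventually_mono, intro allI, goal_cases)
    case (1 k \<alpha>)
    from spec[OF 1(1), of "(1 / s k) *\<^sub>R \<alpha>"] show ?case using s(1)[of k] by auto
  qed
qed

text \<open>Dividing the constraints on \<open>w k\<close> by \<open>s k\<close> splits them into
  \<open>gradq q i y\<close> paired with \<open>w k / s k\<close> and a part converging to the
  Hessian term. So \<open>w k / s k\<close> plays the part of \<open>z\<close>; it may be unbounded,
  and \<open>solvable_limit\<close> supplies the limit.\<close>

lemma KI_limit:
  assumes IpI: "Ip \<subseteq> I" and s: "\<And>k. s k > (0::real)" "s \<longlonglongrightarrow> 0" and U: "U \<longlonglongrightarrow> u" and w: "w \<longlonglongrightarrow> w0"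
    and mem: "\<forall>\<^sub>F k in sequentially. w k \<in> KI q (y + s k *\<^sub>R U k) Ip I"
  shows "w0 \<in> KI_dir q y Ip I u"
proof -
  define X where "X k = y + s k *\<^sub>R U k" for k
  have X: "X \<longlonglongrightarrow> y" unfolding X_def by (rule direction_tendsto[OF s(2) U])
  have lim: "(\<lambda>k. gradq q i (X k) \<bullet> w k) \<longlonglongrightarrow> gradq q i y \<bullet> w0" for i
    by (intro tendsto_inner tendsto_gradq[OF q2] X w)
  have "gradq q i y \<bullet> w0 = 0" if i: "i \<in> Ip" for i
  proof -
    have "\<forall>\<^sub>F k in sequentially. gradq q i (X k) \<bullet> w k = 0"
      using mem by (rule eventually_mono) (use i in \<open>auto simp: KI_def X_def\<close>)
    from LIMSEQ_unique[OF lim tendsto_eventually[OF this]] show ?thesis .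
  qed
  moreover have "gradq q i y \<bullet> w0 \<le> 0" if i: "i \<in> I - Ip" for i
  proof -
    have "\<forall>\<^sub>F k in sequentially. gradq q i (X k) \<bullet> w k \<le> 0"
      using mem by (rule eventually_mono) (use i in \<open>auto simp: KI_def X_def\<close>)
    from tendsto_upperbound[OF lim this] show ?thesis by simp
  qed
  ultimately have "w0 \<in> KI q y Ip I" by (auto simp: KI_def)
  moreover have "\<exists>z. (\<forall>i\<in>Ip. gradq q i y \<bullet> z + u \<bullet> (hessq q i y *v w0) = 0)
      \<and> (\<forall>i\<in>I - Ip. gradq q i y \<bullet> z + u \<bullet> (hessq q i y *v w0) \<le> 0)"
  proof -
    obtain N where N: "\<And>k. k \<ge> N \<Longrightarrow> w k \<in> KI q (X k) Ip I"
      using mem unfolding eventually_sequentially X_def by blast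
    define D where "D k i = (1 / s k) *\<^sub>R (gradq q i (X k) - gradq q i y)" for k i
    have D: "(\<lambda>k. D k i) \<longlonglongrightarrow> hessq q i y *v u" for i
      unfolding D_def X_def by (rule gradq_quotient_tendsto[OF s U])
    have split: "gradq q i y \<bullet> ((1 / s k) *\<^sub>R w k) + D k i \<bullet> w k = (1 / s k) * (gradq q i (X k) \<bullet> w k)" for k i
      by (simp add: D_def inner_diff_left right_diff_distrib diff_divide_distrib)
    show ?thesis
    proof (rule solvable_limit)
      show "Ip \<inter> (I - Ip) = {}" by auto
      fix i assume "i \<in> Ip \<union> (I - Ip)"
      have "(\<lambda>k. D k i \<bullet> w k) \<longlonglongrightarrow> u \<bullet> (hessq q i y *v w0)"
        using tendsto_inner[OF D w, of i] hessq_sym[OF q2, of u i y w0] by (simp add: inner_commute)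
      then show "(\<lambda>k. D (k + N) i \<bullet> w (k + N)) \<longlonglongrightarrow> u \<bullet> (hessq q i y *v w0)"
        by (rule LIMSEQ_ignore_initial_segment)
    next
      fix k i assume "i \<in> Ip"
      then show "gradq q i y \<bullet> ((1 / s (k + N)) *\<^sub>R w (k + N)) + D (k + N) i \<bullet> w (k + N) = 0"
        unfolding split using N[of "k + N"] by (simp add: KI_def)
    next
      fix k i assume "i \<in> I - Ip"
      then show "gradq q i y \<bullet> ((1 / s (k + N)) *\<^sub>R w (k + N)) + D (k + N) i \<bullet> w (k + N) \<le> 0"
        unfolding split using N[of "k + N"] s(1)[of "k + N"] by (simp add: KI_def divide_nonpos_pos)
    qed
  qed
  ultimately show ?thesis unfolding KI_dir_def by blast
qed

text \<open>The trial vector \<open>w0 + s k z\<close> meets the constraints at the moved point up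
  to \<open>o(s k)\<close>. Since \<open>two_regular_solve\<close> handles right-hand sides of order
  \<open>s k\<close> with bounded solutions, such a residual is removed by a correction tending to
  \<open>0\<close>.\<close>

lemma KI_dir_approx:
  assumes reg: "two_regular q I y u"
    and IpI: "Ip \<subseteq> I" and s: "\<And>k. s k > (0::real)" "s \<longlonglongrightarrow> 0" and U: "U \<longlonglongrightarrow> u"
    and w0: "w0 \<in> KI_dir q y Ip I u"
  shows "\<exists>w. w \<longlonglongrightarrow> w0 \<and> (\<forall>\<^sub>F k in sequentially. w k \<in> KI q (y + s k *\<^sub>R U k) Ip I)"
proof -
  define X where "X k = y + s k *\<^sub>R U k" for k
  obtain z where z: "\<And>i. i \<in> Ip \<Longrightarrow> gradq q i y \<bullet> z + u \<bullet> (hessq q i y *v w0) = 0"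
      "\<And>i. i \<in> I - Ip \<Longrightarrow> gradq q i y \<bullet> z + u \<bullet> (hessq q i y *v w0) \<le> 0"
    and wK: "w0 \<in> KI q y Ip I"
    using w0 unfolding KI_dir_def by blast
  obtain C where C: "C > 0" "\<forall>\<^sub>F k in sequentially. \<forall>\<alpha>::real^'l. \<exists>p.
     (\<forall>i\<in>I. gradq q i (X k) \<bullet> p = s k * \<alpha> $ i) \<and> norm p \<le> C * norm \<alpha>"
    using two_regular_solve[OF reg s U] unfolding X_def by blast
  define D where "D k i = (1 / s k) *\<^sub>R (gradq q i (X k) - gradq q i y)" for k i
  have D: "(\<lambda>k. D k i) \<longlonglongrightarrow> hessq q i y *v u" for i
    unfolding D_def X_def by (rule gradq_quotient_tendsto[OF s U])
  \<comment> \<open>Minus the residual of the trial vector divided by \<open>s k\<close>; both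
    summands tend to \<open>0\<close>.\<close>
  define \<alpha> :: "nat \<Rightarrow> real^'l" where
    "\<alpha> k = (\<chi> i. - ((D k i - hessq q i y *v u) \<bullet> w0 + s k * (D k i \<bullet> z)))" for k
  have "(\<lambda>k. \<alpha> k $ i) \<longlonglongrightarrow> 0" for i
  proof -
    have "(\<lambda>k. - ((D k i - hessq q i y *v u) \<bullet> w0 + s k * (D k i \<bullet> z)))
       \<longlonglongrightarrow> - ((hessq q i y *v u - hessq q i y *v u) \<bullet> w0 + 0 * ((hessq q i y *v u) \<bullet> z))"
      by (intro tendsto_intros D s)
    then show ?thesis by (simp add: \<alpha>_def)
  qed
  then have \<alpha>: "\<alpha> \<longlonglongrightarrow> 0" by (intro vec_tendstoI) simp
  define Q where "Q k p \<longleftrightarrow> (\<forall>i\<in>I. gradq q i (X k) \<bullet> p = s k * \<alpha> k $ i) \<and> norm p \<le> C * norm (\<alpha> k)" for k p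
  have "\<forall>\<^sub>F k in sequentially. \<exists>p. Q k p"
    using C(2) unfolding Q_def by (rule eventually_mono) auto
  moreover define p where "p k = (SOME p. Q k p)" for k
  ultimately have Qp: "\<forall>\<^sub>F k in sequentially. Q k (p k)"
    by (auto elim!: eventually_mono intro: someI_ex)
  have "p \<longlonglongrightarrow> 0"
  proof (rule Lim_null_comparison)
    show "\<forall>\<^sub>F k in sequentially. norm (p k) \<le> C * norm (\<alpha> k)"
      using Qp by (rule eventually_mono) (simp add: Q_def)
    show "(\<lambda>k. C * norm (\<alpha> k)) \<longlonglongrightarrow> 0"
      using tendsto_mult[OF tendsto_const tendsto_norm[OF \<alpha>], of C] by simp
  qed
  then have "(\<lambda>k. w0 + s k *\<^sub>R z + p k) \<longlonglongrightarrow> w0 + 0 *\<^sub>R z + 0"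
    by (intro tendsto_intros s)
  then have "(\<lambda>k. w0 + s k *\<^sub>R z + p k) \<longlonglongrightarrow> w0" by simp
  moreover have "\<forall>\<^sub>F k in sequentially. w0 + s k *\<^sub>R z + p k \<in> KI q (X k) Ip I"
    using Qp
  proof (rule eventually_mono)
    fix k assume Q: "Q k (p k)"
    have "gradq q i (X k) \<bullet> (w0 + s k *\<^sub>R z + p k)
        = gradq q i y \<bullet> w0 + s k * (gradq q i y \<bullet> z + u \<bullet> (hessq q i y *v w0))" if i: "i \<in> I" for i
    proof -
      have g: "gradq q i (X k) = gradq q i y + s k *\<^sub>R D k i"
        using s(1)[of k] by (simp add: D_def)
      have "gradq q i (X k) \<bullet> (w0 + s k *\<^sub>R z + p k) = gradq q i (X k) \<bullet> (w0 + s k *\<^sub>R z) + s k * \<alpha> k $ i"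
        using Q i by (simp add: Q_def inner_add_right)
      also have "\<dots> = gradq q i y \<bullet> w0 + s k * (gradq q i y \<bullet> z + (hessq q i y *v u) \<bullet> w0)"
        unfolding g \<alpha>_def by (simp add: inner_add_left inner_add_right inner_diff_left algebra_simps)
      finally show ?thesis using hessq_sym[OF q2, of u i y w0] by (simp add: inner_commute)
    qed
    moreover have "s k * (gradq q i y \<bullet> z + u \<bullet> (hessq q i y *v w0)) \<le> 0" if "i \<in> I - Ip" for i
      using z(2)[OF that] s(1)[of k] by (intro mult_nonneg_nonpos) auto
    ultimately show "w0 + s k *\<^sub>R z + p k \<in> KI q (X k) Ip I"
      using wK z(1) IpI unfolding KI_def
      by (auto simp: subset_iff simp del: mult_le_0_iff intro!: add_nonpos_nonpos)
  qed
  ultimately show ?thesis unfolding X_def by blast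
qed

text \<open>The outer limit \<open>KI_limit\<close> is enough. Let \<open>p k\<close> be the
  projection of \<xi> onto the k-th cone: a cluster point \<open>p0\<close> lies in
  \<open>KI_dir\<close>, and its squared norm is \<open>\<xi> \<bullet> p0 \<le> 0\<close>. Hence
  \<open>p k\<close> tends to \<open>0\<close>, and \<open>\<xi> - p k\<close> is the
  approximation.\<close>

lemma polar_KI_dir_approx:
  assumes IpI: "Ip \<subseteq> I" and s: "\<And>k. s k > (0::real)" "s \<longlonglongrightarrow> 0" and U: "U \<longlonglongrightarrow> u"
    and \<xi>: "\<xi> \<in> neg_polar (KI_dir q y Ip I u)"
  shows "\<exists>\<Xi>. \<Xi> \<longlonglongrightarrow> \<xi> \<and> (\<forall>k. \<Xi> k \<in> neg_polar (KI q (y + s k *\<^sub>R U k) Ip I))"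
proof -
  define K where "K k = KI q (y + s k *\<^sub>R U k) Ip I" for k
  have "\<exists>p. p \<in> K k \<and> (\<forall>x\<in>K k. (\<xi> - p) \<bullet> x \<le> 0) \<and> (\<xi> - p) \<bullet> p = 0" for k
    using moreau[OF KI_closed_cone, where \<xi> = \<xi>] unfolding K_def by blast
  then obtain p where p: "\<And>k. p k \<in> K k" "\<And>k x. x \<in> K k \<Longrightarrow> (\<xi> - p k) \<bullet> x \<le> 0" "\<And>k. (\<xi> - p k) \<bullet> p k = 0"
    by metis
  have pp: "\<xi> \<bullet> p k = (norm (p k))\<^sup>2" for k
    using p(3)[of k] by (simp add: inner_diff_left power2_norm_eq_inner)
  have bound: "norm (p k) \<le> norm \<xi>" for k
  proof (cases "p k = 0")
    case False
    have "norm (p k) * norm (p k) \<le> norm \<xi> * norm (p k)"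
      using pp[of k] norm_cauchy_schwarz[of \<xi> "p k"] by (simp add: power2_eq_square)
    then show ?thesis using False by simp
  qed simp
  have "p \<longlonglongrightarrow> 0"
  proof (rule ccontr)
    assume "\<not> p \<longlonglongrightarrow> 0"
    then obtain e where e: "e > 0" "\<not> (\<forall>\<^sub>F k in sequentially. dist (p k) 0 < e)"
      unfolding tendsto_iff by blast
    obtain r where r: "strict_mono (r::nat\<Rightarrow>nat)" "\<And>k. \<not> dist (p (r k)) 0 < e"
      using not_eventually_sequentiallyD[OF e(2)] by blast
    have "bounded (range (p \<circ> r))"
      unfolding bounded_iff using bound by auto
    then obtain p0 r' where r': "strict_mono (r'::nat\<Rightarrow>nat)" and lim: "((p \<circ> r) \<circ> r') \<longlonglongrightarrow> p0"
      using bounded_imp_convergent_subsequence[of "p \<circ> r"] by blast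
    define \<rho> where "\<rho> = r \<circ> r'"
    have \<rho>: "strict_mono \<rho>" using r(1) r' by (simp add: \<rho>_def strict_mono_o)
    have lim: "(\<lambda>k. p (\<rho> k)) \<longlonglongrightarrow> p0" using lim by (simp add: \<rho>_def o_def)
    have "p0 \<in> KI_dir q y Ip I u"
    proof (rule KI_limit[OF IpI _ _ _ lim])
      show "(\<lambda>k. s (\<rho> k)) \<longlonglongrightarrow> 0" "(\<lambda>k. U (\<rho> k)) \<longlonglongrightarrow> u"
        using LIMSEQ_subseq_LIMSEQ[OF s(2) \<rho>] LIMSEQ_subseq_LIMSEQ[OF U \<rho>] by (simp_all add: o_def)
      show "\<forall>\<^sub>F k in sequentially. p (\<rho> k) \<in> KI q (y + s (\<rho> k) *\<^sub>R U (\<rho> k)) Ip I"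
        using p(1) unfolding K_def by (intro always_eventually allI)
    qed (use s in auto)
    then have le: "\<xi> \<bullet> p0 \<le> 0" using \<xi> by (simp add: neg_polar_def)
    have "(\<lambda>k. \<xi> \<bullet> p (\<rho> k)) \<longlonglongrightarrow> \<xi> \<bullet> p0" by (intro tendsto_intros lim)
    moreover have "(\<lambda>k. \<xi> \<bullet> p (\<rho> k)) \<longlonglongrightarrow> (norm p0)\<^sup>2" unfolding pp by (intro tendsto_intros lim)
    ultimately have "(norm p0)\<^sup>2 \<le> 0" using LIMSEQ_unique le by fastforce
    then have p0: "p0 = 0" by simp
    have "e \<le> norm (p (\<rho> k))" for k using r(2)[of "r' k"] by (simp add: \<rho>_def)
    then have "e \<le> norm p0" using LIMSEQ_le_const[OF tendsto_norm[OF lim]] by blast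
    then show False using p0 e(1) by simp
  qed
  then have "(\<lambda>k. \<xi> - p k) \<longlonglongrightarrow> \<xi> - 0" by (intro tendsto_intros)
  moreover have "\<xi> - p k \<in> neg_polar (K k)" for k
    using p(2) by (simp add: neg_polar_def)
  ultimately show ?thesis unfolding K_def by (intro exI[of _ "\<lambda>k. \<xi> - p k"]) simp
qed

end

lemma Lam_iff:
  assumes "twice_cont_diff q"
  shows "lam \<in> Lam q y ys \<longleftrightarrow> lam \<in> normal_orthant q y \<and> gradsum q y lam = ys"
  unfolding Lam_def transpose_jacobian[OF assms] by simp

section \<open>Limits of multipliers and normals\<close>

text \<open>The points move with speed \<open>s\<close> and the normals with speed \<open>t\<close>: \<open>\<beta> = 1\<close> (with \<open>s = t\<close>) is the case
  of a direction \<open>(u, vs)\<close> with \<open>u \<noteq> 0\<close>, and \<open>\<beta> = 0\<close> that of a direction \<open>(0, vs)\<close>.\<close>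

context
  fixes q :: "real^'m \<Rightarrow> real^'l" and y ys u vs :: "real^'m" and lam :: "real^'l"
    and s t :: "nat \<Rightarrow> real" and \<beta> :: real and U W :: "nat \<Rightarrow> real^'m"
    and L :: "nat \<Rightarrow> real^'l" and I Ip :: "'l set"
  assumes q2: "twice_cont_diff q" and y: "y \<in> Gam q"
    and s: "\<And>k. s k > 0" "s \<longlonglongrightarrow> 0" and U: "U \<longlonglongrightarrow> u"
    and t: "\<And>k. t k > 0" "t \<longlonglongrightarrow> 0" and st: "(\<lambda>k. s k / t k) \<longlonglongrightarrow> \<beta>" and W: "W \<longlonglongrightarrow> vs"
    and feas: "\<And>k. y + s k *\<^sub>R U k \<in> Gam q" and act: "\<And>k. active q (y + s k *\<^sub>R U k) = I"
    and Lorth: "\<And>k. L k \<in> normal_orthant q (y + s k *\<^sub>R U k)"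
    and Leq: "\<And>k. ys + t k *\<^sub>R W k = gradsum q (y + s k *\<^sub>R U k) (L k)"
    and Lpos: "\<And>k. {i. L k $ i > 0} = Ip" and Llim: "L \<longlonglongrightarrow> lam"
begin

abbreviation X :: "nat \<Rightarrow> real^'m" where
  "X k \<equiv> y + s k *\<^sub>R U k"

lemma X_lim: "X \<longlonglongrightarrow> y"
  by (rule direction_tendsto[OF s(2) U])

lemma Ip_subset: "Ip \<subseteq> I"
  using Lorth[of 0] Lpos[of 0] act[of 0] by (auto simp: normal_orthant_def)

lemma q_zero: "i \<in> I \<Longrightarrow> q (X k) $ i = 0"
  using act[of k] by (auto simp: active_def)

lemma L_supp: "i \<notin> Ip \<Longrightarrow> L k $ i = 0"
  using Lorth[of k] Lpos[of k] by (auto simp: normal_orthant_def less_le)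

lemma lam_supp: "i \<notin> Ip \<Longrightarrow> lam $ i = 0"
  using tendsto_vec_nth[OF Llim, of i] L_supp[of i] by (simp add: LIMSEQ_const_iff)

lemma lam_nonneg: "0 \<le> lam $ i"
  using LIMSEQ_le_const[OF tendsto_vec_nth[OF Llim, of i], of 0] Lorth
  by (auto simp: normal_orthant_def)

lemma I_subset_active: "I \<subseteq> active q y"
proof
  fix i assume i: "i \<in> I"
  have "(\<lambda>k. q (X k) $ i) \<longlonglongrightarrow> q y $ i"
    by (rule continuous_on_tendsto_compose[OF comp_continuous[OF q2] X_lim]) auto
  then show "i \<in> active q y"
    using q_zero[OF i] by (simp add: LIMSEQ_const_iff active_def)
qed

lemma lam_orthant: "lam \<in> normal_orthant q y"
  using lam_nonneg lam_supp Ip_subset I_subset_active by (auto simp: normal_orthant_def)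

lemma ys_eq: "ys = gradsum q y lam"
proof -
  have "(\<lambda>k. ys + t k *\<^sub>R W k) \<longlonglongrightarrow> ys" by (rule direction_tendsto[OF t(2) W])
  moreover have "(\<lambda>k. ys + t k *\<^sub>R W k) \<longlonglongrightarrow> gradsum q y lam"
    unfolding Leq by (rule tendsto_gradsum[OF q2 X_lim Llim])
  ultimately show ?thesis by (rule LIMSEQ_unique)
qed

lemma lam_Lam: "lam \<in> Lam q y ys"
  using lam_orthant ys_eq by (simp add: Lam_iff[OF q2])

lemma u_tangent: "i \<in> I \<Longrightarrow> gradq q i y \<bullet> u = 0"
proof -
  assume i: "i \<in> I"
  have "(\<lambda>k. (1 / s k) *\<^sub>R (q (X k) $ i - q y $ i)) \<longlonglongrightarrow> gradq q i y \<bullet> u"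
    by (rule difference_quotient_tendsto[OF gradq_deriv[OF q2] s U])
  then show ?thesis
    using q_zero[OF i] I_subset_active i by (auto simp: LIMSEQ_const_iff active_def)
qed

lemma u_contingent: "u \<in> contingent_cone (Gam q) y"
  unfolding contingent_cone_def using s U feas by blast

lemma u_critK: "u \<in> critK q y ys"
proof -
  have "lam $ i * (gradq q i y \<bullet> u) = 0" for i
    using lam_supp[of i] u_tangent[of i] Ip_subset by auto
  then have "ys \<bullet> u = 0" unfolding ys_eq inner_sum_left inner_scaleR_left by (intro sum.neutral) blast
  then show ?thesis using u_contingent by (simp add: critK_def)
qed

definition Dq :: "nat \<Rightarrow> 'l \<Rightarrow> real" where
  "Dq k i = (q (X k) $ i - q y $ i - s k * (gradq q i y \<bullet> U k)) / (s k)\<^sup>2"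

lemma Dq_lim: "(\<lambda>k. Dq k i) \<longlonglongrightarrow> (u \<bullet> (hessq q i y *v u)) / 2"
  unfolding Dq_def by (rule second_difference_quotient_tendsto[OF q2 s U])

lemma Dq_mult: "(s k)\<^sup>2 * Dq k i = q (X k) $ i - q y $ i - s k * (gradq q i y \<bullet> U k)"
  using s(1)[of k] by (simp add: Dq_def)

text \<open>The points \<open>X k\<close> are complementary to \<open>lam\<close> and feasible for every other multiplier,
  so comparing the second-order expansions of the two Lagrangians gives maximality.\<close>

lemma lam_maximal: "lam \<in> Lam_dir q y ys u"
  unfolding Lam_dir_def
proof (intro CollectI conjI ballI lam_Lam)
  fix lam' assume lam': "lam' \<in> Lam q y ys"
  have orth': "lam' \<in> normal_orthant q y" and eq': "gradsum q y lam' = ys"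
    using lam' by (simp_all add: Lam_iff[OF q2])
  have lim: "(\<lambda>k. \<Sum>i\<in>UNIV. (lam' $ i - lam $ i) * Dq k i)
      \<longlonglongrightarrow> (\<Sum>i\<in>UNIV. (lam' $ i - lam $ i) * ((u \<bullet> (hessq q i y *v u)) / 2))"
    by (intro tendsto_intros Dq_lim)
  have "(\<Sum>i\<in>UNIV. (lam' $ i - lam $ i) * Dq k i) \<le> 0" for k
  proof -
    have summand: "(s k)\<^sup>2 * ((lam' $ i - lam $ i) * Dq k i)
        = lam' $ i * q (X k) $ i - s k * ((lam' $ i - lam $ i) * (gradq q i y \<bullet> U k))" for i
    proof -
      have 1: "lam $ i * q (X k) $ i = 0"
        using lam_supp[of i] q_zero[of i k] Ip_subset by auto
      have 2: "(lam' $ i - lam $ i) * q y $ i = 0"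
        using orth' lam_orthant by (cases "i \<in> active q y") (auto simp: normal_orthant_def active_def)
      have "(s k)\<^sup>2 * ((lam' $ i - lam $ i) * Dq k i) = (lam' $ i - lam $ i) * ((s k)\<^sup>2 * Dq k i)"
        by simp
      also have "\<dots> = lam' $ i * q (X k) $ i - lam $ i * q (X k) $ i - (lam' $ i - lam $ i) * q y $ i
          - s k * ((lam' $ i - lam $ i) * (gradq q i y \<bullet> U k))"
        unfolding Dq_mult by (simp add: algebra_simps)
      finally show ?thesis using 1 2 by simp
    qed
    \<comment> \<open>Both multipliers represent the same \<open>ys\<close>, so the first-order
      terms cancel exactly for every \<open>U k\<close> and not merely in the limit; this allows
      division by \<open>(s k)\<^sup>2\<close>.\<close>
    have zero: "(\<Sum>i\<in>UNIV. (lam' $ i - lam $ i) * (gradq q i y \<bullet> U k)) = 0"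
    proof -
      have "(\<Sum>i\<in>UNIV. (lam' $ i - lam $ i) * (gradq q i y \<bullet> U k)) = (gradsum q y lam' - gradsum q y lam) \<bullet> U k"
        by (simp add: inner_diff_left inner_sum_left left_diff_distrib sum_subtractf)
      then show ?thesis using eq' ys_eq by simp
    qed
    have "(s k)\<^sup>2 * (\<Sum>i\<in>UNIV. (lam' $ i - lam $ i) * Dq k i) = (\<Sum>i\<in>UNIV. lam' $ i * q (X k) $ i)"
      unfolding sum_distrib_left summand sum_subtractf
      using zero by (simp flip: sum_distrib_left)
    also have "\<dots> \<le> 0"
      using orth' feas[of k] by (intro sum_nonpos) (auto simp: normal_orthant_def Gam_def mult_nonneg_nonpos)
    finally show ?thesis using s(1)[of k] by (simp add: mult_le_0_iff)
  qed
  then have "(\<Sum>i\<in>UNIV. (lam' $ i - lam $ i) * ((u \<bullet> (hessq q i y *v u)) / 2)) \<le> 0"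
    using LIMSEQ_le_const2[OF lim] by blast
  then have "(\<Sum>i\<in>UNIV. (lam' $ i - lam $ i) * (u \<bullet> (hessq q i y *v u))) \<le> 0"
    by (simp flip: sum_divide_distrib)
  then show "u \<bullet> (hessL q lam' y *v u) \<le> u \<bullet> (hessL q lam y *v u)"
    by (simp add: hessL_mult[OF q2] inner_sum_right left_diff_distrib sum_subtractf)
qed

text \<open>The candidate for \<open>z\<close> is \<open>(2 / s k) U k\<close>: with
  \<open>2 * Dq k i\<close> for the Hessian term, the expression for an active constraint is
  \<open>2 * q (X k) $ i / (s k)\<^sup>2\<close>, zero on \<open>I\<close> and nonpositive
  elsewhere. The candidates diverge when \<open>u \<noteq> 0\<close>, so the limit is taken by
  \<open>solvable_limit\<close>.\<close>

lemma ex_Jbar: "\<exists>J\<in>Jbar q y u. I \<subseteq> J"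
proof -
  have "\<exists>z. (\<forall>i\<in>I. gradq q i y \<bullet> z + u \<bullet> (hessq q i y *v u) = 0)
      \<and> (\<forall>i\<in>active q y - I. gradq q i y \<bullet> z + u \<bullet> (hessq q i y *v u) \<le> 0)"
  proof (rule solvable_limit)
    show "I \<inter> (active q y - I) = {}" by auto
    show "(\<lambda>k. 2 * Dq k i) \<longlonglongrightarrow> u \<bullet> (hessq q i y *v u)" for i
      using tendsto_mult[OF tendsto_const Dq_lim, of 2 i] by simp
    have eq: "gradq q i y \<bullet> ((2 / s k) *\<^sub>R U k) + 2 * Dq k i = 2 * q (X k) $ i / (s k)\<^sup>2"
      if "i \<in> active q y" for i k
      using that s(1)[of k] by (simp add: Dq_def active_def field_simps power2_eq_square)
    show "gradq q i y \<bullet> ((2 / s k) *\<^sub>R U k) + 2 * Dq k i = 0" if "i \<in> I" for i k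
      using eq[of i k] that I_subset_active q_zero[of i k] by auto
    show "gradq q i y \<bullet> ((2 / s k) *\<^sub>R U k) + 2 * Dq k i \<le> 0" if "i \<in> active q y - I" for i k
      using eq[of i k] that feas[of k] by (auto simp: Gam_def intro!: divide_nonpos_nonneg)
  qed
  then obtain z where z: "\<And>i. i \<in> I \<Longrightarrow> gradq q i y \<bullet> z + u \<bullet> (hessq q i y *v u) = 0"
      "\<And>i. i \<in> active q y - I \<Longrightarrow> gradq q i y \<bullet> z + u \<bullet> (hessq q i y *v u) \<le> 0"
    by auto
  have "z \<in> Xi q y u" unfolding Xi_def
  proof (intro CollectI ballI)
    fix i assume "i \<in> active q y"
    then show "gradq q i y \<bullet> z + u \<bullet> (hessq q i y *v u) \<le> 0"
      using z(1)[of i] z(2)[of i] by (cases "i \<in> I") auto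
  qed
  moreover have "I \<subseteq> Jz q y u z"
    using z(1) u_tangent I_subset_active by (auto simp: Jz_def active_dir_def)
  ultimately show ?thesis unfolding Jbar_def by blast
qed

text \<open>\<open>mu\<close> replaces a limit of \<open>(L k - lam) / t k\<close>, which may be
  unbounded. The images of these quotients under \<open>f\<close> do converge, and the image of the
  cone \<open>C\<close> of admissible sign patterns is closed.\<close>

lemma ex_mu:
  "\<exists>mu. mu \<in> contingent_cone (normal_orthant q y) lam \<and> vs = \<beta> *\<^sub>R (hessL q lam y *v u) + gradsum q y mu
     \<and> Iplus lam mu \<subseteq> Ip"
proof -
  define f :: "real^'l \<Rightarrow> real^'m" where "f = (\<lambda>c. gradsum q y c)"
  have lin: "linear f"
    unfolding f_def by (auto intro!: linearI simp: scaleR_left_distrib sum.distrib scaleR_sum_right)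
  \<comment> \<open>Quotients of \<open>L k - lam\<close> vanish off \<open>Ip\<close>, are
    nonnegative where \<open>lam\<close> vanishes and have no prescribed sign elsewhere. Vanishing
    off \<open>Ip\<close> gives \<open>Iplus lam mu \<subseteq> Ip\<close> below.\<close>
  define C where "C = mixed_orthant {i \<in> Ip. lam $ i = 0} (- Ip)"
  define D where "D k i = (1 / s k) *\<^sub>R (gradq q i (X k) - gradq q i y)" for k i
  have D: "(\<lambda>k. D k i) \<longlonglongrightarrow> hessq q i y *v u" for i
    unfolding D_def by (rule gradq_quotient_tendsto[OF q2 s U])
  define E where "E k = W k - (s k / t k) *\<^sub>R (\<Sum>i\<in>UNIV. L k $ i *\<^sub>R D k i)" for k
  have E: "E \<longlonglongrightarrow> vs - \<beta> *\<^sub>R (hessL q lam y *v u)"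
    unfolding E_def hessL_mult[OF q2] by (intro tendsto_intros W st D Llim)
  have "E k \<in> f ` C" for k
  proof (rule image_eqI)
    show "(1 / t k) *\<^sub>R (L k - lam) \<in> C"
      using L_supp lam_supp Lorth[of k] t(1)[of k]
      by (auto simp: C_def mixed_orthant_def normal_orthant_def)
    have "t k *\<^sub>R E k = t k *\<^sub>R W k - (gradsum q (X k) (L k) - gradsum q y (L k))"
      using s(1)[of k] t(1)[of k]
      by (simp add: E_def D_def scaleR_diff_right scaleR_sum_right sum_subtractf mult.commute)
    also have "\<dots> = f (L k) - f lam"
      using Leq[of k] ys_eq by (simp add: f_def algebra_simps)
    also have "\<dots> = f (L k - lam)" by (simp add: linear_diff[OF lin])
    finally have "(1 / t k) *\<^sub>R (t k *\<^sub>R E k) = (1 / t k) *\<^sub>R f (L k - lam)" by simp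
    then show "E k = f ((1 / t k) *\<^sub>R (L k - lam))"
      using t(1)[of k] by (simp add: linear_cmul[OF lin])
  qed
  moreover have "closed (f ` C)" unfolding C_def by (rule closed_linear_image_mixed_orthant[OF lin])
  ultimately have "vs - \<beta> *\<^sub>R (hessL q lam y *v u) \<in> f ` C"
    using closed_sequentially[OF _ _ E] by blast
  then obtain mu where mu: "mu \<in> C" and eq: "vs - \<beta> *\<^sub>R (hessL q lam y *v u) = f mu" by blast
  have "mu \<in> contingent_cone (normal_orthant q y) lam"
  proof (rule normal_orthant_contingentI[OF lam_orthant])
    fix i
    show "0 \<le> mu $ i" if "lam $ i = 0" using mu that by (cases "i \<in> Ip") (auto simp: C_def mixed_orthant_def)
    show "mu $ i = 0" if "i \<notin> active q y"
      using mu that Ip_subset I_subset_active by (auto simp: C_def mixed_orthant_def)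
  qed
  moreover have "vs = \<beta> *\<^sub>R (hessL q lam y *v u) + gradsum q y mu"
    using eq by (simp add: f_def algebra_simps)
  moreover have "Iplus lam mu \<subseteq> Ip"
  proof
    fix i assume i: "i \<in> Iplus lam mu"
    show "i \<in> Ip"
    proof (rule ccontr)
      assume "i \<notin> Ip"
      then have "lam $ i = 0" "mu $ i = 0" using lam_supp mu by (auto simp: C_def mixed_orthant_def)
      with i show False by (simp add: Iplus_def)
    qed
  qed
  ultimately show ?thesis by blast
qed

text \<open>The outer limit of the critical cones handles \<open>w\<close>; their inner limit
  provides test vectors \<open>P k\<close> for every \<open>p\<close>, so that polarity at the
  points \<open>X k\<close> passes to the limit.\<close>

lemma Qset_limit:
  assumes reg: "two_regular q I y u"
    and Z: "\<And>k. Z k \<in> regular_normal_cone (normal_graph q) (X k, ys + t k *\<^sub>R W k)"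
    and Zlim: "Z \<longlonglongrightarrow> (ws, w)"
  shows "(ws, w) \<in> Qset q y u lam Ip I"
proof -
  define A where "A k = fst (Z k)" for k
  define B where "B k = snd (Z k)" for k
  have A: "A \<longlonglongrightarrow> ws" and B: "B \<longlonglongrightarrow> w"
    using tendsto_fst[OF Zlim] tendsto_snd[OF Zlim] by (simp_all add: A_def[abs_def] B_def[abs_def])
  have ev: "\<forall>\<^sub>F k in sequentially. B k \<in> KI q (X k) Ip I \<and>
      A k + hessL q (L k) (X k) *v B k \<in> neg_polar (KI q (X k) Ip I)"
    using two_regular_eventually_surj[OF q2 reg s U]
  proof (rule eventually_mono)
    fix k assume surj: "\<forall>\<alpha>::real^'l. \<exists>p. \<forall>i\<in>I. gradq q i (X k) \<bullet> p = \<alpha> $ i"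
    have "(A k, B k) \<in> regular_normal_cone (normal_graph q) (X k, ys + t k *\<^sub>R W k)"
      using Z[of k] by (simp add: A_def B_def)
    from graph_normal_cone_subset[OF q2 feas Lorth Leq Lpos[symmetric] _ this] surj
    show "B k \<in> KI q (X k) Ip I \<and> A k + hessL q (L k) (X k) *v B k \<in> neg_polar (KI q (X k) Ip I)"
      by (simp add: act)
  qed
  have wK: "w \<in> KI_dir q y Ip I u"
    by (rule KI_limit[OF q2 Ip_subset s U B]) (use ev in \<open>auto elim: eventually_mono\<close>)
  moreover have "(ws + hessL q lam y *v w) \<bullet> p \<le> 0" if p: "p \<in> KI_dir q y Ip I u" for p
  proof -
    obtain P where P: "P \<longlonglongrightarrow> p" "\<forall>\<^sub>F k in sequentially. P k \<in> KI q (X k) Ip I"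
      using KI_dir_approx[OF q2 reg Ip_subset s U p] by blast
    have lim: "(\<lambda>k. (A k + hessL q (L k) (X k) *v B k) \<bullet> P k) \<longlonglongrightarrow> (ws + hessL q lam y *v w) \<bullet> p"
      by (intro tendsto_inner tendsto_add A P tendsto_hessL_mult[OF q2 X_lim Llim B])
    have "\<forall>\<^sub>F k in sequentially. (A k + hessL q (L k) (X k) *v B k) \<bullet> P k \<le> 0"
      using ev P(2) by eventually_elim (auto simp: neg_polar_def)
    from tendsto_upperbound[OF lim this] show ?thesis by simp
  qed
  ultimately show ?thesis by (auto simp: Qset_def neg_polar_def)
qed

end

section \<open>Curves with a prescribed active set\<close>

lemma Jmax_above:
  fixes q :: "real^'m \<Rightarrow> real^'l"
  assumes "J \<in> Jbar q y u"
  shows "\<exists>J'\<in>Jmax q y u. J \<subseteq> J'"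
proof -
  obtain J' where "J' \<in> Jbar q y u" "J \<subseteq> J'" "\<And>J''. J'' \<in> Jbar q y u \<Longrightarrow> J' \<subseteq> J'' \<Longrightarrow> J' = J''"
    using finite_has_maximal2[OF finite assms] by metis
  then show ?thesis unfolding Jmax_def by auto
qed

text \<open>Otherwise \<open>z\<close> could be moved along \<open>\<plusminus>w\<close> until a further constraint becomes active; a large
  multiple of \<open>u\<close> restores the constraints that are not tangent to \<open>u\<close>.\<close>

lemma Jmax_kernel_pos:
  fixes q :: "real^'m \<Rightarrow> real^'l"
  assumes u: "u \<in> Tlin q y" and z: "z \<in> Xi q y u" and max: "Jz q y u z \<in> Jmax q y u"
    and w: "\<And>i. i \<in> Jz q y u z \<Longrightarrow> gradq q i y \<bullet> w = 0" and i: "i \<in> active_dir q y u"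
  shows "gradq q i y \<bullet> w \<le> 0"
proof (rule ccontr)
  assume pos: "\<not> gradq q i y \<bullet> w \<le> 0"
  define \<phi> where "\<phi> j = - (gradq q j y \<bullet> z + u \<bullet> (hessq q j y *v u))" for j
  have \<phi>0: "0 \<le> \<phi> j" if "j \<in> active q y" for j
  proof -
    have "gradq q j y \<bullet> z + u \<bullet> (hessq q j y *v u) \<le> 0" using z that unfolding Xi_def by blast
    then show ?thesis unfolding \<phi>_def by linarith
  qed
  define A where "A = {j \<in> active_dir q y u. gradq q j y \<bullet> w > 0}"
  have A: "finite A" "i \<in> A" using pos i by (auto simp: A_def)
  have \<phi>A: "\<phi> j > 0" if "j \<in> A" for j
  proof -
    have j: "j \<in> active_dir q y u" "j \<notin> Jz q y u z" using that w[of j] by (auto simp: A_def)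
    then have "\<phi> j \<noteq> 0" by (auto simp: \<phi>_def Jz_def)
    then show ?thesis using \<phi>0[of j] j by (auto simp: active_dir_def)
  qed
  \<comment> \<open>Ratio test: the longest step along \<open>w\<close> before a constraint tangent
    to \<open>u\<close> is violated; a minimiser \<open>j0\<close> becomes active.\<close>
  define \<tau> where "\<tau> = Min ((\<lambda>j. \<phi> j / (gradq q j y \<bullet> w)) ` A)"
  obtain j0 where j0: "j0 \<in> A" "\<tau> = \<phi> j0 / (gradq q j0 y \<bullet> w)"
    using Min_in[of "(\<lambda>j. \<phi> j / (gradq q j y \<bullet> w)) ` A"] A unfolding \<tau>_def by blast
  have \<tau>pos: "\<tau> > 0" using j0 \<phi>A by (auto simp: A_def)
  have \<tau>le: "\<tau> * (gradq q j y \<bullet> w) \<le> \<phi> j" if "j \<in> active_dir q y u" for j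
  proof (cases "j \<in> A")
    case True
    then have "\<tau> \<le> \<phi> j / (gradq q j y \<bullet> w)"
      unfolding \<tau>_def using A by (intro Min_le) auto
    then show ?thesis using True by (simp add: A_def field_simps)
  next
    case False
    then have "gradq q j y \<bullet> w \<le> 0" using that by (auto simp: A_def)
    then show ?thesis using \<tau>pos \<phi>0[of j] that mult_nonneg_nonpos[of \<tau> "gradq q j y \<bullet> w"]
      by (auto simp: active_dir_def)
  qed
  \<comment> \<open>\<open>c j\<close> is the multiple of \<open>u\<close> that outweighs a possible
    violation at a constraint strictly decreasing along \<open>u\<close>. The sum \<open>r\<close>
    dominates all of them, and moving along \<open>u\<close> does not affect the constraints in
    \<open>active_dir\<close>.\<close>
  define c where "c j = \<bar>\<tau> * (gradq q j y \<bullet> w) - \<phi> j\<bar> / - (gradq q j y \<bullet> u)" for j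
  define N where "N = active q y - active_dir q y u"
  define r where "r = (\<Sum>j\<in>N. c j)"
  have neg: "gradq q j y \<bullet> u < 0" if "j \<in> N" for j
    using u that by (auto simp: N_def Tlin_def active_dir_def less_le)
  have cr: "c j \<le> r" if "j \<in> N" for j
    unfolding r_def by (rule member_le_sum) (use that neg in \<open>auto simp: c_def intro!: divide_nonneg_neg\<close>)
  define z' where "z' = z + \<tau> *\<^sub>R w + r *\<^sub>R u"
  have z': "gradq q j y \<bullet> z' + u \<bullet> (hessq q j y *v u) = \<tau> * (gradq q j y \<bullet> w) - \<phi> j + r * (gradq q j y \<bullet> u)" for j
    by (simp add: z'_def \<phi>_def inner_add_right)
  have z'dir: "gradq q j y \<bullet> z' + u \<bullet> (hessq q j y *v u) = \<tau> * (gradq q j y \<bullet> w) - \<phi> j"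
    if "j \<in> active_dir q y u" for j
    unfolding z' using that by (simp add: active_dir_def)
  have "z' \<in> Xi q y u"
    unfolding Xi_def
  proof (intro CollectI ballI)
    fix j assume j: "j \<in> active q y"
    show "gradq q j y \<bullet> z' + u \<bullet> (hessq q j y *v u) \<le> 0"
    proof (cases "j \<in> active_dir q y u")
      case True
      then show ?thesis using z'dir \<tau>le by simp
    next
      case False
      then have N: "j \<in> N" using j by (simp add: N_def)
      have "r * (gradq q j y \<bullet> u) \<le> c j * (gradq q j y \<bullet> u)"
        using cr[OF N] neg[OF N] by (simp add: mult_right_mono_neg)
      also have "\<dots> = - \<bar>\<tau> * (gradq q j y \<bullet> w) - \<phi> j\<bar>"
        using neg[OF N] by (simp add: c_def)
      finally show ?thesis unfolding z' by linarith
    qed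
  qed
  then have "Jz q y u z' \<in> Jbar q y u" by (simp add: Jbar_def)
  moreover have "Jz q y u z \<subseteq> Jz q y u z'"
  proof
    fix j assume j: "j \<in> Jz q y u z"
    then have "j \<in> active_dir q y u" "\<phi> j = 0" by (auto simp: Jz_def \<phi>_def)
    then show "j \<in> Jz q y u z'" using z'dir[of j] w[OF j] by (simp add: Jz_def)
  qed
  ultimately have eq: "Jz q y u z' = Jz q y u z" using max unfolding Jmax_def by blast
  have "j0 \<in> active_dir q y u" "gradq q j0 y \<bullet> w > 0" using j0(1) by (auto simp: A_def)
  then have "j0 \<in> Jz q y u z'" using z'dir[of j0] j0(2) by (simp add: Jz_def)
  then show False using eq w[of j0] \<open>gradq q j0 y \<bullet> w > 0\<close> by auto
qed

lemma Jmax_kernel: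
  fixes q :: "real^'m \<Rightarrow> real^'l"
  assumes "u \<in> Tlin q y" "z \<in> Xi q y u" "Jz q y u z \<in> Jmax q y u"
    and "\<And>i. i \<in> Jz q y u z \<Longrightarrow> gradq q i y \<bullet> w = 0" and "i \<in> active_dir q y u"
  shows "gradq q i y \<bullet> w = 0"
  using Jmax_kernel_pos[of u q y z w i] Jmax_kernel_pos[of u q y z "- w" i] assms by auto

context
  fixes q :: "real^'m \<Rightarrow> real^'l"
  assumes q2: "twice_cont_diff q"
begin

text \<open>Brouwer's theorem works at one fixed \<open>t\<close> on a whole ball of parameters, so
  the expansion is needed uniformly. Violations with \<open>t\<close> tending to \<open>0\<close>
  would accumulate by compactness and contradict the sequential expansion with direction
  \<open>d + t e\<close>.\<close>

lemma second_order_uniform: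
  fixes d e :: "'a::metric_space \<Rightarrow> real^'m"
  assumes K: "compact K" and d: "continuous_on K d" and e: "continuous_on K e" and c: "c > 0"
  shows "\<forall>\<^sub>F t in at_right 0. \<forall>a\<in>K. \<bar>(q (y + t *\<^sub>R (d a + t *\<^sub>R e a)) $ i - q y $ i - t * (gradq q i y \<bullet> d a)) / t\<^sup>2
     - (gradq q i y \<bullet> e a + (d a \<bullet> (hessq q i y *v d a)) / 2)\<bar> \<le> c"
proof (rule ccontr)
  define P where "P t a \<longleftrightarrow> \<bar>(q (y + t *\<^sub>R (d a + t *\<^sub>R e a)) $ i - q y $ i - t * (gradq q i y \<bullet> d a)) / t\<^sup>2
     - (gradq q i y \<bullet> e a + (d a \<bullet> (hessq q i y *v d a)) / 2)\<bar> \<le> c" for t a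
  assume "\<not> ?thesis"
  then have "\<not> (\<exists>b>0. \<forall>t>0. t < b \<longrightarrow> (\<forall>a\<in>K. P t a))"
    unfolding eventually_at_right_field P_def by simp
  then have "\<exists>t a. 0 < t \<and> t < inverse (real (Suc n)) \<and> a \<in> K \<and> \<not> P t a" for n
    by (metis inverse_positive_iff_positive of_nat_0_less_iff zero_less_Suc)
  then obtain t a where ta: "\<And>n. 0 < t n" "\<And>n. t n < inverse (real (Suc n))" "\<And>n. a n \<in> K" "\<And>n. \<not> P (t n) (a n)"
    by metis
  have t: "t \<longlonglongrightarrow> 0"
    by (rule tendsto_sandwich[OF _ _ tendsto_const LIMSEQ_inverse_real_of_nat])
      (use ta in \<open>auto intro!: always_eventually less_imp_le\<close>)
  obtain a0 r where a0: "a0 \<in> K" and r: "strict_mono (r::nat\<Rightarrow>nat)" and lim: "(a \<circ> r) \<longlonglongrightarrow> a0"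
    using compact_imp_seq_compact[OF K] ta(3) unfolding seq_compact_def by metis
  define s where "s k = t (r k)" for k
  define x where "x k = a (r k)" for k
  have s: "s k > 0" "s \<longlonglongrightarrow> 0" for k
    using ta(1) LIMSEQ_subseq_LIMSEQ[OF t r] by (simp_all add: s_def[abs_def] o_def)
  have xK: "x k \<in> K" for k using ta(3) by (simp add: x_def)
  have x: "x \<longlonglongrightarrow> a0" using lim by (simp add: x_def[abs_def] o_def)
  have dx: "(\<lambda>k. d (x k)) \<longlonglongrightarrow> d a0" and ex: "(\<lambda>k. e (x k)) \<longlonglongrightarrow> e a0"
    by (rule continuous_on_tendsto_compose[OF d x a0] continuous_on_tendsto_compose[OF e x a0], use xK in auto)+
  define U where "U k = d (x k) + s k *\<^sub>R e (x k)" for k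
  have "U \<longlonglongrightarrow> d a0 + 0 *\<^sub>R e a0"
    unfolding U_def by (intro tendsto_intros dx ex s)
  then have U: "U \<longlonglongrightarrow> d a0" by simp
  define Q where "Q k = (q (y + s k *\<^sub>R U k) $ i - q y $ i - s k * (gradq q i y \<bullet> U k)) / (s k)\<^sup>2" for k
  have Q: "Q \<longlonglongrightarrow> (d a0 \<bullet> (hessq q i y *v d a0)) / 2"
    unfolding Q_def by (rule second_difference_quotient_tendsto[OF q2 s U])
  define R where "R k = (d (x k) \<bullet> (hessq q i y *v d (x k))) / 2" for k
  have R: "R \<longlonglongrightarrow> (d a0 \<bullet> (hessq q i y *v d a0)) / 2"
    unfolding R_def by (intro tendsto_intros tendsto_matrix_vector_mult dx) simp
  have "(\<lambda>k. \<bar>Q k - R k\<bar>) \<longlonglongrightarrow> \<bar>(d a0 \<bullet> (hessq q i y *v d a0)) / 2 - (d a0 \<bullet> (hessq q i y *v d a0)) / 2\<bar>"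
    by (intro tendsto_intros Q R)
  then have "\<forall>\<^sub>F k in sequentially. \<bar>Q k - R k\<bar> < c"
    using c by (intro order_tendstoD(2)) auto
  then obtain k where k: "\<bar>Q k - R k\<bar> < c" using eventually_happens by fastforce
  have "(q (y + s k *\<^sub>R (d (x k) + s k *\<^sub>R e (x k))) $ i - q y $ i - s k * (gradq q i y \<bullet> d (x k))) / (s k)\<^sup>2
      = Q k + gradq q i y \<bullet> e (x k)"
    using s(1)[of k] by (simp add: Q_def U_def inner_add_right field_simps power2_eq_square)
  then have "P (s k) (x k)" unfolding P_def using k by (simp add: R_def)
  then show False using ta(4)[of "r k"] by (simp add: s_def x_def)
qed

text \<open>Along this parabola 2-regularity turns the linear part of the second-order coefficients
  into the Brouwer parameter itself; the term quadratic in \<open>b\<close> is small on a small ball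
  and is absorbed together with the Taylor error. The factor \<open>1/2\<close> on \<open>z\<close>
  matches Taylor's formula. That \<open>b\<close> stays in the kernel of the gradients is recorded
  for the sake of constraints outside \<open>J\<close>.\<close>

lemma two_regular_curve:
  assumes reg: "two_regular q J y u"
    and act: "\<And>i. i \<in> J \<Longrightarrow> q y $ i = 0"
    and u: "\<And>i. i \<in> J \<Longrightarrow> gradq q i y \<bullet> u = 0"
    and z: "\<And>i. i \<in> J \<Longrightarrow> gradq q i y \<bullet> z + u \<bullet> (hessq q i y *v u) = 0"
    and c: "\<And>i. 0 \<le> c i" "\<And>i. c i \<le> 1" and \<delta>: "\<delta> > 0"
  shows "\<forall>\<^sub>F t in at_right 0. \<exists>b a. norm b \<le> \<delta> \<and> norm a \<le> \<delta> \<and> (\<forall>i\<in>J. gradq q i y \<bullet> b = 0) \<and>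
     (\<forall>i\<in>J. q (y + t *\<^sub>R ((u + b) + t *\<^sub>R ((1/2) *\<^sub>R z + a))) $ i = - c i * t ^ 3)"
proof -
  obtain G B :: "real^'l \<Rightarrow> real^'m" and C where C: "C > 0"
    and cont: "\<And>S. continuous_on S G" "\<And>S. continuous_on S B"
    and le: "\<And>\<alpha>. norm (G \<alpha>) \<le> C * norm \<alpha>" "\<And>\<alpha>. norm (B \<alpha>) \<le> C * norm \<alpha>"
    and GB: "\<And>\<alpha> i. i \<in> J \<Longrightarrow> gradq q i y \<bullet> G \<alpha> + u \<bullet> (hessq q i y *v B \<alpha>) = \<alpha> $ i"
      "\<And>\<alpha> i. i \<in> J \<Longrightarrow> gradq q i y \<bullet> B \<alpha> = 0"
    by (rule two_regular_selection[OF reg]) (rule that; assumption)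
  define N where "N = (\<Sum>i\<in>UNIV. onorm ((*v) (hessq q i y))) + 1"
  have on0: "0 \<le> onorm ((*v) (hessq q i y))" for i
    by (rule onorm_pos_le) (simp add: matrix_vector_mul_bounded_linear)
  have N0: "N > 0" unfolding N_def by (simp add: add_nonneg_pos sum_nonneg on0)
  have N: "\<bar>b \<bullet> (hessq q i y *v b)\<bar> \<le> N * (norm b * norm b)" for i b
  proof -
    have "onorm ((*v) (hessq q i y)) \<le> (\<Sum>i\<in>UNIV. onorm ((*v) (hessq q i y)))"
      by (rule member_le_sum) (auto simp: on0)
    then have "onorm ((*v) (hessq q i y)) \<le> N" by (simp add: N_def)
    moreover have "norm (hessq q i y *v b) \<le> onorm ((*v) (hessq q i y)) * norm b"
      by (rule onorm) (simp add: matrix_vector_mul_bounded_linear)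
    ultimately have "norm (hessq q i y *v b) \<le> N * norm b"
      by (meson mult_right_mono norm_ge_zero order_trans)
    then have "norm b * norm (hessq q i y *v b) \<le> norm b * (N * norm b)"
      by (intro mult_left_mono) auto
    then show ?thesis using Cauchy_Schwarz_ineq2[of b "hessq q i y *v b"] by (simp add: mult.left_commute)
  qed
  define n where "n = real CARD('l)"
  have n: "n > 0" by (simp add: n_def)
  \<comment> \<open>\<open>\<delta> / C\<close> keeps both corrections below \<delta>;
    \<open>1 / (n * N * C\<^sup>2)\<close> makes the quadratic term at most
    \<open>\<epsilon> / n\<close>, and only half of it occurs.\<close>
  define \<epsilon> where "\<epsilon> = min (\<delta> / C) (1 / (n * N * C\<^sup>2))"
  have \<epsilon>0: "\<epsilon> > 0" using \<delta> C n N0 by (simp add: \<epsilon>_def)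
  have \<epsilon>\<delta>: "C * \<epsilon> \<le> \<delta>"
  proof -
    have "C * \<epsilon> \<le> C * (\<delta> / C)" using C by (intro mult_left_mono) (auto simp: \<epsilon>_def)
    then show ?thesis using C by simp
  qed
  have \<epsilon>N: "N * (C * \<epsilon> * (C * \<epsilon>)) \<le> \<epsilon> / n"
  proof -
    have "N * (C * \<epsilon> * (C * \<epsilon>)) = \<epsilon> * (N * C\<^sup>2 * \<epsilon>)" by (simp add: power2_eq_square)
    also have "\<dots> \<le> \<epsilon> * (N * C\<^sup>2 * (1 / (n * N * C\<^sup>2)))"
      using \<epsilon>0 N0 C by (intro mult_left_mono) (auto simp: \<epsilon>_def)
    also have "\<dots> = \<epsilon> / n" using N0 C n by simp
    finally show ?thesis .
  qed
  define d where "d a = u + B a" for a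
  define e where "e a = (1/2) *\<^sub>R z + G a" for a
  \<comment> \<open>Error budget per component: \<eta> for the expansion, \<eta> for
    \<open>c i * t\<close> and \<open>\<epsilon> / (2 * n)\<close> for the quadratic term, together
    \<open>\<epsilon> / n\<close>.\<close>
  define \<eta> where "\<eta> = \<epsilon> / (4 * n)"
  have \<eta>: "\<eta> > 0" using \<epsilon>0 n by (simp add: \<eta>_def)
  have ev1: "\<forall>\<^sub>F t in at_right 0. \<forall>i. \<forall>a\<in>cball 0 \<epsilon>.
     \<bar>(q (y + t *\<^sub>R (d a + t *\<^sub>R e a)) $ i - q y $ i - t * (gradq q i y \<bullet> d a)) / t\<^sup>2
     - (gradq q i y \<bullet> e a + (d a \<bullet> (hessq q i y *v d a)) / 2)\<bar> \<le> \<eta>"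
    by (intro eventually_all_finite second_order_uniform[OF compact_cball _ _ \<eta>])
      (auto simp: d_def e_def intro!: continuous_intros cont)
  have ev2: "\<forall>\<^sub>F t in at_right 0. 0 < t \<and> t < \<eta>"
    unfolding eventually_at_right_field using \<eta> by blast
  show ?thesis
  proof (rule eventually_mono[OF eventually_conj[OF ev1 ev2]], goal_cases)
    case t: (1 t)
    define F where "F a i = q (y + t *\<^sub>R (d a + t *\<^sub>R e a)) $ i / t\<^sup>2 + c i * t" for a i
    have "\<exists>a. norm a \<le> \<epsilon> \<and> (\<forall>i\<in>J. F a i = 0)"
    proof (rule zero_on_components)
      show "0 \<le> \<epsilon>" using \<epsilon>0 by simp
      fix i
      have "continuous_on (cball 0 \<epsilon>) (\<lambda>a. q (y + t *\<^sub>R (d a + t *\<^sub>R e a)) $ i)"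
        unfolding d_def e_def
        by (rule continuous_on_compose2[OF comp_continuous[OF q2]]) (auto intro!: continuous_intros cont)
      then show "continuous_on (cball 0 \<epsilon>) (\<lambda>a. F a i)"
        unfolding F_def using t by (auto intro!: continuous_intros)
      fix a :: "real^'l" assume a: "norm a \<le> \<epsilon>" and i: "i \<in> J"
      have gd: "gradq q i y \<bullet> d a = 0" using u[OF i] GB(2)[OF i] by (simp add: d_def inner_add_right)
      have main: "gradq q i y \<bullet> e a + (d a \<bullet> (hessq q i y *v d a)) / 2
          = a $ i + (B a \<bullet> (hessq q i y *v B a)) / 2"
      proof -
        have "d a \<bullet> (hessq q i y *v d a) = u \<bullet> (hessq q i y *v u) + 2 * (u \<bullet> (hessq q i y *v B a))
            + B a \<bullet> (hessq q i y *v B a)"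
          using hessq_sym[OF q2, of "B a" i y u]
          by (simp add: d_def inner_add_left inner_add_right matrix_vector_right_distrib)
        then show ?thesis
          using z[OF i] GB(1)[OF i, of a] by (simp add: e_def inner_add_right field_simps)
      qed
      have quad: "\<bar>B a \<bullet> (hessq q i y *v B a)\<bar> \<le> \<epsilon> / n"
      proof -
        have b: "norm (B a) \<le> C * \<epsilon>"
          using le(2)[of a] a C by (meson less_imp_le mult_left_mono order_trans)
        have "norm (B a) * norm (B a) \<le> C * \<epsilon> * (C * \<epsilon>)"
          using b by (intro mult_mono) (use C \<epsilon>0 in auto)
        then have "N * (norm (B a) * norm (B a)) \<le> N * (C * \<epsilon> * (C * \<epsilon>))"
          using N0 by (intro mult_left_mono) auto
        then show ?thesis using N[of "B a" i] \<epsilon>N by linarith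
      qed
      have ct: "\<bar>c i * t\<bar> \<le> \<eta>"
      proof -
        have "c i * t \<le> 1 * t" using c t by (intro mult_right_mono) auto
        moreover have "0 \<le> c i * t" using c(1)[of i] t by simp
        ultimately show ?thesis using t by linarith
      qed
      have near: "\<bar>q (y + t *\<^sub>R (d a + t *\<^sub>R e a)) $ i / t\<^sup>2
          - (a $ i + (B a \<bullet> (hessq q i y *v B a)) / 2)\<bar> \<le> \<eta>"
        using t a act[OF i] gd main by (auto dest!: spec[of _ i] bspec[of _ _ a])
      have comb: "\<bar>X + K - A\<bar> \<le> r" if "\<bar>X - (A + B / 2)\<bar> \<le> g" "\<bar>B\<bar> \<le> r" "\<bar>K\<bar> \<le> g" "g + g + r / 2 = r"
        for X A B K g r :: real
        using that by linarith
      have "F a i - a $ i = q (y + t *\<^sub>R (d a + t *\<^sub>R e a)) $ i / t\<^sup>2 + c i * t - a $ i"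
        by (simp add: F_def)
      moreover have "\<eta> + \<eta> + (\<epsilon> / n) / 2 = \<epsilon> / n" by (simp add: \<eta>_def)
      ultimately show "\<bar>F a i - a $ i\<bar> \<le> \<epsilon> / CARD('l)" using comb[OF near quad ct] by (simp add: n_def)
    qed
    then obtain a where a: "norm a \<le> \<epsilon>" "\<And>i. i \<in> J \<Longrightarrow> F a i = 0" by blast
    have Ca: "C * norm a \<le> \<delta>"
      using a(1) C \<epsilon>\<delta> by (meson less_imp_le mult_left_mono order_trans)
    show ?case
    proof (rule exI[of _ "B a"], rule exI[of _ "G a"], intro conjI ballI)
      show "norm (B a) \<le> \<delta>" "norm (G a) \<le> \<delta>" using le[of a] Ca by auto
      fix i assume i: "i \<in> J"
      then show "gradq q i y \<bullet> B a = 0" by (rule GB(2))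
      have "q (y + t *\<^sub>R (d a + t *\<^sub>R e a)) $ i / t\<^sup>2 = - c i * t" using a(2)[OF i] by (simp add: F_def)
      then have "q (y + t *\<^sub>R (d a + t *\<^sub>R e a)) $ i = - c i * t * t\<^sup>2" using t by (simp add: field_simps)
      then show "q (y + t *\<^sub>R ((u + B a) + t *\<^sub>R ((1/2) *\<^sub>R z + G a))) $ i = - c i * t ^ 3"
        by (simp add: d_def e_def power2_eq_square power3_eq_cube)
    qed
  qed
qed

text \<open>The value \<open>- t ^ 3\<close> prescribed on \<open>J - I\<close> is negative but negligible against second-order terms.\<close>

lemma curve_sequence:
  assumes y: "y \<in> Gam q" and u: "u \<in> Tlin q y" and J: "J \<in> Jmax q y u"
    and reg: "two_regular q J y u" and IJ: "I \<subseteq> J"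
  shows "\<exists>(s::nat \<Rightarrow> real) U. (\<forall>k. s k > 0) \<and> s \<longlonglongrightarrow> 0 \<and> U \<longlonglongrightarrow> u \<and>
     (\<forall>k. y + s k *\<^sub>R U k \<in> Gam q \<and> active q (y + s k *\<^sub>R U k) = I)"
proof -
  obtain z where z: "z \<in> Xi q y u" and Jz: "J = Jz q y u z"
    using J unfolding Jmax_def Jbar_def by auto
  have Jdir: "J \<subseteq> active_dir q y u" by (auto simp: Jz Jz_def)
  define c :: "'l \<Rightarrow> real" where "c i = (if i \<in> I then 0 else 1)" for i
  define P where "P \<delta> t b a \<longleftrightarrow> norm b \<le> \<delta> \<and> norm a \<le> \<delta> \<and> (\<forall>i\<in>J. gradq q i y \<bullet> b = 0) \<and>
     (\<forall>i\<in>J. q (y + t *\<^sub>R ((u + b) + t *\<^sub>R ((1/2) *\<^sub>R z + a))) $ i = - c i * t ^ 3)" for \<delta> t b a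
  have "\<exists>t b a. 0 < t \<and> t < inverse (real (Suc k)) \<and> P (inverse (real (Suc k))) t b a" for k
  proof -
    have "\<forall>\<^sub>F t in at_right 0. \<exists>b a. P (inverse (real (Suc k))) t b a"
      unfolding P_def
      by (rule two_regular_curve[OF reg]) (use Jdir in \<open>auto simp: Jz Jz_def active_dir_def active_def c_def\<close>)
    moreover have "\<forall>\<^sub>F t in at_right 0. 0 < t \<and> t < inverse (real (Suc k))"
      unfolding eventually_at_right_field by (intro exI[of _ "inverse (real (Suc k))"]) auto
    ultimately have "\<forall>\<^sub>F t in at_right 0. (\<exists>b a. P (inverse (real (Suc k))) t b a) \<and> 0 < t \<and> t < inverse (real (Suc k))"
      by (rule eventually_conj)
    then show ?thesis using eventually_happens[of _ "at_right (0::real)"] by fastforce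
  qed
  then obtain t b a where tba: "\<And>k. 0 < t k" "\<And>k. t k < inverse (real (Suc k))"
      "\<And>k. P (inverse (real (Suc k))) (t k) (b k) (a k)"
    by metis
  have t: "t \<longlonglongrightarrow> 0"
    by (rule tendsto_sandwich[OF _ _ tendsto_const LIMSEQ_inverse_real_of_nat])
      (use tba in \<open>auto intro!: always_eventually less_imp_le\<close>)
  have b: "b \<longlonglongrightarrow> 0" and a: "a \<longlonglongrightarrow> 0"
    by (rule Lim_null_comparison[OF _ LIMSEQ_inverse_real_of_nat], use tba(3) in \<open>simp add: P_def\<close>)+
  define E where "E k = (1/2) *\<^sub>R z + a k" for k
  define U where "U k = (u + b k) + t k *\<^sub>R E k" for k
  have "E \<longlonglongrightarrow> (1/2) *\<^sub>R z + 0" unfolding E_def by (intro tendsto_intros a)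
  then have E: "E \<longlonglongrightarrow> (1/2) *\<^sub>R z" by simp
  have "U \<longlonglongrightarrow> (u + 0) + 0 *\<^sub>R ((1/2) *\<^sub>R z)"
    unfolding U_def by (intro tendsto_intros b t E)
  then have U: "U \<longlonglongrightarrow> u" by simp
  have X: "(\<lambda>k. y + t k *\<^sub>R U k) \<longlonglongrightarrow> y" by (rule direction_tendsto[OF t U])
  have onJ: "q (y + t k *\<^sub>R U k) $ i = - c i * t k ^ 3" if "i \<in> J" for i k
    using tba(3)[of k] that by (simp add: P_def U_def E_def)
  have ev: "\<forall>\<^sub>F k in sequentially. \<forall>i. i \<notin> J \<longrightarrow> q (y + t k *\<^sub>R U k) $ i < 0"
  proof (rule eventually_all_finite)
    fix i
    consider "i \<in> J" | "i \<in> active_dir q y u - J" | "i \<in> active q y - active_dir q y u" | "i \<notin> active q y"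
      by (auto simp: active_dir_def)
    then show "\<forall>\<^sub>F k in sequentially. i \<notin> J \<longrightarrow> q (y + t k *\<^sub>R U k) $ i < 0"
    proof cases
      case 1 then show ?thesis by simp
    next
      case 2
      then have qy: "q y $ i = 0" and gu: "gradq q i y \<bullet> u = 0" by (auto simp: active_dir_def active_def)
      \<comment> \<open>A priori \<open>t k * (gradq q i y \<bullet> b k)\<close> is only
        \<open>o(t k)\<close> and could exceed the negative term of order
        \<open>(t k)\<^sup>2\<close>. Maximality of \<open>J\<close> removes it.\<close>
      have gb: "gradq q i y \<bullet> b k = 0" for k
        by (rule Jmax_kernel[OF u z]) (use J Jz 2 tba(3)[of k] in \<open>auto simp: P_def\<close>)
      define D where "D k = (q (y + t k *\<^sub>R U k) $ i - q y $ i - t k * (gradq q i y \<bullet> U k)) / (t k)\<^sup>2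
          + gradq q i y \<bullet> E k" for k
      have "D \<longlonglongrightarrow> (u \<bullet> (hessq q i y *v u)) / 2 + gradq q i y \<bullet> ((1/2) *\<^sub>R z)"
        unfolding D_def
        by (intro tendsto_add second_difference_quotient_tendsto[OF q2] tendsto_inner tendsto_const E U t tba)
      moreover have "(u \<bullet> (hessq q i y *v u)) / 2 + gradq q i y \<bullet> ((1/2) *\<^sub>R z) < 0"
      proof -
        have "gradq q i y \<bullet> z + u \<bullet> (hessq q i y *v u) \<le> 0" "gradq q i y \<bullet> z + u \<bullet> (hessq q i y *v u) \<noteq> 0"
          using 2 z by (auto simp: Xi_def Jz Jz_def active_dir_def)
        then show ?thesis by (simp add: field_simps)
      qed
      ultimately have "\<forall>\<^sub>F k in sequentially. D k < 0" by (rule order_tendstoD(2))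
      then show ?thesis
      proof (rule eventually_mono)
        fix k assume D: "D k < 0"
        have "D k = q (y + t k *\<^sub>R U k) $ i / (t k)\<^sup>2"
          using tba(1)[of k] gb[of k] gu qy
          by (simp add: D_def U_def inner_add_right field_simps power2_eq_square)
        then show "i \<notin> J \<longrightarrow> q (y + t k *\<^sub>R U k) $ i < 0" using D tba(1)[of k] by (simp add: divide_less_0_iff)
      qed
    next
      case 3
      have lim: "(\<lambda>k. (1 / t k) *\<^sub>R (q (y + t k *\<^sub>R U k) $ i - q y $ i)) \<longlonglongrightarrow> gradq q i y \<bullet> u"
        by (rule difference_quotient_tendsto[OF gradq_deriv[OF q2] tba(1) t U])
      have "gradq q i y \<bullet> u < 0" using 3 u by (auto simp: Tlin_def active_dir_def less_le)
      then have "\<forall>\<^sub>F k in sequentially. (1 / t k) *\<^sub>R (q (y + t k *\<^sub>R U k) $ i - q y $ i) < 0"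
        by (rule order_tendstoD(2)[OF lim])
      then show ?thesis
      proof (rule eventually_mono)
        fix k assume "(1 / t k) *\<^sub>R (q (y + t k *\<^sub>R U k) $ i - q y $ i) < 0"
        then show "i \<notin> J \<longrightarrow> q (y + t k *\<^sub>R U k) $ i < 0"
          using tba(1)[of k] 3 by (auto simp: divide_less_0_iff active_def)
      qed
    next
      case 4
      have "\<forall>\<^sub>F k in sequentially. \<forall>i. i \<notin> active q y \<longrightarrow> q (y + t k *\<^sub>R U k) $ i < 0"
        using inactive_nbhd[OF q2 y] X unfolding filterlim_iff by blast
      then show ?thesis by (rule eventually_mono) (use 4 in auto)
    qed
  qed
  then obtain N where N: "\<And>k i. k \<ge> N \<Longrightarrow> i \<notin> J \<Longrightarrow> q (y + t k *\<^sub>R U k) $ i < 0"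
    unfolding eventually_sequentially by blast
  have final: "y + t (k + N) *\<^sub>R U (k + N) \<in> Gam q \<and> active q (y + t (k + N) *\<^sub>R U (k + N)) = I" for k
  proof -
    have neg: "q (y + t (k + N) *\<^sub>R U (k + N)) $ i < 0" if "i \<notin> I" for i
    proof (cases "i \<in> J")
      case True
      then show ?thesis using onJ[of i "k + N"] that tba(1)[of "k + N"] by (simp add: c_def)
    qed (rule N, auto)
    have zero: "q (y + t (k + N) *\<^sub>R U (k + N)) $ i = 0" if "i \<in> I" for i
      using onJ[of i "k + N"] that IJ by (auto simp: c_def)
    have "q (y + t (k + N) *\<^sub>R U (k + N)) $ i \<le> 0" for i
      using neg[of i] zero[of i] by (cases "i \<in> I") auto
    moreover have "q (y + t (k + N) *\<^sub>R U (k + N)) $ i = 0 \<longleftrightarrow> i \<in> I" for i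
      using neg[of i] zero[of i] by (cases "i \<in> I") auto
    ultimately show ?thesis by (simp add: Gam_def active_def)
  qed
  show ?thesis
  proof (rule exI[of _ "\<lambda>k. t (k + N)"], rule exI[of _ "\<lambda>k. U (k + N)"], intro conjI)
    show "(\<lambda>k. t (k + N)) \<longlonglongrightarrow> 0" "(\<lambda>k. U (k + N)) \<longlonglongrightarrow> u"
      by (intro LIMSEQ_ignore_initial_segment t U)+
    show "\<forall>k. 0 < t (k + N)" using tba(1) by simp
  qed (use final in blast)
qed

section \<open>Realising multipliers and normals along a curve\<close>

lemma vicinity_multipliers:
  assumes "metrically_regular_vicinity q y"
  shows "\<exists>V \<kappa>. open V \<and> y \<in> V \<and> (\<forall>x\<in>V. x \<in> Gam q \<longrightarrow> x \<noteq> y \<longrightarrow> bounded_multipliers \<kappa> q x)"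
proof -
  obtain V \<kappa> where V: "open V" "y \<in> V" "\<kappa> > 0"
      "\<And>x. x \<in> Gam q \<inter> V \<Longrightarrow> x \<noteq> y \<Longrightarrow> metrically_regular \<kappa> (Mq q) x 0"
    using assms unfolding metrically_regular_vicinity_def by blast
  have "bounded_multipliers \<kappa> q x" if x: "x \<in> V" "x \<in> Gam q" "x \<noteq> y" for x
    unfolding bounded_multipliers_def
  proof
    fix ys assume ys: "ys \<in> regular_normal_cone (Gam q) x"
    have mr: "metrically_regular \<kappa> (Mq q) x 0" using V(4) x by blast
    obtain lam where "lam \<in> normal_orthant q x" "ys = gradsum q x lam"
      using multipliers_exist[OF q2 x(2) V(3) mr ys] by blast
    then show "\<exists>lam\<in>normal_orthant q x. ys = gradsum q x lam \<and> norm lam \<le> \<kappa> * norm ys"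
      using multiplier_bound[OF q2 x(2) V(3) mr] by blast
  qed
  then show ?thesis using V(1,2) by blast
qed

text \<open>The multipliers \<open>lam + t k mu\<close> are corrected by \<open>(t k)\<^sup>2\<close> on \<open>Ip\<close>, which makes \<open>Ip\<close> their exact support
  without affecting the first-order behaviour.\<close>

lemma realize_normals:
  assumes vic: "metrically_regular_vicinity q y"
    and lam: "lam \<in> Lam q y ys" and mu: "mu \<in> contingent_cone (normal_orthant q y) lam"
    and Ip: "Iplus lam mu \<subseteq> Ip" "Ip \<subseteq> I"
    and reg: "two_regular q I y u" and u: "u \<noteq> 0"
    and s: "\<And>k. s k > 0" "s \<longlonglongrightarrow> 0" and U: "U \<longlonglongrightarrow> u"
    and X: "\<And>k. y + s k *\<^sub>R U k \<in> Gam q" "\<And>k. active q (y + s k *\<^sub>R U k) = I"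
    and t: "\<And>k. t k > (0::real)" "t \<longlonglongrightarrow> 0" and st: "(\<lambda>k. s k / t k) \<longlonglongrightarrow> \<beta>"
    and Q: "(ws, w) \<in> Qset q y u lam Ip I"
  shows "\<exists>W Z. W \<longlonglongrightarrow> \<beta> *\<^sub>R (hessL q lam y *v u) + gradsum q y mu \<and> Z \<longlonglongrightarrow> (ws, w) \<and>
     (\<forall>\<^sub>F k in sequentially. Z k \<in> regular_normal_cone (normal_graph q)
        (y + s k *\<^sub>R U k, ys + t k *\<^sub>R W k))"
proof -
  define x where "x k = y + s k *\<^sub>R U k" for k
  have x: "x \<longlonglongrightarrow> y" unfolding x_def by (rule direction_tendsto[OF s(2) U])
  have orth: "lam \<in> normal_orthant q y" and ys: "gradsum q y lam = ys"
    using lam by (simp_all add: Lam_iff[OF q2])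
  have muD: "\<And>i. lam $ i = 0 \<Longrightarrow> 0 \<le> mu $ i" "\<And>i. i \<notin> active q y \<Longrightarrow> mu $ i = 0"
    using normal_orthant_contingentD[OF orth mu] by auto
  have lam0: "0 \<le> lam $ i" for i using orth by (simp add: normal_orthant_def)
  define one :: "real^'l" where "one = (\<chi> i. if i \<in> Ip then 1 else 0)"
  define nu where "nu k = mu + t k *\<^sub>R one" for k
  define L where "L k = lam + t k *\<^sub>R nu k" for k
  have nu: "nu \<longlonglongrightarrow> mu" unfolding nu_def by (rule direction_tendsto[OF t(2) tendsto_const])
  have L: "L \<longlonglongrightarrow> lam" unfolding L_def by (rule direction_tendsto[OF t(2) nu])
  have Lout: "L k $ i = 0" if "i \<notin> Ip" for i k
  proof -
    have "lam $ i = 0" "mu $ i = 0"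
      using Ip(1) that lam0[of i] muD(1)[of i] by (force simp: Iplus_def less_le)+
    then show ?thesis using that by (simp add: L_def nu_def one_def)
  qed
  have "\<forall>\<^sub>F k in sequentially. \<forall>i. i \<in> Ip \<longrightarrow> 0 < L k $ i"
  proof (rule eventually_all_finite)
    fix i
    show "\<forall>\<^sub>F k in sequentially. i \<in> Ip \<longrightarrow> 0 < L k $ i"
    proof (cases "lam $ i = 0")
      case False
      then have "0 < lam $ i" using lam0[of i] by (simp add: less_le)
      from order_tendstoD(1)[OF tendsto_vec_nth[OF L] this]
      show ?thesis by (rule eventually_mono) simp
    next
      case True
      have "i \<in> Ip \<longrightarrow> 0 < L k $ i" for k
        using muD(1)[OF True] True t(1)[of k] by (auto simp: L_def nu_def one_def intro!: mult_pos_pos add_nonneg_pos)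
      then show ?thesis by (intro always_eventually allI)
    qed
  qed
  then have evL: "\<forall>\<^sub>F k in sequentially. Ip = {i. L k $ i > 0} \<and> L k \<in> normal_orthant q (x k)"
  proof (rule eventually_mono)
    fix k assume *: "\<forall>i. i \<in> Ip \<longrightarrow> 0 < L k $ i"
    have "i \<in> Ip \<longleftrightarrow> L k $ i > 0" for i using * Lout[of i k] by (cases "i \<in> Ip") auto
    then have 1: "Ip = {i. L k $ i > 0}" by blast
    have "0 \<le> L k $ i" for i using * Lout[of i k] by (cases "i \<in> Ip") (auto simp: less_imp_le)
    moreover have "L k $ i = 0" if "i \<notin> active q (x k)" for i
      using that Ip(2) X(2)[of k] by (intro Lout) (auto simp: x_def)
    ultimately have "L k \<in> normal_orthant q (x k)" unfolding normal_orthant_def by blast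
    with 1 show "Ip = {i. L k $ i > 0} \<and> L k \<in> normal_orthant q (x k)" by (rule conjI)
  qed
  define D where "D k i = (1 / s k) *\<^sub>R (gradq q i (x k) - gradq q i y)" for k i
  have D: "(\<lambda>k. D k i) \<longlonglongrightarrow> hessq q i y *v u" for i
    unfolding D_def x_def by (rule gradq_quotient_tendsto[OF q2 s U])
  \<comment> \<open>Solved from the requirement that \<open>ys + t k W k\<close> be the gradient sum
    with multipliers \<open>L k\<close> at \<open>x k\<close>; the gradient differences enter with
    the factor \<open>s k / t k\<close>.\<close>
  define W where "W k = (s k / t k) *\<^sub>R (\<Sum>i\<in>UNIV. lam $ i *\<^sub>R D k i) + gradsum q (x k) (nu k)" for k
  have W: "W \<longlonglongrightarrow> \<beta> *\<^sub>R (hessL q lam y *v u) + gradsum q y mu"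
    unfolding W_def hessL_mult[OF q2] by (intro tendsto_add tendsto_scaleR st tendsto_sum tendsto_const D tendsto_gradsum[OF q2 x nu])
  have WL: "ys + t k *\<^sub>R W k = gradsum q (x k) (L k)" for k
  proof -
    have "t k *\<^sub>R ((s k / t k) *\<^sub>R (\<Sum>i\<in>UNIV. lam $ i *\<^sub>R D k i)) = gradsum q (x k) lam - gradsum q y lam"
      using s(1)[of k] t(1)[of k]
      by (simp add: D_def scaleR_diff_right scaleR_sum_right sum_subtractf mult.commute)
    moreover have "gradsum q (x k) (L k) = gradsum q (x k) lam + t k *\<^sub>R gradsum q (x k) (nu k)"
      by (simp add: L_def scaleR_left_distrib sum.distrib scaleR_sum_right)
    ultimately show ?thesis by (simp add: W_def scaleR_add_right ys)
  qed
  have wK: "w \<in> KI_dir q y Ip I u" and wsK: "ws + hessL q lam y *v w \<in> neg_polar (KI_dir q y Ip I u)"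
    using Q by (auto simp: Qset_def)
  obtain B where B: "B \<longlonglongrightarrow> w" "\<forall>\<^sub>F k in sequentially. B k \<in> KI q (x k) Ip I"
    using KI_dir_approx[OF q2 reg Ip(2) s U wK] unfolding x_def by blast
  obtain \<Xi> where \<Xi>: "\<Xi> \<longlonglongrightarrow> ws + hessL q lam y *v w" "\<And>k. \<Xi> k \<in> neg_polar (KI q (x k) Ip I)"
    using polar_KI_dir_approx[OF q2 Ip(2) s U wsK] unfolding x_def by blast
  \<comment> \<open>Makes \<open>A k + hessL q (L k) (x k) *v B k\<close> equal to
    \<open>\<Xi> k\<close>, so polarity holds exactly at each \<open>x k\<close> and not just in the
    limit.\<close>
  define A where "A k = \<Xi> k - hessL q (L k) (x k) *v B k" for k
  have "A \<longlonglongrightarrow> (ws + hessL q lam y *v w) - hessL q lam y *v w"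
    unfolding A_def by (intro tendsto_diff \<Xi> tendsto_hessL_mult[OF q2 x L B(1)])
  then have A: "A \<longlonglongrightarrow> ws" by simp
  obtain V \<kappa> where V: "open V" "y \<in> V" "\<And>x. x \<in> V \<Longrightarrow> x \<in> Gam q \<Longrightarrow> x \<noteq> y \<Longrightarrow> bounded_multipliers \<kappa> q x"
    using vicinity_multipliers[OF vic] by blast
  have evV: "\<forall>\<^sub>F k in sequentially. x k \<in> V" using topological_tendstoD[OF x V(1,2)] .
  have evU: "\<forall>\<^sub>F k in sequentially. U k \<noteq> 0" using tendsto_imp_eventually_ne[OF U u] .
  have evS: "\<forall>\<^sub>F k in sequentially. \<forall>\<alpha>::real^'l. \<exists>p. \<forall>i\<in>I. gradq q i (x k) \<bullet> p = \<alpha> $ i"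
    unfolding x_def by (rule two_regular_eventually_surj[OF q2 reg s U])
  have "\<forall>\<^sub>F k in sequentially. (A k, B k) \<in> regular_normal_cone (normal_graph q)
        (x k, ys + t k *\<^sub>R W k)"
    using evL B(2) evV evU evS
  proof eventually_elim
    case (elim k)
    have xy: "x k \<noteq> y" using elim(4) s(1)[of k] by (simp add: x_def)
    have act: "active q (x k) = I" using X(2) by (simp add: x_def)
    \<comment> \<open>The multiplier bound is provided only away from \<open>y\<close>, so the
      neighbourhood has to omit \<open>y\<close>; since \<open>U k \<noteq> 0\<close>, the point
      \<open>x k\<close> still lies inside.\<close>
    have nb: "\<forall>\<^sub>F x' in nhds (x k). x' \<in> Gam q \<longrightarrow> bounded_multipliers \<kappa> q x'"
      unfolding eventually_nhds
      by (rule exI[of _ "V - {y}"]) (use V elim(3) xy in \<open>auto intro: open_Diff\<close>)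
    have xG: "x k \<in> Gam q" using X(1) by (simp add: x_def)
    show ?case
      by (rule graph_normal_cone_supset[OF q2 xG _ WL _ _ nb, of Ip])
        (use elim act \<Xi>(2)[of k] in \<open>auto simp: A_def\<close>)
  qed
  then show ?thesis
    unfolding x_def using W tendsto_Pair[OF A B(1)]
    by (intro exI[of _ W] exI[of _ "\<lambda>k. (A k, B k)"]) simp
qed

end

section \<open>Directional normals to the graph\<close>

lemma Mbar_iff:
  assumes "twice_cont_diff q"
  shows "(lam, mu) \<in> Mbar q y ys v vs \<longleftrightarrow> lam \<in> Lam_dir q y ys v \<and>
    mu \<in> contingent_cone (normal_orthant q y) lam \<and> vs = hessL q lam y *v v + gradsum q y mu"
  unfolding Mbar_def transpose_jacobian[OF assms] by simp

lemma Lam_dir_subset: "lam \<in> Lam_dir q y ys v \<Longrightarrow> lam \<in> Lam q y ys"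
  by (simp add: Lam_dir_def)

text \<open>Maximality is vacuous at the zero direction. Hence \<open>Mbar\<close> with
  \<open>v = 0\<close> puts no second-order condition on \<open>lam\<close>, and maximality for the
  direction of the points has to be required separately.\<close>

lemma Lam_dir_zero: "Lam_dir q y ys 0 = Lam q y ys"
  by (auto simp: Lam_dir_def)

lemma dir_nbhd_eventually:
  fixes u :: "real^'m"
  assumes u: "u \<noteq> 0" and s: "\<And>k. s k > (0::real)" "s \<longlonglongrightarrow> 0" and U: "U \<longlonglongrightarrow> u"
    and e: "\<epsilon> > 0" "\<delta> > 0"
  shows "\<forall>\<^sub>F k in sequentially. s k *\<^sub>R U k \<in> dir_nbhd \<epsilon> \<delta> u"
proof -
  have evU: "\<forall>\<^sub>F k in sequentially. U k \<noteq> 0" using tendsto_imp_eventually_ne[OF U u] .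
  have "(\<lambda>k. s k *\<^sub>R U k) \<longlonglongrightarrow> 0" using tendsto_scaleR[OF s(2) U] by simp
  then have "\<forall>\<^sub>F k in sequentially. norm (s k *\<^sub>R U k) < \<epsilon>"
    using e(1) unfolding tendsto_iff by (simp add: dist_norm)
  moreover have "(\<lambda>k. U k /\<^sub>R norm (U k)) \<longlonglongrightarrow> u /\<^sub>R norm u"
    by (intro tendsto_intros U) (use u in simp)
  then have "\<forall>\<^sub>F k in sequentially. norm (U k /\<^sub>R norm (U k) - u /\<^sub>R norm u) < \<delta>"
    using e(2) unfolding tendsto_iff by (simp add: dist_norm)
  ultimately show ?thesis using evU
  proof eventually_elim
    case (elim k)
    have eq: "(s k *\<^sub>R U k) /\<^sub>R norm (s k *\<^sub>R U k) = U k /\<^sub>R norm (U k)"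
      using s(1)[of k] by simp
    have "norm ((s k *\<^sub>R U k) /\<^sub>R norm (s k *\<^sub>R U k) - u /\<^sub>R norm u) \<le> \<delta>"
      unfolding eq using elim(2) by (rule less_imp_le)
    moreover have "norm (s k *\<^sub>R U k) \<le> \<epsilon>" using elim(1) by (rule less_imp_le)
    moreover have "s k *\<^sub>R U k \<noteq> 0" using elim(3) s(1)[of k] by simp
    ultimately show ?case using u unfolding dir_nbhd_def by simp
  qed
qed

context
  fixes q :: "real^'m \<Rightarrow> real^'l" and y :: "real^'m"
  assumes q2: "twice_cont_diff q" and y: "y \<in> Gam q" and vic: "metrically_regular_vicinity q y"
begin

text \<open>Common core of both cases. 2-LICQ is assumed only on condition that \<open>u\<close> is
  critical, because for \<open>v = 0\<close> the direction \<open>u\<close> is extracted from the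
  sequence and its criticality is part of the conclusion.\<close>

lemma forward_inclusion:
  assumes u: "u \<noteq> 0" and s: "\<And>k. s k > (0::real)" "s \<longlonglongrightarrow> 0" and U: "U \<longlonglongrightarrow> u"
    and t: "\<And>k. t k > (0::real)" "t \<longlonglongrightarrow> 0" and st: "(\<lambda>k. s k / t k) \<longlonglongrightarrow> \<beta>" and W: "W \<longlonglongrightarrow> vs"
    and Z: "\<And>k. Z k \<in> regular_normal_cone (normal_graph q) (y + s k *\<^sub>R U k, ys + t k *\<^sub>R W k)"
    and Zlim: "Z \<longlonglongrightarrow> (ws, w)"
    and licq: "u \<in> critK q y ys \<Longrightarrow> two_LICQ q y u"
  shows "u \<in> critK q y ys \<and> (\<exists>lam\<in>Lam_dir q y ys u. \<exists>mu\<in>contingent_cone (normal_orthant q y) lam.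
    vs = \<beta> *\<^sub>R (hessL q lam y *v u) + gradsum q y mu \<and>
    (\<exists>J\<in>Jbar q y u. \<exists>Ip I. Iplus lam mu \<subseteq> Ip \<and> Ip \<subseteq> I \<and> I \<subseteq> J \<and> (ws, w) \<in> Qset q y u lam Ip I))"
proof -
  define x where "x k = y + s k *\<^sub>R U k" for k
  define Y where "Y k = ys + t k *\<^sub>R W k" for k
  have x: "x \<longlonglongrightarrow> y" unfolding x_def by (rule direction_tendsto[OF s(2) U])
  have Y: "Y \<longlonglongrightarrow> ys" unfolding Y_def by (rule direction_tendsto[OF t(2) W])
  have Yx: "Y k \<in> regular_normal_cone (Gam q) (x k)" for k
  proof -
    have "(x k, Y k) \<in> normal_graph q"
      using Z[of k] unfolding regular_normal_cone_def[of "gph _"] x_def Y_def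
      by (auto split: if_splits)
    then show ?thesis by (simp add: gph_def)
  qed
  have xG: "x k \<in> Gam q" for k
    using Yx[of k] unfolding regular_normal_cone_def by (auto split: if_splits)
  obtain V \<kappa> where V: "open V" "y \<in> V" "\<And>x. x \<in> V \<Longrightarrow> x \<in> Gam q \<Longrightarrow> x \<noteq> y \<Longrightarrow> bounded_multipliers \<kappa> q x"
    using vicinity_multipliers[OF q2 vic] by blast
  have "\<forall>\<^sub>F k in sequentially. x k \<in> V \<and> U k \<noteq> 0"
    using eventually_conj[OF topological_tendstoD[OF x V(1,2)] tendsto_imp_eventually_ne[OF U u]] .
  then obtain N where N: "\<And>k. k \<ge> N \<Longrightarrow> x k \<in> V" "\<And>k. k \<ge> N \<Longrightarrow> U k \<noteq> 0"
    unfolding eventually_sequentially by blast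
  have xy: "x k \<noteq> y" if "k \<ge> N" for k using N(2)[OF that] s(1)[of k] by (simp add: x_def)
  have bm: "bounded_multipliers \<kappa> q (x (k + N))" for k
    using V(3)[of "x (k + N)"] N(1)[of "k + N"] xG xy[of "k + N"] by simp
  obtain r L lam I Ip where r: "strict_mono (r::nat\<Rightarrow>nat)" and L: "L \<longlonglongrightarrow> lam"
    and A: "\<And>k. active q (x (r k + N)) = I" "\<And>k. L k \<in> normal_orthant q (x (r k + N))"
      "\<And>k. Y (r k + N) = gradsum q (x (r k + N)) (L k)" "\<And>k. {i. L k $ i > 0} = Ip"
    by (rule multiplier_subsequence[of \<kappa> q "\<lambda>k. x (k + N)" "\<lambda>k. Y (k + N)" ys,
          OF bm Yx LIMSEQ_ignore_initial_segment[OF Y]]) (rule that; assumption)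
  define \<rho> where "\<rho> k = r k + N" for k
  have \<rho>: "strict_mono \<rho>" using r by (simp add: \<rho>_def strict_mono_def)
  note sub = LIMSEQ_subseq_LIMSEQ[OF _ \<rho>, unfolded o_def]
  have a: "\<And>k. 0 < s (\<rho> k)" "\<And>k. 0 < t (\<rho> k)" "\<And>k. y + s (\<rho> k) *\<^sub>R U (\<rho> k) \<in> Gam q"
    "\<And>k. active q (y + s (\<rho> k) *\<^sub>R U (\<rho> k)) = I"
    "\<And>k. L k \<in> normal_orthant q (y + s (\<rho> k) *\<^sub>R U (\<rho> k))"
    "\<And>k. ys + t (\<rho> k) *\<^sub>R W (\<rho> k) = gradsum q (y + s (\<rho> k) *\<^sub>R U (\<rho> k)) (L k)"
    using s(1) t(1) xG A by (simp_all add: x_def Y_def \<rho>_def)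
  \<comment> \<open>The hypotheses of the limit context, instantiated with the subsequence \<rho>
    and in the order in which that context lists them.\<close>
  note seq = q2 y a(1) sub[OF s(2)] sub[OF U] a(2) sub[OF t(2)] sub[OF st] sub[OF W] a(3-6) A(4) L
  have lic: "two_LICQ q y u" by (rule licq[OF u_critK[OF seq]])
  then obtain \<epsilon> \<delta> where ed: "\<epsilon> > 0" "\<delta> > 0"
     "\<And>x. x \<in> (\<lambda>d. y + d) ` dir_nbhd \<epsilon> \<delta> u \<inter> Gam q \<Longrightarrow> x \<noteq> y \<Longrightarrow> two_regular q (active q x) y u"
    unfolding two_LICQ_def by blast
  have "\<forall>\<^sub>F k in sequentially. s (\<rho> k) *\<^sub>R U (\<rho> k) \<in> dir_nbhd \<epsilon> \<delta> u"
    by (rule dir_nbhd_eventually[OF u _ sub[OF s(2)] sub[OF U] ed(1,2)]) (rule s)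
  \<comment> \<open>One index is enough, as the active set is \<open>I\<close> along the whole
    subsequence.\<close>
  then obtain k where k: "s (\<rho> k) *\<^sub>R U (\<rho> k) \<in> dir_nbhd \<epsilon> \<delta> u"
    using eventually_happens by fastforce
  have reg: "two_regular q I y u"
  proof -
    have "x (\<rho> k) \<in> (\<lambda>d. y + d) ` dir_nbhd \<epsilon> \<delta> u \<inter> Gam q" using k xG by (auto simp: x_def)
    then have "two_regular q (active q (x (\<rho> k))) y u" by (rule ed(3)) (simp add: xy \<rho>_def)
    then show ?thesis using a(4)[of k] by (simp add: x_def)
  qed
  have "(ws, w) \<in> Qset q y u lam Ip I"
    by (rule Qset_limit[OF seq reg Z sub[OF Zlim]])
  then show ?thesis
    using u_critK[OF seq] lam_maximal[OF seq] ex_mu[OF seq] ex_Jbar[OF seq] Ip_subset[OF seq] by blast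
qed

text \<open>The speed of the normals is a function \<open>g\<close> of that of the points, because
  \<open>curve_sequence\<close> produces \<open>s\<close> and the second speed can be set only
  afterwards. The identity serves nonzero directions, the square root the direction
  \<open>(0, vs)\<close>.\<close>

lemma realize_directional_normals:
  assumes u: "u \<noteq> 0" "u \<in> Tlin q y" and reg: "\<And>J. J \<in> Jmax q y u \<Longrightarrow> two_regular q J y u"
    and lam: "lam \<in> Lam q y ys" and mu: "mu \<in> contingent_cone (normal_orthant q y) lam"
    and J: "J \<in> Jbar q y u" and I: "Iplus lam mu \<subseteq> Ip" "Ip \<subseteq> I" "I \<subseteq> J"
    and Q: "(ws, w) \<in> Qset q y u lam Ip I"
    and g: "\<And>\<sigma>. \<sigma> > (0::real) \<Longrightarrow> g \<sigma> > 0" "(g \<longlongrightarrow> 0) (at_right 0)" "((\<lambda>\<sigma>. \<sigma> / g \<sigma>) \<longlongrightarrow> \<beta>) (at_right 0)"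
  shows "\<exists>s U W Z. (\<forall>k. s k > (0::real)) \<and> (\<lambda>k. g (s k)) \<longlonglongrightarrow> 0 \<and> (\<lambda>k. s k / g (s k)) \<longlonglongrightarrow> \<beta> \<and> U \<longlonglongrightarrow> u \<and>
     (\<forall>k. U k \<noteq> 0) \<and> W \<longlonglongrightarrow> \<beta> *\<^sub>R (hessL q lam y *v u) + gradsum q y mu \<and> Z \<longlonglongrightarrow> (ws, w) \<and>
     (\<forall>k::nat. Z k \<in> regular_normal_cone (normal_graph q)
        (y + s k *\<^sub>R U k, ys + g (s k) *\<^sub>R W k))"
proof -
  \<comment> \<open>Only maximal index sets are known to be 2-regular; \<open>I\<close> inherits
    this from a maximal set above \<open>J\<close>.\<close>
  obtain J' where J': "J' \<in> Jmax q y u" "J \<subseteq> J'" using Jmax_above[OF J] by blast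
  have IJ': "I \<subseteq> J'" using I J' by blast
  have regI: "two_regular q I y u" by (rule two_regular_mono[OF reg[OF J'(1)] IJ'])
  obtain s U where s: "\<And>k. s k > (0::real)" "s \<longlonglongrightarrow> 0" and U: "U \<longlonglongrightarrow> u"
      and X: "\<And>k. y + s k *\<^sub>R U k \<in> Gam q" "\<And>k. active q (y + s k *\<^sub>R U k) = I"
    using curve_sequence[OF q2 y u(2) J'(1) reg[OF J'(1)] IJ'] by blast
  have right: "filterlim s (at_right 0) sequentially"
    using s by (simp add: filterlim_at less_imp_neq[symmetric])
  have t: "(\<lambda>k. g (s k)) \<longlonglongrightarrow> 0" and st: "(\<lambda>k. s k / g (s k)) \<longlonglongrightarrow> \<beta>"
    using filterlim_compose[OF g(2) right] filterlim_compose[OF g(3) right] by simp_all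
  obtain W Z where W: "W \<longlonglongrightarrow> \<beta> *\<^sub>R (hessL q lam y *v u) + gradsum q y mu" and Z: "Z \<longlonglongrightarrow> (ws, w)"
     and ev: "\<forall>\<^sub>F k in sequentially. Z k \<in> regular_normal_cone (normal_graph q)
        (y + s k *\<^sub>R U k, ys + g (s k) *\<^sub>R W k)"
    using realize_normals[OF q2 vic lam mu I(1,2) regI u(1) s U X _ t st Q] g(1) s(1) by blast
  obtain N where N: "\<And>k. k \<ge> N \<Longrightarrow> Z k \<in> regular_normal_cone (normal_graph q)
        (y + s k *\<^sub>R U k, ys + g (s k) *\<^sub>R W k) \<and> U k \<noteq> 0"
    using eventually_conj[OF ev tendsto_imp_eventually_ne[OF U u(1)]] unfolding eventually_sequentially by blast
  show ?thesis
  proof (rule exI[of _ "\<lambda>k. s (k + N)"], rule exI[of _ "\<lambda>k. U (k + N)"], rule exI[of _ "\<lambda>k. W (k + N)"],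
      rule exI[of _ "\<lambda>k. Z (k + N)"], intro conjI)
    show "(\<lambda>k. g (s (k + N))) \<longlonglongrightarrow> 0" using LIMSEQ_ignore_initial_segment[OF t] .
    show "(\<lambda>k. s (k + N) / g (s (k + N))) \<longlonglongrightarrow> \<beta>" using LIMSEQ_ignore_initial_segment[OF st] .
    show "(\<lambda>k. U (k + N)) \<longlonglongrightarrow> u" using LIMSEQ_ignore_initial_segment[OF U] .
    show "(\<lambda>k. W (k + N)) \<longlonglongrightarrow> \<beta> *\<^sub>R (hessL q lam y *v u) + gradsum q y mu" using LIMSEQ_ignore_initial_segment[OF W] .
    show "(\<lambda>k. Z (k + N)) \<longlonglongrightarrow> (ws, w)" using LIMSEQ_ignore_initial_segment[OF Z] .
  qed (use s(1) N in auto)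
qed

lemma nonzero_direction_subset:
  assumes v: "v \<noteq> 0" and licq: "two_LICQ q y v"
    and z: "(ws, w) \<in> dir_normal_cone (normal_graph q) (y, ys) (v, vs)"
  shows "\<exists>lam mu J Ip I. (lam, mu) \<in> Mbar q y ys v vs \<and> J \<in> Jbar q y v \<and> Iplus lam mu \<subseteq> Ip \<and>
    Ip \<subseteq> I \<and> I \<subseteq> J \<and> (ws, w) \<in> Qset q y v lam Ip I"
proof -
  obtain t :: "nat \<Rightarrow> real" and U Z where t: "\<And>k. t k > 0" "t \<longlonglongrightarrow> 0" and U: "U \<longlonglongrightarrow> (v, vs)" and Zlim: "Z \<longlonglongrightarrow> (ws, w)"
    and Z: "\<And>k. Z k \<in> regular_normal_cone (normal_graph q) ((y, ys) + t k *\<^sub>R U k)"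
    using z unfolding dir_normal_cone_def by blast
  have "(\<lambda>k. t k / t k) \<longlonglongrightarrow> 1" using t(1) by (simp add: less_imp_neq[symmetric])
  moreover have "Z k \<in> regular_normal_cone (normal_graph q)
      (y + t k *\<^sub>R fst (U k), ys + t k *\<^sub>R snd (U k))" for k
  proof -
    have "(y, ys) + t k *\<^sub>R U k = (y + t k *\<^sub>R fst (U k), ys + t k *\<^sub>R snd (U k))" by (simp add: prod_eq_iff)
    then show ?thesis using Z[of k] by simp
  qed
  moreover have "(\<lambda>k. fst (U k)) \<longlonglongrightarrow> v" "(\<lambda>k. snd (U k)) \<longlonglongrightarrow> vs"
    using tendsto_fst[OF U] tendsto_snd[OF U] by simp_all
  ultimately have "\<exists>lam\<in>Lam_dir q y ys v. \<exists>mu\<in>contingent_cone (normal_orthant q y) lam.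
    vs = 1 *\<^sub>R (hessL q lam y *v v) + gradsum q y mu \<and>
    (\<exists>J\<in>Jbar q y v. \<exists>Ip I. Iplus lam mu \<subseteq> Ip \<and> Ip \<subseteq> I \<and> I \<subseteq> J \<and> (ws, w) \<in> Qset q y v lam Ip I)"
    using forward_inclusion[of v t "\<lambda>k. fst (U k)" t 1 "\<lambda>k. snd (U k)" vs Z ys ws w] v t Zlim licq by blast
  then obtain lam mu J Ip I where *: "lam \<in> Lam_dir q y ys v"
    "mu \<in> contingent_cone (normal_orthant q y) lam" "vs = hessL q lam y *v v + gradsum q y mu"
    "J \<in> Jbar q y v" "Iplus lam mu \<subseteq> Ip" "Ip \<subseteq> I" "I \<subseteq> J" "(ws, w) \<in> Qset q y v lam Ip I"
    by auto
  then have "(lam, mu) \<in> Mbar q y ys v vs" by (simp add: Mbar_iff[OF q2])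
  then show ?thesis using * by blast
qed

lemma nonzero_direction_supset:
  assumes v: "v \<noteq> 0" and licq: "two_LICQ q y v"
    and reg: "\<And>J. J \<in> Jmax q y v \<Longrightarrow> two_regular q J y v"
    and M: "(lam, mu) \<in> Mbar q y ys v vs" and J: "J \<in> Jbar q y v"
    and I: "Iplus lam mu \<subseteq> Ip" "Ip \<subseteq> I" "I \<subseteq> J" and Q: "(ws, w) \<in> Qset q y v lam Ip I"
  shows "(ws, w) \<in> dir_normal_cone (normal_graph q) (y, ys) (v, vs)"
proof -
  have vT: "v \<in> Tlin q y" using licq by (simp add: two_LICQ_def)
  have lam: "lam \<in> Lam q y ys" and mu: "mu \<in> contingent_cone (normal_orthant q y) lam"
    and vs: "vs = hessL q lam y *v v + gradsum q y mu"
    using M Lam_dir_subset by (auto simp: Mbar_iff[OF q2])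
  have "((\<lambda>\<sigma>::real. \<sigma> / \<sigma>) \<longlongrightarrow> 1) (at_right 0)"
    by (rule tendsto_eventually) (auto intro!: eventually_mono[OF eventually_at_right_less[of 0]])
  then obtain s U W Z where s: "\<forall>k. s k > (0::real)" "s \<longlonglongrightarrow> 0" and U: "U \<longlonglongrightarrow> v"
    and W: "W \<longlonglongrightarrow> 1 *\<^sub>R (hessL q lam y *v v) + gradsum q y mu" and Z: "Z \<longlonglongrightarrow> (ws, w)"
    and mem: "\<forall>k::nat. Z k \<in> regular_normal_cone (normal_graph q) (y + s k *\<^sub>R U k, ys + s k *\<^sub>R W k)"
    using realize_directional_normals[OF v vT reg lam mu J I Q, of "\<lambda>\<sigma>. \<sigma>" 1] tendsto_ident_at by blast
  have "(\<lambda>k. (U k, W k)) \<longlonglongrightarrow> (v, vs)" using tendsto_Pair[OF U W] vs by simp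
  moreover have "Z k \<in> regular_normal_cone (normal_graph q) ((y, ys) + s k *\<^sub>R (U k, W k))" for k
    using mem by simp
  ultimately show ?thesis unfolding dir_normal_cone_def using s Z by blast
qed

text \<open>The displacement \<open>t k A k\<close> of the points is rewritten, along a subsequence,
  as \<open>s k E k\<close> with unit vectors \<open>E k\<close> and
  \<open>s k = t k * norm (A k)\<close>. Then \<open>s k / t k\<close> tends to \<open>0\<close>,
  and the limit of the \<open>E k\<close> is the direction \<open>u\<close>.\<close>

lemma zero_direction_subset:
  assumes licq: "\<And>u. u \<in> critK q y ys \<Longrightarrow> u \<noteq> 0 \<Longrightarrow> two_LICQ q y u"
    and z: "(ws, w) \<in> dir_normal_cone1 (normal_graph q) (y, ys) (0, vs)"
  shows "(ws, w) \<in> (\<Union>u \<in> {u \<in> critK q y ys. norm u = 1}.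
    \<Union>(lam, mu) \<in> {(lam, mu) \<in> Mbar q y ys 0 vs. lam \<in> Lam_dir q y ys u}. \<Union>J \<in> Jbar q y u.
      \<Union>Ip \<in> {Ip. Iplus lam mu \<subseteq> Ip}. \<Union>I \<in> {I. Ip \<subseteq> I \<and> I \<subseteq> J}. Qset q y u lam Ip I)"
proof -
  obtain t :: "nat \<Rightarrow> real" and U Z where t: "\<And>k. t k > 0" "t \<longlonglongrightarrow> 0" and U: "U \<longlonglongrightarrow> (0, vs)" and Zlim: "Z \<longlonglongrightarrow> (ws, w)"
    and ne: "\<And>k. fst (U k) \<noteq> 0"
    and Z: "\<And>k. Z k \<in> regular_normal_cone (normal_graph q) ((y, ys) + t k *\<^sub>R U k)"
    using z unfolding dir_normal_cone1_def by blast
  define A where "A k = fst (U k)" for k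
  define B where "B k = snd (U k)" for k
  have A: "A \<longlonglongrightarrow> 0" and B: "B \<longlonglongrightarrow> vs"
    using tendsto_fst[OF U] tendsto_snd[OF U] by (simp_all add: A_def[abs_def] B_def[abs_def])
  have A0: "A k \<noteq> 0" for k using ne by (simp add: A_def)
  define E where "E k = A k /\<^sub>R norm (A k)" for k
  have nE: "norm (E k) = 1" for k using A0[of k] by (simp add: E_def)
  have "bounded (range E)" unfolding bounded_iff using nE by auto
  then obtain u r where r: "strict_mono (r::nat\<Rightarrow>nat)" and u: "(E \<circ> r) \<longlonglongrightarrow> u"
    using bounded_imp_convergent_subsequence[of E] by blast
  note sub = LIMSEQ_subseq_LIMSEQ[OF _ r, unfolded o_def]
  have u: "(\<lambda>k. E (r k)) \<longlonglongrightarrow> u" using u by (simp add: o_def)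
  have nu: "norm u = 1" using tendsto_norm[OF u] nE by (simp add: LIMSEQ_const_iff)
  define s where "s k = t (r k) * norm (A (r k))" for k
  have s: "s k > 0" for k using t(1) A0 by (simp add: s_def)
  have s0: "s \<longlonglongrightarrow> 0"
    unfolding s_def using tendsto_mult[OF sub[OF t(2)] tendsto_norm[OF sub[OF A]]] by simp
  have "s k / t (r k) = norm (A (r k))" for k using t(1)[of "r k"] by (simp add: s_def)
  then have st: "(\<lambda>k. s k / t (r k)) \<longlonglongrightarrow> 0" using tendsto_norm[OF sub[OF A]] by simp
  have mem: "Z (r k) \<in> regular_normal_cone (normal_graph q)
      (y + s k *\<^sub>R E (r k), ys + t (r k) *\<^sub>R B (r k))" for k
  proof -
    have "(y, ys) + t (r k) *\<^sub>R U (r k) = (y + s k *\<^sub>R E (r k), ys + t (r k) *\<^sub>R B (r k))"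
      using A0[of "r k"] by (simp add: prod_eq_iff s_def E_def B_def flip: A_def)
    then show ?thesis using Z[of "r k"] by simp
  qed
  have u0: "u \<noteq> 0" using nu by auto
  have "u \<in> critK q y ys \<and> (\<exists>lam\<in>Lam_dir q y ys u. \<exists>mu\<in>contingent_cone (normal_orthant q y) lam.
    vs = 0 *\<^sub>R (hessL q lam y *v u) + gradsum q y mu \<and>
    (\<exists>J\<in>Jbar q y u. \<exists>Ip I. Iplus lam mu \<subseteq> Ip \<and> Ip \<subseteq> I \<and> I \<subseteq> J \<and> (ws, w) \<in> Qset q y u lam Ip I))"
    by (rule forward_inclusion[OF u0 s s0 u _ sub[OF t(2)] st sub[OF B] mem sub[OF Zlim]])
      (use t licq u0 in auto)
  then obtain lam mu J Ip I where *: "u \<in> critK q y ys" "lam \<in> Lam_dir q y ys u"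
    "mu \<in> contingent_cone (normal_orthant q y) lam" "vs = gradsum q y mu"
    "J \<in> Jbar q y u" "Iplus lam mu \<subseteq> Ip" "Ip \<subseteq> I" "I \<subseteq> J" "(ws, w) \<in> Qset q y u lam Ip I"
    by auto
  have "(lam, mu) \<in> Mbar q y ys 0 vs"
    using *(2,3,4) Lam_dir_subset[OF *(2)] by (simp add: Mbar_iff[OF q2] Lam_dir_zero)
  then show ?thesis using * nu by blast
qed

text \<open>With normals moving at speed \<open>sqrt s\<close> and points at speed \<open>s\<close>,
  the direction of the points measured in the speed of the normals tends to \<open>0\<close> without
  ever vanishing, as \<open>dir_normal_cone1\<close> demands.\<close>

lemma zero_direction_supset:
  assumes reg: "\<And>J. J \<in> Jmax q y u \<Longrightarrow> two_regular q J y u"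
    and u: "u \<in> critK q y ys" "norm u = 1"
    and M: "(lam, mu) \<in> Mbar q y ys 0 vs" and J: "J \<in> Jbar q y u"
    and I: "Iplus lam mu \<subseteq> Ip" "Ip \<subseteq> I" "I \<subseteq> J" and Q: "(ws, w) \<in> Qset q y u lam Ip I"
  shows "(ws, w) \<in> dir_normal_cone1 (normal_graph q) (y, ys) (0, vs)"
proof -
  have uT: "u \<in> Tlin q y" using u(1) contingent_subset_Tlin[OF q2 y] by (auto simp: critK_def)
  have u0: "u \<noteq> 0" using u(2) by auto
  have lam: "lam \<in> Lam q y ys" and mu: "mu \<in> contingent_cone (normal_orthant q y) lam"
    and vs: "vs = gradsum q y mu"
    using M by (auto simp: Mbar_iff[OF q2] Lam_dir_zero)
  have sqrt0: "(sqrt \<longlongrightarrow> 0) (at_right 0)"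
    using tendsto_real_sqrt[OF tendsto_ident_at[of 0 "{0<..}"]] by simp
  have "((\<lambda>\<sigma>. \<sigma> / sqrt \<sigma>) \<longlongrightarrow> 0) (at_right 0)"
  proof (rule Lim_transform_eventually[OF sqrt0])
    show "\<forall>\<^sub>F \<sigma> in at_right 0. sqrt \<sigma> = \<sigma> / sqrt \<sigma>"
      by (rule eventually_mono[OF eventually_at_right_less[of 0]]) (simp add: real_div_sqrt)
  qed
  then obtain s U W Z where s: "\<And>k. s k > (0::real)" "(\<lambda>k. sqrt (s k)) \<longlonglongrightarrow> 0" "(\<lambda>k. s k / sqrt (s k)) \<longlonglongrightarrow> 0"
    and U: "U \<longlonglongrightarrow> u" "\<And>k. U k \<noteq> 0"
    and W: "W \<longlonglongrightarrow> 0 *\<^sub>R (hessL q lam y *v u) + gradsum q y mu" and Z: "Z \<longlonglongrightarrow> (ws, w)"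
    and mem: "\<And>k::nat. Z k \<in> regular_normal_cone (normal_graph q)
        (y + s k *\<^sub>R U k, ys + sqrt (s k) *\<^sub>R W k)"
    using realize_directional_normals[OF u0 uT reg lam mu J I Q, of sqrt 0] sqrt0 by auto
  define A where "A k = (s k / sqrt (s k)) *\<^sub>R U k" for k
  have "A \<longlonglongrightarrow> 0" unfolding A_def using tendsto_scaleR[OF s(3) U(1)] by simp
  then have "(\<lambda>k. (A k, W k)) \<longlonglongrightarrow> (0, vs)" using tendsto_Pair[OF _ W] vs by simp
  moreover have "Z k \<in> regular_normal_cone (normal_graph q) ((y, ys) + sqrt (s k) *\<^sub>R (A k, W k))" for k
    using mem[of k] s(1)[of k] by (simp add: A_def)
  moreover have "fst (A k, W k) \<noteq> 0" for k using U(2)[of k] s(1)[of k] by (simp add: A_def)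
  moreover have "sqrt (s k) > 0" for k using s(1)[of k] by simp
  ultimately show ?thesis
    unfolding dir_normal_cone1_def using s(2) Z
    by (intro CollectI exI[of _ "\<lambda>k. sqrt (s k)"] exI[of _ "\<lambda>k. (A k, W k)"] exI[of _ Z]) blast
qed

end

theorem theorem3:
  fixes q :: "real^'m \<Rightarrow> real^'l"
    and y ys v vs :: "real^'m"
  assumes "twice_cont_diff q"
    and "y \<in> Gam q"
    and "ys \<in> regular_normal_cone (Gam q) y"
    and "(v, vs) \<noteq> 0"
    and "(v, vs) \<in> contingent_cone (gph (regular_normal_cone (Gam q))) (y, ys)"
    and "metrically_subregular (Mq q) y 0"
    and "metrically_regular_vicinity q y"
  shows
   "(v \<noteq> 0 \<longrightarrow> two_LICQ q y v \<longrightarrow>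
      (let N = dir_normal_cone (gph (regular_normal_cone (Gam q))) (y, ys) (v, vs);
           R = (\<Union>(lam, mu) \<in> Mbar q y ys v vs. \<Union>J \<in> Jbar q y v.
                  \<Union>Ip \<in> {Ip. Iplus lam mu \<subseteq> Ip}. \<Union>I \<in> {I. Ip \<subseteq> I \<and> I \<subseteq> J}.
                    Qset q y v lam Ip I)
       in N \<subseteq> R \<and> ((\<forall>J \<in> Jmax q y v. two_regular q J y v) \<longrightarrow> N = R)))
    \<and>
    (v = 0 \<longrightarrow> (\<forall>u \<in> critK q y ys. u \<noteq> 0 \<longrightarrow> two_LICQ q y u) \<longrightarrow>
      (let N = dir_normal_cone1 (gph (regular_normal_cone (Gam q))) (y, ys) (0, vs);
           R = (\<Union>vt \<in> {vt \<in> critK q y ys. norm vt = 1}.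
                  \<Union>(lam, mu) \<in> {(lam, mu) \<in> Mbar q y ys 0 vs. lam \<in> Lam_dir q y ys vt}.
                  \<Union>J \<in> Jbar q y vt.
                  \<Union>Ip \<in> {Ip. Iplus lam mu \<subseteq> Ip}. \<Union>I \<in> {I. Ip \<subseteq> I \<and> I \<subseteq> J}.
                    Qset q y vt lam Ip I)
       in N \<subseteq> R \<and>
          ((\<forall>u \<in> critK q y ys. u \<noteq> 0 \<longrightarrow> (\<forall>J \<in> Jmax q y u. two_regular q J y u)) \<longrightarrow> N = R)))"
proof (intro conjI impI, goal_cases)
  note setting = assms(1,2,7)
  case 1
  note v = \<open>v \<noteq> 0\<close> and licq = \<open>two_LICQ q y v\<close>
  show ?case
    unfolding Let_def
  \<comment> \<open>The first two cases are the same inclusion, once on its own and once as half of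
    the equality.\<close>
  proof (intro conjI impI equalityI subrelI, goal_cases)
    case (1 ws w)
    from nonzero_direction_subset[OF setting v licq 1] show ?case by blast
  next
    case (2 ws w)
    from nonzero_direction_subset[OF setting v licq 2(2)] show ?case by blast
  next
    case (3 ws w)
    then obtain lam mu J Ip I where "(lam, mu) \<in> Mbar q y ys v vs" "J \<in> Jbar q y v"
        "Iplus lam mu \<subseteq> Ip" "Ip \<subseteq> I" "I \<subseteq> J" "(ws, w) \<in> Qset q y v lam Ip I"
      by blast
    from nonzero_direction_supset[OF setting v licq _ this] 3(1) show ?case by blast
  qed
next
  note setting = assms(1,2,7)
  case 2
  note licq = \<open>\<forall>u\<in>critK q y ys. u \<noteq> 0 \<longrightarrow> two_LICQ q y u\<close>
  show ?case
    unfolding Let_def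
  proof (intro conjI impI equalityI subrelI, goal_cases)
    case (1 ws w)
    show ?case by (rule zero_direction_subset[OF setting _ 1]) (use licq in blast)
  next
    case (2 ws w)
    show ?case by (rule zero_direction_subset[OF setting _ 2(2)]) (use licq in blast)
  next
    case (3 ws w)
    then obtain u lam mu J Ip I where u: "u \<in> critK q y ys" "norm u = 1"
      and *: "(lam, mu) \<in> Mbar q y ys 0 vs" "J \<in> Jbar q y u" "Iplus lam mu \<subseteq> Ip" "Ip \<subseteq> I" "I \<subseteq> J"
        "(ws, w) \<in> Qset q y u lam Ip I"
      by blast
    have "two_regular q J y u" if "J \<in> Jmax q y u" for J using 3(1) u that by force
    from zero_direction_supset[OF setting this u *] show ?case .
  qed
qed

end
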